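(* If $A:\mathcal U^e$ is a cofibrant exo-type and the natural number exo-type $\mathbb N^e$ is cofibrant, then the exo-type $\mathsf{List}^e(A)$ of finite exo-lists of terms of $A$ is cofibrant.
   Context: Setting: two-level type theory (2LTT). There is a hierarchy of universes $\mathcal U$ whose terms are called types and which obeys homotopy type theory (with the usual $\prod,\sum,+,\mathbf 1,\mathbf 0,\mathbb N$ and identity type $=$), and a hierarchy of exo-universes $\mathcal U^e$ whose terms are called exo-types, with their own formers $\prod^e,\sum^e,+^e,\mathbf 1^e,\mathbf 0^e,\mathbb N^e$ and exo-equality $=^e$. Every type is also an exo-type. Exo-level inductive exo-types eliminate into arbitrary exo-types, while inductive types eliminate only into types. Axioms: univalence (hence function extensionality) for $=$; function extensionality and uniqueness of identity proofs for $=^e$. An exo-isomorphism $A\cong B$ of exo-types consists of $f:A\to B$, $g:B\to A$ with $f\circ g=^e\mathrm{id}_B$ and $g\circ f=^e\mathrm{id}_A$. An exo-type $A$ is fibrant if there is a type $RA:\mathcal U$ (its fibrant match) with $A\cong RA$. An exo-type $A$ is cofibrant if (1) for any $Y:A\to\mathcal U$ the exo-type $\prod^e_{a:A}Y(a)$ is fibrant, and (2) in that case, if each $Y(a)$ is contractible (with respect to $=$), then so is the fibrant match of $\prod^e_{a:A}Y(a)$. For $A:\mathcal U^e$, $\mathsf{List}^e(A):\mathcal U^e$ is the inductive exo-type with constructors $[\,]^e:\mathsf{List}^e(A)$ and $::^e\;:A\to\mathsf{List}^e(A)\to\mathsf{List}^e(A)$. *)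

theory Defs
  imports Main
begin

text \<open>
  Two-level type theory (2LTT), deeply embedded with de Bruijn indices. The rules follow the
  appendix of the HoTT book: dependent eliminators whose branches are terms with bound variables,
  computation rules for all of them, and the uniqueness rule for functions. As both levels have the
  same formers, these are written once and are indexed by the level. The universes are Russell style
  and cumulative, and every type is an exo-type without an explicit coercion.
\<close>

subsection \<open>Syntax\<close>

datatype level = Inner | Exo

text \<open>
  Bound variables: one in the last argument of \<open>Pi\<close> and \<open>Sig\<close> and in \<open>Lam\<close>; in the eliminators
  the first argument is the motive, which binds the eliminated term (for \<open>EqInd\<close>, the two end points
  and the proof), the next ones are the branches, which bind the arguments of the constructor
  and then the induction hypothesis if there is one, and the last one is the eliminated term.
  For \<open>EqInd\<close> the last three arguments are the end points and the proof.
\<close>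

datatype tm =
    Var nat
  | Univ level nat
  | Pi level tm tm | Lam level tm | App level tm tm
  | Sig level tm tm | Pair level tm tm | SigInd level tm tm tm
  | Plus level tm tm | InjL level tm | InjR level tm | PlusInd level tm tm tm tm
  | One level | Star level | OneInd level tm tm tm
  | Zero level | ZeroInd level tm tm
  | Nat level | NZero level | NSuc level tm | NatInd level tm tm tm tm
  | Eq level tm tm tm | Refl level tm | EqInd level tm tm tm tm tm
  | List tm | LNil | LCons tm tm | ListInd tm tm tm tm
  | Univalence nat | FunextE nat | UipE nat

definition upren :: "(nat \<Rightarrow> nat) \<Rightarrow> nat \<Rightarrow> nat" where
  "upren r = case_nat 0 (\<lambda>n. Suc (r n))"

primrec ren :: "(nat \<Rightarrow> nat) \<Rightarrow> tm \<Rightarrow> tm" where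
  "ren r (Var n) = Var (r n)"
| "ren r (Univ s i) = Univ s i"
| "ren r (Pi s A B) = Pi s (ren r A) (ren (upren r) B)"
| "ren r (Lam s b) = Lam s (ren (upren r) b)"
| "ren r (App s f a) = App s (ren r f) (ren r a)"
| "ren r (Sig s A B) = Sig s (ren r A) (ren (upren r) B)"
| "ren r (Pair s a b) = Pair s (ren r a) (ren r b)"
| "ren r (SigInd s C c p) = SigInd s (ren (upren r) C) (ren (upren (upren r)) c) (ren r p)"
| "ren r (Plus s A B) = Plus s (ren r A) (ren r B)"
| "ren r (InjL s a) = InjL s (ren r a)"
| "ren r (InjR s b) = InjR s (ren r b)"
| "ren r (PlusInd s C c d e) =
     PlusInd s (ren (upren r) C) (ren (upren r) c) (ren (upren r) d) (ren r e)"
| "ren r (One s) = One s"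
| "ren r (Star s) = Star s"
| "ren r (OneInd s C c a) = OneInd s (ren (upren r) C) (ren r c) (ren r a)"
| "ren r (Zero s) = Zero s"
| "ren r (ZeroInd s C a) = ZeroInd s (ren (upren r) C) (ren r a)"
| "ren r (Nat s) = Nat s"
| "ren r (NZero s) = NZero s"
| "ren r (NSuc s n) = NSuc s (ren r n)"
| "ren r (NatInd s C c d n) =
     NatInd s (ren (upren r) C) (ren r c) (ren (upren (upren r)) d) (ren r n)"
| "ren r (Eq s A a b) = Eq s (ren r A) (ren r a) (ren r b)"
| "ren r (Refl s a) = Refl s (ren r a)"
| "ren r (EqInd s C c a b p) =
     EqInd s (ren (upren (upren (upren r))) C) (ren (upren r) c) (ren r a) (ren r b) (ren r p)"
| "ren r (List A) = List (ren r A)"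
| "ren r LNil = LNil"
| "ren r (LCons a l) = LCons (ren r a) (ren r l)"
| "ren r (ListInd C c d l) =
     ListInd (ren (upren r) C) (ren r c) (ren (upren (upren (upren r))) d) (ren r l)"
| "ren r (Univalence i) = Univalence i"
| "ren r (FunextE i) = FunextE i"
| "ren r (UipE i) = UipE i"

abbreviation wk :: "tm \<Rightarrow> tm" where
  "wk \<equiv> ren Suc"

abbreviation scons :: "tm \<Rightarrow> (nat \<Rightarrow> tm) \<Rightarrow> nat \<Rightarrow> tm"  (infixr \<open>\<cdot>\<close> 65) where
  "t \<cdot> \<sigma> \<equiv> case_nat t \<sigma>"

definition up :: "(nat \<Rightarrow> tm) \<Rightarrow> nat \<Rightarrow> tm" where
  "up \<sigma> = Var 0 \<cdot> (\<lambda>n. wk (\<sigma> n))"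

primrec subst :: "(nat \<Rightarrow> tm) \<Rightarrow> tm \<Rightarrow> tm" where
  "subst \<sigma> (Var n) = \<sigma> n"
| "subst \<sigma> (Univ s i) = Univ s i"
| "subst \<sigma> (Pi s A B) = Pi s (subst \<sigma> A) (subst (up \<sigma>) B)"
| "subst \<sigma> (Lam s b) = Lam s (subst (up \<sigma>) b)"
| "subst \<sigma> (App s f a) = App s (subst \<sigma> f) (subst \<sigma> a)"
| "subst \<sigma> (Sig s A B) = Sig s (subst \<sigma> A) (subst (up \<sigma>) B)"
| "subst \<sigma> (Pair s a b) = Pair s (subst \<sigma> a) (subst \<sigma> b)"
| "subst \<sigma> (SigInd s C c p) = SigInd s (subst (up \<sigma>) C) (subst (up (up \<sigma>)) c) (subst \<sigma> p)"
| "subst \<sigma> (Plus s A B) = Plus s (subst \<sigma> A) (subst \<sigma> B)"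
| "subst \<sigma> (InjL s a) = InjL s (subst \<sigma> a)"
| "subst \<sigma> (InjR s b) = InjR s (subst \<sigma> b)"
| "subst \<sigma> (PlusInd s C c d e) =
     PlusInd s (subst (up \<sigma>) C) (subst (up \<sigma>) c) (subst (up \<sigma>) d) (subst \<sigma> e)"
| "subst \<sigma> (One s) = One s"
| "subst \<sigma> (Star s) = Star s"
| "subst \<sigma> (OneInd s C c a) = OneInd s (subst (up \<sigma>) C) (subst \<sigma> c) (subst \<sigma> a)"
| "subst \<sigma> (Zero s) = Zero s"
| "subst \<sigma> (ZeroInd s C a) = ZeroInd s (subst (up \<sigma>) C) (subst \<sigma> a)"
| "subst \<sigma> (Nat s) = Nat s"
| "subst \<sigma> (NZero s) = NZero s"
| "subst \<sigma> (NSuc s n) = NSuc s (subst \<sigma> n)"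
| "subst \<sigma> (NatInd s C c d n) =
     NatInd s (subst (up \<sigma>) C) (subst \<sigma> c) (subst (up (up \<sigma>)) d) (subst \<sigma> n)"
| "subst \<sigma> (Eq s A a b) = Eq s (subst \<sigma> A) (subst \<sigma> a) (subst \<sigma> b)"
| "subst \<sigma> (Refl s a) = Refl s (subst \<sigma> a)"
| "subst \<sigma> (EqInd s C c a b p) =
     EqInd s (subst (up (up (up \<sigma>))) C) (subst (up \<sigma>) c)
       (subst \<sigma> a) (subst \<sigma> b) (subst \<sigma> p)"
| "subst \<sigma> (List A) = List (subst \<sigma> A)"
| "subst \<sigma> LNil = LNil"
| "subst \<sigma> (LCons a l) = LCons (subst \<sigma> a) (subst \<sigma> l)"
| "subst \<sigma> (ListInd C c d l) =
     ListInd (subst (up \<sigma>) C) (subst \<sigma> c) (subst (up (up (up \<sigma>))) d) (subst \<sigma> l)"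
| "subst \<sigma> (Univalence i) = Univalence i"
| "subst \<sigma> (FunextE i) = FunextE i"
| "subst \<sigma> (UipE i) = UipE i"

abbreviation inst :: "tm \<Rightarrow> tm \<Rightarrow> tm" where
  "inst B a \<equiv> subst (a \<cdot> Var) B"

text \<open>
  \<open>shifted k\<close> leaves the variables alone except that it makes room for \<open>k\<close> new ones;
  \<open>subst (t \<cdot> shifted k) C\<close> is \<open>C(t)\<close> for a term \<open>t\<close> that lives in an extension of the context by
  \<open>k\<close> variables.
\<close>

abbreviation shifted :: "nat \<Rightarrow> nat \<Rightarrow> tm" where
  "shifted k \<equiv> \<lambda>n. Var (n + k)"


subsection \<open>Judgmental equality\<close>

text \<open>
  Conversion of raw terms. Abstractions carry no domain: with one, eta and beta would identify
  abstractions that differ in the domain only.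
\<close>

inductive conv :: "tm \<Rightarrow> tm \<Rightarrow> bool"  (infix \<open>\<cong>\<close> 50) where
  conv_refl: "t \<cong> t"
| conv_sym: "t \<cong> u \<Longrightarrow> u \<cong> t"
| conv_trans: "t \<cong> u \<Longrightarrow> u \<cong> v \<Longrightarrow> t \<cong> v"

| beta_Pi: "App s (Lam s b) a \<cong> inst b a"
| eta_Pi: "Lam s (App s (wk f) (Var 0)) \<cong> f"
| beta_Sig: "SigInd s C c (Pair s a b) \<cong> subst (b \<cdot> a \<cdot> Var) c"
| beta_PlusL: "PlusInd s C c d (InjL s a) \<cong> inst c a"
| beta_PlusR: "PlusInd s C c d (InjR s b) \<cong> inst d b"
| beta_One: "OneInd s C c (Star s) \<cong> c"
| beta_NZero: "NatInd s C c d (NZero s) \<cong> c"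
| beta_NSuc: "NatInd s C c d (NSuc s n) \<cong> subst (NatInd s C c d n \<cdot> n \<cdot> Var) d"
| beta_Eq: "EqInd s C c a b (Refl s x) \<cong> inst c x"
| beta_LNil: "ListInd C c d LNil \<cong> c"
| beta_LCons: "ListInd C c d (LCons a l) \<cong> subst (ListInd C c d l \<cdot> l \<cdot> a \<cdot> Var) d"

| cong_Pi: "A \<cong> A' \<Longrightarrow> B \<cong> B' \<Longrightarrow> Pi s A B \<cong> Pi s A' B'"
| cong_Lam: "b \<cong> b' \<Longrightarrow> Lam s b \<cong> Lam s b'"
| cong_App: "f \<cong> f' \<Longrightarrow> a \<cong> a' \<Longrightarrow> App s f a \<cong> App s f' a'"
| cong_Sig: "A \<cong> A' \<Longrightarrow> B \<cong> B' \<Longrightarrow> Sig s A B \<cong> Sig s A' B'"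
| cong_Pair: "a \<cong> a' \<Longrightarrow> b \<cong> b' \<Longrightarrow> Pair s a b \<cong> Pair s a' b'"
| cong_SigInd: "C \<cong> C' \<Longrightarrow> c \<cong> c' \<Longrightarrow> p \<cong> p' \<Longrightarrow> SigInd s C c p \<cong> SigInd s C' c' p'"
| cong_Plus: "A \<cong> A' \<Longrightarrow> B \<cong> B' \<Longrightarrow> Plus s A B \<cong> Plus s A' B'"
| cong_InjL: "a \<cong> a' \<Longrightarrow> InjL s a \<cong> InjL s a'"
| cong_InjR: "b \<cong> b' \<Longrightarrow> InjR s b \<cong> InjR s b'"
| cong_PlusInd: "C \<cong> C' \<Longrightarrow> c \<cong> c' \<Longrightarrow> d \<cong> d' \<Longrightarrow> e \<cong> e' \<Longrightarrow>
    PlusInd s C c d e \<cong> PlusInd s C' c' d' e'"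
| cong_OneInd: "C \<cong> C' \<Longrightarrow> c \<cong> c' \<Longrightarrow> a \<cong> a' \<Longrightarrow> OneInd s C c a \<cong> OneInd s C' c' a'"
| cong_ZeroInd: "C \<cong> C' \<Longrightarrow> a \<cong> a' \<Longrightarrow> ZeroInd s C a \<cong> ZeroInd s C' a'"
| cong_NSuc: "n \<cong> n' \<Longrightarrow> NSuc s n \<cong> NSuc s n'"
| cong_NatInd: "C \<cong> C' \<Longrightarrow> c \<cong> c' \<Longrightarrow> d \<cong> d' \<Longrightarrow> n \<cong> n' \<Longrightarrow>
    NatInd s C c d n \<cong> NatInd s C' c' d' n'"
| cong_Eq: "A \<cong> A' \<Longrightarrow> a \<cong> a' \<Longrightarrow> b \<cong> b' \<Longrightarrow> Eq s A a b \<cong> Eq s A' a' b'"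
| cong_Refl: "a \<cong> a' \<Longrightarrow> Refl s a \<cong> Refl s a'"
| cong_EqInd: "C \<cong> C' \<Longrightarrow> c \<cong> c' \<Longrightarrow> a \<cong> a' \<Longrightarrow> b \<cong> b' \<Longrightarrow> p \<cong> p' \<Longrightarrow>
    EqInd s C c a b p \<cong> EqInd s C' c' a' b' p'"
| cong_List: "A \<cong> A' \<Longrightarrow> List A \<cong> List A'"
| cong_LCons: "a \<cong> a' \<Longrightarrow> l \<cong> l' \<Longrightarrow> LCons a l \<cong> LCons a' l'"
| cong_ListInd: "C \<cong> C' \<Longrightarrow> c \<cong> c' \<Longrightarrow> d \<cong> d' \<Longrightarrow> l \<cong> l' \<Longrightarrow>
    ListInd C c d l \<cong> ListInd C' c' d' l'"


subsection \<open>Types needed for the axioms and for cofibrancy\<close>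

abbreviation Arr :: "level \<Rightarrow> tm \<Rightarrow> tm \<Rightarrow> tm" where
  "Arr s A B \<equiv> Pi s A (wk B)"

abbreviation Prod :: "level \<Rightarrow> tm \<Rightarrow> tm \<Rightarrow> tm" where
  "Prod s A B \<equiv> Sig s A (wk B)"

abbreviation idfun :: "level \<Rightarrow> tm" where
  "idfun s \<equiv> Lam s (Var 0)"

abbreviation comp :: "level \<Rightarrow> tm \<Rightarrow> tm \<Rightarrow> tm" where
  "comp s f g \<equiv> Lam s (App s (wk f) (App s (wk g) (Var 0)))"

text \<open>\<open>\<Sum>(x:A). \<Prod>(y:A). x = y\<close>\<close>

definition is_contr :: "tm \<Rightarrow> tm" where
  "is_contr A = Sig Inner A (Pi Inner (wk A) (Eq Inner (wk (wk A)) (Var 1) (Var 0)))"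

text \<open>\<open>(\<Sum>(g:B\<rightarrow>A). \<Prod>(y:B). f (g y) = y) \<times> (\<Sum>(h:B\<rightarrow>A). \<Prod>(x:A). h (f x) = x)\<close>\<close>

definition is_equiv :: "tm \<Rightarrow> tm \<Rightarrow> tm \<Rightarrow> tm" where
  "is_equiv A B f = Prod Inner
     (Sig Inner (Arr Inner B A) (Pi Inner (wk B)
        (Eq Inner (wk (wk B)) (App Inner (wk (wk f)) (App Inner (Var 1) (Var 0))) (Var 0))))
     (Sig Inner (Arr Inner B A) (Pi Inner (wk A)
        (Eq Inner (wk (wk A)) (App Inner (Var 1) (App Inner (wk (wk f)) (Var 0))) (Var 0))))"

definition equiv_ty :: "tm \<Rightarrow> tm \<Rightarrow> tm" where
  "equiv_ty A B = Sig Inner (Arr Inner A B) (is_equiv (wk A) (wk B) (Var 0))"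

definition id_equiv :: tm where
  "id_equiv = Pair Inner (idfun Inner)
     (Pair Inner (Pair Inner (idfun Inner) (Lam Inner (Refl Inner (Var 0))))
                 (Pair Inner (idfun Inner) (Lam Inner (Refl Inner (Var 0)))))"

definition idtoeqv :: "tm \<Rightarrow> tm \<Rightarrow> tm" where
  "idtoeqv A B = Lam Inner
     (EqInd Inner (equiv_ty (Var 2) (Var 1)) id_equiv (wk A) (wk B) (Var 0))"

text \<open>\<open>\<Prod>(A:U\<^sub>i). \<Prod>(B:U\<^sub>i). is_equiv (idtoeqv A B)\<close>\<close>

definition univalence_ty :: "nat \<Rightarrow> tm" where
  "univalence_ty i = Pi Inner (Univ Inner i) (Pi Inner (Univ Inner i)
     (is_equiv (Eq Inner (Univ Inner i) (Var 1) (Var 0)) (equiv_ty (Var 1) (Var 0))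
        (idtoeqv (Var 1) (Var 0))))"

text \<open>
  At the exo-level,
  \<open>\<Prod>(A:U\<^sub>i). \<Prod>(B:A\<rightarrow>U\<^sub>i). \<Prod>(f g:\<Prod>(a:A). B a). (\<Prod>(a:A). f a = g a) \<rightarrow> f = g\<close>
  and \<open>\<Prod>(A:U\<^sub>i). \<Prod>(x y:A). \<Prod>(p q:x = y). p = q\<close>.
\<close>

definition funextE_ty :: "nat \<Rightarrow> tm" where
  "funextE_ty i =
     Pi Exo (Univ Exo i)
    (Pi Exo (Arr Exo (Var 0) (Univ Exo i))
    (Pi Exo (Pi Exo (Var 1) (App Exo (Var 1) (Var 0)))
    (Pi Exo (Pi Exo (Var 2) (App Exo (Var 2) (Var 0)))
    (Arr Exo
      (Pi Exo (Var 3)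
        (Eq Exo (App Exo (Var 3) (Var 0)) (App Exo (Var 2) (Var 0)) (App Exo (Var 1) (Var 0))))
      (Eq Exo (Pi Exo (Var 3) (App Exo (Var 3) (Var 0))) (Var 1) (Var 0))))))"

definition uipE_ty :: "nat \<Rightarrow> tm" where
  "uipE_ty i =
     Pi Exo (Univ Exo i)
    (Pi Exo (Var 0)
    (Pi Exo (Var 1)
    (Pi Exo (Eq Exo (Var 2) (Var 1) (Var 0))
    (Pi Exo (Eq Exo (Var 3) (Var 2) (Var 1))
    (Eq Exo (Eq Exo (Var 4) (Var 3) (Var 2)) (Var 1) (Var 0))))))"


subsection \<open>Typing\<close>

text \<open>
  The most recent variable comes first in a context. All entries of a context are exo-types. In each
  elimination rule the motive is in a universe of the level of the eliminated term, so inductive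
  types eliminate into types only, and inductive exo-types into arbitrary exo-types.
\<close>

inductive ctx :: "tm list \<Rightarrow> bool"
  and typing :: "tm list \<Rightarrow> tm \<Rightarrow> tm \<Rightarrow> bool"  (\<open>_ \<turnstile> _ \<Ztypecolon> _\<close> [50, 50, 50] 50)
where
  ctx_Nil: "ctx []"
| ctx_Cons: "ctx \<Gamma> \<Longrightarrow> \<Gamma> \<turnstile> A \<Ztypecolon> Univ Exo i \<Longrightarrow> ctx (A # \<Gamma>)"

| ty_Var: "ctx \<Gamma> \<Longrightarrow> n < length \<Gamma> \<Longrightarrow> \<Gamma> \<turnstile> Var n \<Ztypecolon> ren (\<lambda>m. m + Suc n) (\<Gamma> ! n)"
| ty_conv: "\<Gamma> \<turnstile> t \<Ztypecolon> A \<Longrightarrow> A \<cong> B \<Longrightarrow> \<Gamma> \<turnstile> B \<Ztypecolon> Univ Exo i \<Longrightarrow> \<Gamma> \<turnstile> t \<Ztypecolon> B"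

| ty_Univ: "ctx \<Gamma> \<Longrightarrow> \<Gamma> \<turnstile> Univ s i \<Ztypecolon> Univ s (Suc i)"
| ty_cumul: "\<Gamma> \<turnstile> A \<Ztypecolon> Univ s i \<Longrightarrow> \<Gamma> \<turnstile> A \<Ztypecolon> Univ s (Suc i)"
| ty_exo: "\<Gamma> \<turnstile> A \<Ztypecolon> Univ Inner i \<Longrightarrow> \<Gamma> \<turnstile> A \<Ztypecolon> Univ Exo i"

| ty_Pi: "\<Gamma> \<turnstile> A \<Ztypecolon> Univ s i \<Longrightarrow> A # \<Gamma> \<turnstile> B \<Ztypecolon> Univ s i \<Longrightarrow> \<Gamma> \<turnstile> Pi s A B \<Ztypecolon> Univ s i"
| ty_Lam: "\<Gamma> \<turnstile> A \<Ztypecolon> Univ s i \<Longrightarrow> A # \<Gamma> \<turnstile> B \<Ztypecolon> Univ s i \<Longrightarrow> A # \<Gamma> \<turnstile> b \<Ztypecolon> B \<Longrightarrow>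
    \<Gamma> \<turnstile> Lam s b \<Ztypecolon> Pi s A B"
| ty_App: "\<Gamma> \<turnstile> f \<Ztypecolon> Pi s A B \<Longrightarrow> \<Gamma> \<turnstile> a \<Ztypecolon> A \<Longrightarrow> \<Gamma> \<turnstile> App s f a \<Ztypecolon> inst B a"

| ty_Sig: "\<Gamma> \<turnstile> A \<Ztypecolon> Univ s i \<Longrightarrow> A # \<Gamma> \<turnstile> B \<Ztypecolon> Univ s i \<Longrightarrow> \<Gamma> \<turnstile> Sig s A B \<Ztypecolon> Univ s i"
| ty_Pair: "\<Gamma> \<turnstile> A \<Ztypecolon> Univ s i \<Longrightarrow> A # \<Gamma> \<turnstile> B \<Ztypecolon> Univ s i \<Longrightarrow>
    \<Gamma> \<turnstile> a \<Ztypecolon> A \<Longrightarrow> \<Gamma> \<turnstile> b \<Ztypecolon> inst B a \<Longrightarrow> \<Gamma> \<turnstile> Pair s a b \<Ztypecolon> Sig s A B"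
| ty_SigInd: "Sig s A B # \<Gamma> \<turnstile> C \<Ztypecolon> Univ s i \<Longrightarrow>
    B # A # \<Gamma> \<turnstile> c \<Ztypecolon> subst (Pair s (Var 1) (Var 0) \<cdot> shifted 2) C \<Longrightarrow>
    \<Gamma> \<turnstile> p \<Ztypecolon> Sig s A B \<Longrightarrow> \<Gamma> \<turnstile> SigInd s C c p \<Ztypecolon> inst C p"

| ty_Plus: "\<Gamma> \<turnstile> A \<Ztypecolon> Univ s i \<Longrightarrow> \<Gamma> \<turnstile> B \<Ztypecolon> Univ s i \<Longrightarrow> \<Gamma> \<turnstile> Plus s A B \<Ztypecolon> Univ s i"
| ty_InjL: "\<Gamma> \<turnstile> A \<Ztypecolon> Univ s i \<Longrightarrow> \<Gamma> \<turnstile> B \<Ztypecolon> Univ s i \<Longrightarrow> \<Gamma> \<turnstile> a \<Ztypecolon> A \<Longrightarrow>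
    \<Gamma> \<turnstile> InjL s a \<Ztypecolon> Plus s A B"
| ty_InjR: "\<Gamma> \<turnstile> A \<Ztypecolon> Univ s i \<Longrightarrow> \<Gamma> \<turnstile> B \<Ztypecolon> Univ s i \<Longrightarrow> \<Gamma> \<turnstile> b \<Ztypecolon> B \<Longrightarrow>
    \<Gamma> \<turnstile> InjR s b \<Ztypecolon> Plus s A B"
| ty_PlusInd: "Plus s A B # \<Gamma> \<turnstile> C \<Ztypecolon> Univ s i \<Longrightarrow>
    A # \<Gamma> \<turnstile> c \<Ztypecolon> subst (InjL s (Var 0) \<cdot> shifted 1) C \<Longrightarrow>
    B # \<Gamma> \<turnstile> d \<Ztypecolon> subst (InjR s (Var 0) \<cdot> shifted 1) C \<Longrightarrow>
    \<Gamma> \<turnstile> e \<Ztypecolon> Plus s A B \<Longrightarrow> \<Gamma> \<turnstile> PlusInd s C c d e \<Ztypecolon> inst C e"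

| ty_One: "ctx \<Gamma> \<Longrightarrow> \<Gamma> \<turnstile> One s \<Ztypecolon> Univ s i"
| ty_Star: "ctx \<Gamma> \<Longrightarrow> \<Gamma> \<turnstile> Star s \<Ztypecolon> One s"
| ty_OneInd: "One s # \<Gamma> \<turnstile> C \<Ztypecolon> Univ s i \<Longrightarrow> \<Gamma> \<turnstile> c \<Ztypecolon> inst C (Star s) \<Longrightarrow>
    \<Gamma> \<turnstile> a \<Ztypecolon> One s \<Longrightarrow> \<Gamma> \<turnstile> OneInd s C c a \<Ztypecolon> inst C a"

| ty_Zero: "ctx \<Gamma> \<Longrightarrow> \<Gamma> \<turnstile> Zero s \<Ztypecolon> Univ s i"
| ty_ZeroInd: "Zero s # \<Gamma> \<turnstile> C \<Ztypecolon> Univ s i \<Longrightarrow> \<Gamma> \<turnstile> a \<Ztypecolon> Zero s \<Longrightarrow>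
    \<Gamma> \<turnstile> ZeroInd s C a \<Ztypecolon> inst C a"

| ty_Nat: "ctx \<Gamma> \<Longrightarrow> \<Gamma> \<turnstile> Nat s \<Ztypecolon> Univ s i"
| ty_NZero: "ctx \<Gamma> \<Longrightarrow> \<Gamma> \<turnstile> NZero s \<Ztypecolon> Nat s"
| ty_NSuc: "\<Gamma> \<turnstile> n \<Ztypecolon> Nat s \<Longrightarrow> \<Gamma> \<turnstile> NSuc s n \<Ztypecolon> Nat s"
| ty_NatInd: "Nat s # \<Gamma> \<turnstile> C \<Ztypecolon> Univ s i \<Longrightarrow> \<Gamma> \<turnstile> c \<Ztypecolon> inst C (NZero s) \<Longrightarrow>
    C # Nat s # \<Gamma> \<turnstile> d \<Ztypecolon> subst (NSuc s (Var 1) \<cdot> shifted 2) C \<Longrightarrow>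
    \<Gamma> \<turnstile> n \<Ztypecolon> Nat s \<Longrightarrow> \<Gamma> \<turnstile> NatInd s C c d n \<Ztypecolon> inst C n"

| ty_Eq: "\<Gamma> \<turnstile> A \<Ztypecolon> Univ s i \<Longrightarrow> \<Gamma> \<turnstile> a \<Ztypecolon> A \<Longrightarrow> \<Gamma> \<turnstile> b \<Ztypecolon> A \<Longrightarrow> \<Gamma> \<turnstile> Eq s A a b \<Ztypecolon> Univ s i"
| ty_Refl: "\<Gamma> \<turnstile> A \<Ztypecolon> Univ s i \<Longrightarrow> \<Gamma> \<turnstile> a \<Ztypecolon> A \<Longrightarrow> \<Gamma> \<turnstile> Refl s a \<Ztypecolon> Eq s A a a"
| ty_EqInd: "Eq s (wk (wk A)) (Var 1) (Var 0) # wk A # A # \<Gamma> \<turnstile> C \<Ztypecolon> Univ s i \<Longrightarrow>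
    A # \<Gamma> \<turnstile> c \<Ztypecolon> subst (Refl s (Var 0) \<cdot> Var 0 \<cdot> Var 0 \<cdot> shifted 1) C \<Longrightarrow>
    \<Gamma> \<turnstile> a \<Ztypecolon> A \<Longrightarrow> \<Gamma> \<turnstile> b \<Ztypecolon> A \<Longrightarrow> \<Gamma> \<turnstile> p \<Ztypecolon> Eq s A a b \<Longrightarrow>
    \<Gamma> \<turnstile> EqInd s C c a b p \<Ztypecolon> subst (p \<cdot> b \<cdot> a \<cdot> Var) C"

| ty_List: "\<Gamma> \<turnstile> A \<Ztypecolon> Univ Exo i \<Longrightarrow> \<Gamma> \<turnstile> List A \<Ztypecolon> Univ Exo i"
| ty_LNil: "\<Gamma> \<turnstile> A \<Ztypecolon> Univ Exo i \<Longrightarrow> \<Gamma> \<turnstile> LNil \<Ztypecolon> List A"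
| ty_LCons: "\<Gamma> \<turnstile> A \<Ztypecolon> Univ Exo i \<Longrightarrow> \<Gamma> \<turnstile> a \<Ztypecolon> A \<Longrightarrow> \<Gamma> \<turnstile> l \<Ztypecolon> List A \<Longrightarrow> \<Gamma> \<turnstile> LCons a l \<Ztypecolon> List A"
| ty_ListInd: "List A # \<Gamma> \<turnstile> C \<Ztypecolon> Univ Exo i \<Longrightarrow> \<Gamma> \<turnstile> c \<Ztypecolon> inst C LNil \<Longrightarrow>
    subst (Var 0 \<cdot> shifted 2) C # wk (List A) # A # \<Gamma>
      \<turnstile> d \<Ztypecolon> subst (LCons (Var 2) (Var 1) \<cdot> shifted 3) C \<Longrightarrow>
    \<Gamma> \<turnstile> l \<Ztypecolon> List A \<Longrightarrow> \<Gamma> \<turnstile> ListInd C c d l \<Ztypecolon> inst C l"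

| ty_Univalence: "ctx \<Gamma> \<Longrightarrow> \<Gamma> \<turnstile> Univalence i \<Ztypecolon> univalence_ty i"
| ty_FunextE: "ctx \<Gamma> \<Longrightarrow> \<Gamma> \<turnstile> FunextE i \<Ztypecolon> funextE_ty i"
| ty_UipE: "ctx \<Gamma> \<Longrightarrow> \<Gamma> \<turnstile> UipE i \<Ztypecolon> uipE_ty i"


subsection \<open>Fibrant and cofibrant exo-types\<close>

text \<open>\<open>\<Sum>(f:A\<rightarrow>B). \<Sum>(g:B\<rightarrow>A). (f \<circ> g = id) \<times> (g \<circ> f = id)\<close>\<close>

definition exo_iso :: "tm \<Rightarrow> tm \<Rightarrow> tm" where
  "exo_iso A B = Sig Exo (Arr Exo A B) (Sig Exo (wk (Arr Exo B A))
     (Prod Exo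
       (Eq Exo (wk (wk (Arr Exo B B))) (comp Exo (Var 1) (Var 0)) (idfun Exo))
       (Eq Exo (wk (wk (Arr Exo A A))) (comp Exo (Var 0) (Var 1)) (idfun Exo))))"

definition is_fibrant :: "nat \<Rightarrow> tm \<Rightarrow> tm" where
  "is_fibrant i A = Sig Exo (Univ Inner i) (exo_iso (wk A) (Var 0))"

text \<open>The first projection of a term of \<open>is_fibrant i A\<close>.\<close>

definition fibrant_match :: "nat \<Rightarrow> tm \<Rightarrow> tm" where
  "fibrant_match i p = SigInd Exo (Univ Inner i) (Var 1) p"

text \<open>
  \<open>\<Sum>(F : \<Prod>(Y:A\<rightarrow>U\<^sub>i). is_fibrant (\<Prod>(a:A). Y a)).
    \<Prod>(Y:A\<rightarrow>U\<^sub>i). (\<Prod>(a:A). is_contr (Y a)) \<rightarrow> is_contr (fibrant_match (F Y))\<close>.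
  Typical ambiguity for ``any \<open>Y : A \<rightarrow> U\<close>'' is resolved by one index \<open>i\<close>: the exo-type \<open>A\<close> is considered
  in the exo-universe \<open>i\<close>, and \<open>Y\<close> and the fibrant matches are in the universe \<open>i\<close>. By cumulativity an
  exo-type can be considered in every higher exo-universe as well.
\<close>

definition is_cofibrant :: "nat \<Rightarrow> tm \<Rightarrow> tm" where
  "is_cofibrant i A = Sig Exo
     (Pi Exo (Arr Exo A (Univ Inner i))
       (is_fibrant i (Pi Exo (wk A) (App Exo (Var 1) (Var 0)))))
     (Pi Exo (wk (Arr Exo A (Univ Inner i)))
       (Arr Exo
         (Pi Exo (wk (wk A)) (is_contr (App Exo (Var 1) (Var 0))))
         (is_contr (fibrant_match i (App Exo (Var 1) (Var 0))))))"

end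

theory Submission
  imports Defs
begin

text \<open>
  For \<open>Y : List A \<rightarrow> U\<close> let \<open>T 0 Y = Y []\<close>, and let \<open>T (n + 1) Y\<close> be the fibrant match of
  \<open>\<Prod>(a:A). T n (\<lambda>l. Y (a :: l))\<close>, which exists because \<open>A\<close> is cofibrant. Thus \<open>T n Y\<close> is a fibrant
  match of the product of \<open>Y\<close> over the lists of length \<open>n\<close>, without any mention of length. A section
  of \<open>Y\<close> restricts to a point of each \<open>T n Y\<close>, by induction on \<open>n\<close>; conversely the value at \<open>l\<close> of
    the
  section that belongs to \<open>h : \<Prod>n. T n Y\<close> is found by induction on \<open>l\<close>, with \<open>Y\<close> and \<open>h\<close> varying. So
  \<open>\<Prod>l. Y l \<cong> \<Prod>n. T n Y\<close>, and the right-hand side is fibrant because \<open>\<nat>\<close> is cofibrant. If every \<open>Y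
    l\<close> is
  contractible, then so is every \<open>T n Y\<close> by induction on \<open>n\<close>, and hence the match of their product.

  Only the types \<open>T n Y\<close> and the two maps, which occur in types, are written down as terms. Of the
  proofs of equations and of contractibility just the existence is tracked.
\<close>

subsection \<open>Substitution\<close>

text \<open>Lists of a fixed length could be cut out by an equation on lengths, at the price of a
  transport in every recursive step. Letting the family vary avoids this:
  \<open>l \<mapsto> Y (a :: l)\<close> is again a family on all lists, so the recursion on
  \<open>n\<close> is typed with the constant motive
  \<open>fams i A \<rightarrow> Univ Inner i\<close>. That motive is an exo-type, which the
  eliminator of the exo-naturals admits. The match of a product of types of universe
  \<open>i\<close> lies in the same universe, so all \<open>T n Y\<close> stay there, and the
  cofibrancy of the exo-naturals applies to them at the same index. The equations for
  \<open>T 0\<close> and \<open>T (n + 1)\<close> hold by computation, so types are matched by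
  conversion alone. The exo-equalities at the bottom of the argument are the round trips of the
  isomorphisms with fibrant matches, which function extensionality turns into equations between
  sections. Since terms are raw and typing is a derivation, every step also has to be shown well
  typed; this is why the development opens with substitution, weakening and the inversion of
  formation rules.\<close>

lemma upren_simps [simp]:
  "upren r 0 = 0" "upren r (Suc n) = Suc (r n)" "upren r (numeral k) = Suc (r (pred_numeral k))"
  by (simp_all add: upren_def)

lemma up_simps [simp]:
  "up \<sigma> 0 = Var 0" "up \<sigma> (Suc n) = wk (\<sigma> n)" "up \<sigma> (numeral k) = wk (\<sigma> (pred_numeral k))"
  by (simp_all add: up_def)

text \<open>Stated for \<open>1\<close> separately: it is not of the form \<open>numeral k\<close>,
  and the restricted simplifier calls in the proof of stability under substitution do not turn it
  into \<open>Suc 0\<close>.\<close>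

lemma up_up_1: "up (up \<sigma>) 1 = Var 1"
  by simp

lemma up_Var_upren: "up (\<lambda>n. Var (r n)) = (\<lambda>n. Var (upren r n))"
  by (rule ext) (simp add: up_def upren_def split: nat.split)

lemma ren_as_subst: "ren r t = subst (\<lambda>n. Var (r n)) t"
  by (induction t arbitrary: r) (simp_all add: up_Var_upren)

lemma up_comp_upren: "(\<lambda>n. up \<sigma> (upren r n)) = up (\<lambda>n. \<sigma> (r n))"
  by (rule ext) (simp add: up_def upren_def split: nat.split)

text \<open>The fusion laws come in the order in which the binder cases depend on each other:
  substitution after renaming stands on its own, renaming after renaming is a special case of it,
  renaming after substitution uses that below a binder, and substitution after substitution uses
  both mixed laws.\<close>

lemma subst_ren: "subst \<sigma> (ren r t) = subst (\<lambda>n. \<sigma> (r n)) t"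
  by (induction t arbitrary: \<sigma> r) (simp_all add: up_comp_upren)

lemma ren_ren: "ren r (ren r' t) = ren (\<lambda>n. r (r' n)) t"
  unfolding ren_as_subst[of r] subst_ren by (simp add: ren_as_subst)

lemma ren_up: "(\<lambda>n. ren (upren r) (up \<sigma> n)) = up (\<lambda>n. ren r (\<sigma> n))"
  by (rule ext) (simp add: up_def upren_def ren_ren split: nat.split)

lemma ren_subst: "ren r (subst \<sigma> t) = subst (\<lambda>n. ren r (\<sigma> n)) t"
  by (induction t arbitrary: \<sigma> r) (simp_all add: ren_up)

lemma subst_up_up: "(\<lambda>n. subst (up \<sigma>) (up \<tau> n)) = up (\<lambda>n. subst \<sigma> (\<tau> n))"
  by (rule ext) (simp add: up_def subst_ren ren_subst split: nat.split)

lemma subst_subst: "subst \<sigma> (subst \<tau> t) = subst (\<lambda>n. subst \<sigma> (\<tau> n)) t"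
  by (induction t arbitrary: \<sigma> \<tau>) (simp_all add: subst_up_up)

lemma up_Var [simp]: "up Var = Var"
  by (rule ext) (simp add: up_def split: nat.split)

lemma subst_Var [simp]: "subst Var t = t"
  by (induction t) simp_all

lemma subst_scons_wk [simp]: "subst (a \<cdot> \<sigma>) (wk t) = subst \<sigma> t"
  by (simp add: subst_ren)

lemma subst_up_wk [simp]: "subst (up \<sigma>) (wk t) = wk (subst \<sigma> t)"
  by (simp add: subst_ren ren_subst)

lemma ren_upren_wk [simp]: "ren (upren r) (wk t) = wk (ren r t)"
  by (simp add: ren_ren)

text \<open>The shapes that \<open>shifted k\<close> takes during simplification; for 3 the numeral
  may be left standing or be unfolded into successors, hence two forms.\<close>

lemma subst_shift [simp]:
  "subst (\<lambda>n. Var (Suc n)) t = wk t"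
  "subst (\<lambda>n. Var (Suc (Suc n))) t = wk (wk t)"
  "subst (\<lambda>n. Var (n + 3)) t = wk (wk (wk t))"
  "subst (\<lambda>n. Var (Suc (Suc (Suc n)))) t = wk (wk (wk t))"
  by (simp_all add: ren_as_subst subst_subst eval_nat_numeral)

text \<open>The pattern of the commutation lemmas that follow: both sides are fused into one
  substitution each, and these are compared variable by variable.\<close>

lemma subst_eq: "(\<And>n. \<sigma> n = \<tau> n) \<Longrightarrow> subst \<sigma> t = subst \<tau> t"
  by presburger

lemma subst_inst [simp]: "subst \<sigma> (inst B a) = inst (subst (up \<sigma>) B) (subst \<sigma> a)"
  unfolding subst_subst by (rule subst_eq) (simp add: up_def split: nat.split)

lemma ren_inst [simp]: "ren r (inst B a) = inst (ren (upren r) B) (ren r a)"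
  unfolding ren_subst subst_ren by (rule subst_eq) (simp add: upren_def split: nat.split)

text \<open>In the typing rules a branch has the motive at a constructor term as its type, in a
  context extended by the arguments of the constructor. These laws carry a substitution past that
  instantiation, for one, two and three extra variables.\<close>

lemma subst_branch:
  "subst (up \<sigma>) (subst (t \<cdot> shifted 1) C) = subst (subst (up \<sigma>) t \<cdot> shifted 1) (subst (up \<sigma>) C)"
  "subst (up (up \<sigma>)) (subst (t \<cdot> shifted 2) C)
     = subst (subst (up (up \<sigma>)) t \<cdot> shifted 2) (subst (up \<sigma>) C)"
  "subst (up (up (up \<sigma>))) (subst (t \<cdot> shifted 3) C)
     = subst (subst (up (up (up \<sigma>))) t \<cdot> shifted 3) (subst (up \<sigma>) C)"
  unfolding subst_subst
  by (rule subst_eq, simp add: eval_nat_numeral split: nat.split)+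

lemma subst2: "subst \<sigma> (subst (b \<cdot> a \<cdot> Var) c)
    = subst (subst \<sigma> b \<cdot> subst \<sigma> a \<cdot> Var) (subst (up (up \<sigma>)) c)"
  unfolding subst_subst by (rule subst_eq) (simp add: up_def split: nat.split)

lemma subst3: "subst \<sigma> (subst (d \<cdot> b \<cdot> a \<cdot> Var) c)
    = subst (subst \<sigma> d \<cdot> subst \<sigma> b \<cdot> subst \<sigma> a \<cdot> Var) (subst (up (up (up \<sigma>))) c)"
  unfolding subst_subst by (rule subst_eq) (simp add: up_def split: nat.split)

lemma subst_EqInd_branch:
  "subst (up \<sigma>) (subst (Refl s (Var 0) \<cdot> Var 0 \<cdot> Var 0 \<cdot> shifted 1) C)
    = subst (Refl s (Var 0) \<cdot> Var 0 \<cdot> Var 0 \<cdot> shifted 1) (subst (up (up (up \<sigma>))) C)"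
  unfolding subst_subst
  by (rule subst_eq) (simp add: eval_nat_numeral split: nat.split)

lemma subst_ListInd_hyp:
  "subst (up (up \<sigma>)) (subst (Var 0 \<cdot> shifted 2) C) = subst (Var 0 \<cdot> shifted 2) (subst (up \<sigma>) C)"
  by (simp only: subst_branch) simp

lemma subst_branches:
  "subst (up (up \<sigma>)) (subst (Pair s (Var 1) (Var 0) \<cdot> shifted 2) C)
    = subst (Pair s (Var 1) (Var 0) \<cdot> shifted 2) (subst (up \<sigma>) C)"
  "subst (up \<sigma>) (subst (InjL s (Var 0) \<cdot> shifted 1) C)
    = subst (InjL s (Var 0) \<cdot> shifted 1) (subst (up \<sigma>) C)"
  "subst (up \<sigma>) (subst (InjR s (Var 0) \<cdot> shifted 1) C)
    = subst (InjR s (Var 0) \<cdot> shifted 1) (subst (up \<sigma>) C)"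
  "subst (up (up \<sigma>)) (subst (NSuc s (Var 1) \<cdot> shifted 2) C)
    = subst (NSuc s (Var 1) \<cdot> shifted 2) (subst (up \<sigma>) C)"
  "subst (up (up (up \<sigma>))) (subst (LCons (Var 2) (Var 1) \<cdot> shifted 3) C)
    = subst (LCons (Var 2) (Var 1) \<cdot> shifted 3) (subst (up \<sigma>) C)"
  by (simp_all only: subst_branch) (simp_all add: eval_nat_numeral)

lemmas subst_comm = subst_inst subst2 subst3 subst_branches subst_EqInd_branch subst_ListInd_hyp

section \<open>Conversion and substitution\<close>

lemma conv_subst: "t \<cong> u \<Longrightarrow> subst \<sigma> t \<cong> subst \<sigma> u"
proof (induction arbitrary: \<sigma> rule: conv.induct)
  \<comment> \<open>Transitivity is kept away from the automation of the other cases because its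
    middle term does not occur in the goal.\<close>
  case (conv_trans t u v)
  then show ?case by (meson conv.conv_trans)
qed (auto simp: subst_comm intro: conv.intros conv.conv_sym)

lemma conv_ren: "t \<cong> u \<Longrightarrow> ren r t \<cong> ren r u"
  unfolding ren_as_subst by (rule conv_subst)

text \<open>The first fourteen rules are those of an equivalence relation, computation and
  uniqueness; the congruences start at the fifteenth.\<close>

lemmas conv_cong = conv.intros(15-)

definition conv_sub :: "(nat \<Rightarrow> tm) \<Rightarrow> (nat \<Rightarrow> tm) \<Rightarrow> bool" where
  "conv_sub \<sigma> \<tau> \<longleftrightarrow> (\<forall>n. \<sigma> n \<cong> \<tau> n)"

lemma conv_sub_up: "conv_sub \<sigma> \<tau> \<Longrightarrow> conv_sub (up \<sigma>) (up \<tau>)"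
  unfolding conv_sub_def by (intro allI, case_tac n) (auto intro: conv_refl conv_ren)

text \<open>Allows a term inside a dependent type to be replaced by a convertible one; the typing of
  the second projection rests on it.\<close>

lemma conv_subst_conv: "conv_sub \<sigma> \<tau> \<Longrightarrow> subst \<sigma> t \<cong> subst \<tau> t"
proof (induction t arbitrary: \<sigma> \<tau>)
  case (Var n) then show ?case by (simp add: conv_sub_def)
qed (simp_all add: conv_refl conv_cong conv_sub_up)

subsection \<open>Typing is stable under substitution\<close>

text \<open>
  The elimination rules extend the context without a premise that the new entries are types. That
  fact is therefore carried through the induction below as \<open>good_ctx\<close>.
\<close>

primrec good_ctx :: "(tm list \<Rightarrow> (nat \<Rightarrow> tm) \<Rightarrow> tm list \<Rightarrow> bool) \<Rightarrow> tm list \<Rightarrow> bool" where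
  "good_ctx W [] = True"
| "good_ctx W (A # \<Gamma>) =
     (good_ctx W \<Gamma> \<and> (\<forall>\<Delta> \<sigma>. W \<Delta> \<sigma> \<Gamma> \<longrightarrow> (\<exists>j. \<Delta> \<turnstile> subst \<sigma> A \<Ztypecolon> Univ Exo j)))"

lemma closed_axioms:
  "subst \<sigma> (univalence_ty i) = univalence_ty i"
  "subst \<sigma> (funextE_ty i) = funextE_ty i"
  "subst \<sigma> (uipE_ty i) = uipE_ty i"
  by (simp_all add: univalence_ty_def funextE_ty_def uipE_ty_def is_equiv_def equiv_ty_def
      idtoeqv_def id_equiv_def)

text \<open>
  Stated for a class \<open>W\<close> of substitutions that is closed under passing below a binder: for
  substitutions in general this closure needs weakening, which is the instance for renamings.
\<close>

lemma typing_subst_gen: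
  assumes W_ctx: "\<And>\<Delta> \<sigma> \<Gamma>. W \<Delta> \<sigma> \<Gamma> \<Longrightarrow> ctx \<Delta>"
    and W_var: "\<And>\<Delta> \<sigma> \<Gamma> n. W \<Delta> \<sigma> \<Gamma> \<Longrightarrow> n < length \<Gamma> \<Longrightarrow>
      \<Delta> \<turnstile> \<sigma> n \<Ztypecolon> subst \<sigma> (ren (\<lambda>m. m + Suc n) (\<Gamma> ! n))"
    and W_up: "\<And>\<Delta> \<sigma> \<Gamma> A j. W \<Delta> \<sigma> \<Gamma> \<Longrightarrow> \<Delta> \<turnstile> subst \<sigma> A \<Ztypecolon> Univ Exo j \<Longrightarrow>
      W (subst \<sigma> A # \<Delta>) (up \<sigma>) (A # \<Gamma>)"
  shows "ctx \<Gamma> \<Longrightarrow> good_ctx W \<Gamma>"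
    and "\<Gamma> \<turnstile> t \<Ztypecolon> A \<Longrightarrow>
      good_ctx W \<Gamma> \<and> (\<forall>\<Delta> \<sigma>. W \<Delta> \<sigma> \<Gamma> \<longrightarrow> \<Delta> \<turnstile> subst \<sigma> t \<Ztypecolon> subst \<sigma> A)"
proof (induction \<Gamma> and \<Gamma> t A rule: ctx_typing.inducts)
  have up: "W (subst \<sigma> A # \<Delta>) (up \<sigma>) (A # \<Gamma>)" if g: "good_ctx W (A # \<Gamma>)" and W: "W \<Delta> \<sigma> \<Gamma>"
    for A \<Delta> \<sigma> \<Gamma>
  proof -
    from g W obtain j where "\<Delta> \<turnstile> subst \<sigma> A \<Ztypecolon> Univ Exo j" by auto
    with W show ?thesis by (rule W_up)
  qed
  have goodD: "good_ctx W (A # \<Gamma>) \<Longrightarrow> good_ctx W \<Gamma>" for A \<Gamma> by simp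
  note [simp] = subst_inst closed_axioms
  note comm = subst.simps subst_comm up_simps up_up_1 subst_up_wk
  \<comment> \<open>The unfolding is switched off so that \<open>good_ctx W (A # \<Gamma>)\<close>
    survives simplification as the premise of \<open>up\<close> and \<open>goodD\<close>.\<close>
  note [simp del] = good_ctx.simps(2)
  {
    case ctx_Nil then show ?case by simp
  next
    case ctx_Cons then show ?case by (auto simp: good_ctx.simps(2))
  next
    case ty_Var then show ?case using W_var by auto
  next
    case (ty_conv \<Gamma> t A B i)
    then show ?case by (metis conv_subst subst.simps(2) ctx_typing.ty_conv)
  next
    case ty_cumul then show ?case by (auto intro: ctx_typing.ty_cumul)
  next
    case ty_exo then show ?case by (auto intro: ctx_typing.ty_exo)
  next
    case ty_Univ then show ?case by (simp; blast dest: goodD intro: ctx_typing.ty_Univ up W_ctx)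
  next
    case ty_Pi then show ?case by (simp; blast dest: goodD intro: ctx_typing.ty_Pi up W_ctx)
  next
    case ty_Lam then show ?case by (simp; blast dest: goodD intro: ctx_typing.ty_Lam up W_ctx)
  next
    case ty_App then show ?case by (simp; blast dest: goodD intro: ctx_typing.ty_App up W_ctx)
  next
    case ty_Sig then show ?case by (simp; blast dest: goodD intro: ctx_typing.ty_Sig up W_ctx)
  next
    case ty_Pair then show ?case by (simp; blast dest: goodD intro: ctx_typing.ty_Pair up W_ctx)
  next
    case (ty_SigInd s A B \<Gamma> C i c p)
    show ?case
    proof (intro conjI allI impI)
      show "good_ctx W \<Gamma>" using ty_SigInd.IH goodD by blast
      fix \<Delta> \<sigma> assume W: "W \<Delta> \<sigma> \<Gamma>"
      \<comment> \<open>For every context extension in the premises of the rule, \<open>W\<close> is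
        re-established by \<open>up\<close>; what \<open>up\<close> asks for is the
        \<open>good_ctx\<close> half of an induction hypothesis. The other eliminators are treated
        alike.\<close>
      have W1: "W (subst \<sigma> (Sig s A B) # \<Delta>) (up \<sigma>) (Sig s A B # \<Gamma>)"
        using ty_SigInd.IH goodD by (blast intro: up W)
      have W2: "W (subst \<sigma> A # \<Delta>) (up \<sigma>) (A # \<Gamma>)"
        using ty_SigInd.IH goodD by (blast intro: up W)
      have W3: "W (subst (up \<sigma>) B # subst \<sigma> A # \<Delta>) (up (up \<sigma>)) (B # A # \<Gamma>)"
        using ty_SigInd.IH goodD by (blast intro: up W2)
      show "\<Delta> \<turnstile> subst \<sigma> (SigInd s C c p) \<Ztypecolon> subst \<sigma> (inst C p)"
        by (simp only: subst.simps subst_inst subst3, rule ctx_typing.ty_SigInd)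
          (use ty_SigInd.IH(1)[THEN conjunct2, rule_format, OF W1]
            ty_SigInd.IH(2)[THEN conjunct2, rule_format, OF W3]
            ty_SigInd.IH(3)[THEN conjunct2, rule_format, OF W] in \<open>simp_all only: comm\<close>)
    qed
  next
    case ty_Plus then show ?case by (simp; blast dest: goodD intro: ctx_typing.ty_Plus up W_ctx)
  next
    case ty_InjL then show ?case by (simp; blast dest: goodD intro: ctx_typing.ty_InjL up W_ctx)
  next
    case ty_InjR then show ?case by (simp; blast dest: goodD intro: ctx_typing.ty_InjR up W_ctx)
  next
    case (ty_PlusInd s A B \<Gamma> C i c d e)
    show ?case
    proof (intro conjI allI impI)
      show "good_ctx W \<Gamma>" using ty_PlusInd.IH goodD by blast
      fix \<Delta> \<sigma> assume W: "W \<Delta> \<sigma> \<Gamma>"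
      have W1: "W (subst \<sigma> (Plus s A B) # \<Delta>) (up \<sigma>) (Plus s A B # \<Gamma>)"
        using ty_PlusInd.IH goodD by (blast intro: up W)
      have W2: "W (subst \<sigma> A # \<Delta>) (up \<sigma>) (A # \<Gamma>)"
        using ty_PlusInd.IH goodD by (blast intro: up W)
      have W3: "W (subst \<sigma> B # \<Delta>) (up \<sigma>) (B # \<Gamma>)"
        using ty_PlusInd.IH goodD by (blast intro: up W)
      show "\<Delta> \<turnstile> subst \<sigma> (PlusInd s C c d e) \<Ztypecolon> subst \<sigma> (inst C e)"
        by (simp only: subst.simps subst_inst subst3, rule ctx_typing.ty_PlusInd)
          (use ty_PlusInd.IH(1)[THEN conjunct2, rule_format, OF W1]
            ty_PlusInd.IH(2)[THEN conjunct2, rule_format, OF W2]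
            ty_PlusInd.IH(3)[THEN conjunct2, rule_format, OF W3]
            ty_PlusInd.IH(4)[THEN conjunct2, rule_format, OF W] in \<open>simp_all only: comm\<close>)
    qed
  next
    case ty_One then show ?case by (simp; blast dest: goodD intro: ctx_typing.ty_One up W_ctx)
  next
    case ty_Star then show ?case by (simp; blast dest: goodD intro: ctx_typing.ty_Star up W_ctx)
  next
    case (ty_OneInd s \<Gamma> C i c a)
    show ?case
    proof (intro conjI allI impI)
      show "good_ctx W \<Gamma>" using ty_OneInd.IH goodD by blast
      fix \<Delta> \<sigma> assume W: "W \<Delta> \<sigma> \<Gamma>"
      have W1: "W (subst \<sigma> (One s) # \<Delta>) (up \<sigma>) (One s # \<Gamma>)"
        using ty_OneInd.IH goodD by (blast intro: up W)
      show "\<Delta> \<turnstile> subst \<sigma> (OneInd s C c a) \<Ztypecolon> subst \<sigma> (inst C a)"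
        by (simp only: subst.simps subst_inst, rule ctx_typing.ty_OneInd)
          (use ty_OneInd.IH(1)[THEN conjunct2, rule_format, OF W1]
            ty_OneInd.IH(2)[THEN conjunct2, rule_format, OF W]
            ty_OneInd.IH(3)[THEN conjunct2, rule_format, OF W] in \<open>simp_all only: comm\<close>)
    qed
  next
    case ty_Zero then show ?case by (simp; blast dest: goodD intro: ctx_typing.ty_Zero up W_ctx)
  next
    case (ty_ZeroInd s \<Gamma> C i a)
    show ?case
    proof (intro conjI allI impI)
      show "good_ctx W \<Gamma>" using ty_ZeroInd.IH goodD by blast
      fix \<Delta> \<sigma> assume W: "W \<Delta> \<sigma> \<Gamma>"
      have W1: "W (subst \<sigma> (Zero s) # \<Delta>) (up \<sigma>) (Zero s # \<Gamma>)"
        using ty_ZeroInd.IH goodD by (blast intro: up W)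
      show "\<Delta> \<turnstile> subst \<sigma> (ZeroInd s C a) \<Ztypecolon> subst \<sigma> (inst C a)"
        by (simp only: subst.simps subst_inst, rule ctx_typing.ty_ZeroInd)
          (use ty_ZeroInd.IH(1)[THEN conjunct2, rule_format, OF W1]
            ty_ZeroInd.IH(2)[THEN conjunct2, rule_format, OF W] in \<open>simp_all only: comm\<close>)
    qed
  next
    case ty_Nat then show ?case by (simp; blast dest: goodD intro: ctx_typing.ty_Nat up W_ctx)
  next
    case ty_NZero then show ?case by (simp; blast dest: goodD intro: ctx_typing.ty_NZero up W_ctx)
  next
    case ty_NSuc then show ?case by (simp; blast dest: goodD intro: ctx_typing.ty_NSuc up W_ctx)
  next
    case (ty_NatInd s \<Gamma> C i c d n)
    show ?case
    proof (intro conjI allI impI)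
      show "good_ctx W \<Gamma>" using ty_NatInd.IH goodD by blast
      fix \<Delta> \<sigma> assume W: "W \<Delta> \<sigma> \<Gamma>"
      have W1: "W (subst \<sigma> (Nat s) # \<Delta>) (up \<sigma>) (Nat s # \<Gamma>)"
        using ty_NatInd.IH goodD by (blast intro: up W)
      have W2: "W (subst (up \<sigma>) C # subst \<sigma> (Nat s) # \<Delta>) (up (up \<sigma>)) (C # Nat s # \<Gamma>)"
        using ty_NatInd.IH goodD by (blast intro: up W1)
      show "\<Delta> \<turnstile> subst \<sigma> (NatInd s C c d n) \<Ztypecolon> subst \<sigma> (inst C n)"
        by (simp only: subst.simps subst_inst subst3, rule ctx_typing.ty_NatInd)
          (use ty_NatInd.IH(1)[THEN conjunct2, rule_format, OF W1]
            ty_NatInd.IH(2)[THEN conjunct2, rule_format, OF W]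
            ty_NatInd.IH(3)[THEN conjunct2, rule_format, OF W2]
            ty_NatInd.IH(4)[THEN conjunct2, rule_format, OF W] in \<open>simp_all only: comm\<close>)
    qed
  next
    case ty_Eq then show ?case by (simp; blast dest: goodD intro: ctx_typing.ty_Eq up W_ctx)
  next
    case ty_Refl then show ?case by (simp; blast dest: goodD intro: ctx_typing.ty_Refl up W_ctx)
  next
    case (ty_EqInd s A \<Gamma> C i c a b p)
    show ?case
    proof (intro conjI allI impI)
      show "good_ctx W \<Gamma>" using ty_EqInd.IH goodD by blast
      fix \<Delta> \<sigma> assume W: "W \<Delta> \<sigma> \<Gamma>"
      have W1: "W (subst \<sigma> A # \<Delta>) (up \<sigma>) (A # \<Gamma>)"
        using ty_EqInd.IH goodD by (blast intro: up W)
      have W2: "W (subst (up \<sigma>) (wk A) # subst \<sigma> A # \<Delta>) (up (up \<sigma>)) (wk A # A # \<Gamma>)"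
        using ty_EqInd.IH goodD by (blast intro: up W1)
      have W3: "W (subst (up (up \<sigma>)) (Eq s (wk (wk A)) (Var 1) (Var 0)) # subst (up \<sigma>) (wk A) #
        subst \<sigma> A # \<Delta>) (up (up (up \<sigma>))) (Eq s (wk (wk A)) (Var 1) (Var 0) # wk A # A # \<Gamma>)"
        using ty_EqInd.IH goodD by (blast intro: up W2)
      show "\<Delta> \<turnstile> subst \<sigma> (EqInd s C c a b p) \<Ztypecolon> subst \<sigma> (subst (p \<cdot> b \<cdot> a \<cdot> Var) C)"
        by (simp only: subst.simps subst_inst subst3, rule ctx_typing.ty_EqInd)
          (use ty_EqInd.IH(1)[THEN conjunct2, rule_format, OF W3]
            ty_EqInd.IH(2)[THEN conjunct2, rule_format, OF W1]
            ty_EqInd.IH(3)[THEN conjunct2, rule_format, OF W]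
            ty_EqInd.IH(4)[THEN conjunct2, rule_format, OF W]
            ty_EqInd.IH(5)[THEN conjunct2, rule_format, OF W] in \<open>simp_all only: comm\<close>)
    qed
  next
    case ty_List then show ?case by (simp; blast dest: goodD intro: ctx_typing.ty_List up W_ctx)
  next
    case ty_LNil then show ?case by (simp; blast dest: goodD intro: ctx_typing.ty_LNil up W_ctx)
  next
    case ty_LCons then show ?case by (simp; blast dest: goodD intro: ctx_typing.ty_LCons up W_ctx)
  next
    case (ty_ListInd A \<Gamma> C i c d l)
    show ?case
    proof (intro conjI allI impI)
      show "good_ctx W \<Gamma>" using ty_ListInd.IH goodD by blast
      fix \<Delta> \<sigma> assume W: "W \<Delta> \<sigma> \<Gamma>"
      have W1: "W (subst \<sigma> (List A) # \<Delta>) (up \<sigma>) (List A # \<Gamma>)"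
        using ty_ListInd.IH goodD by (blast intro: up W)
      \<comment> \<open>Only the branch for \<open>LCons\<close> has \<open>A\<close> itself in its
        context, below the tail and the induction hypothesis; two uses of \<open>goodD\<close>
        uncover it.\<close>
      have W2: "W (subst \<sigma> A # \<Delta>) (up \<sigma>) (A # \<Gamma>)"
        using ty_ListInd.IH(3)[THEN conjunct1, THEN goodD, THEN goodD] by (rule up[OF _ W])
      have W3: "W (subst (up \<sigma>) (wk (List A)) # subst \<sigma> A # \<Delta>) (up (up \<sigma>)) (wk (List A) # A # \<Gamma>)"
        using ty_ListInd.IH goodD by (blast intro: up W2)
      have W4: "W (subst (up (up \<sigma>)) (subst (Var 0 \<cdot> shifted 2) C) # subst (up \<sigma>) (wk (List A)) #
        subst \<sigma> A # \<Delta>) (up (up (up \<sigma>))) (subst (Var 0 \<cdot> shifted 2) C # wk (List A) # A # \<Gamma>)"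
        using ty_ListInd.IH goodD by (blast intro: up W3)
      show "\<Delta> \<turnstile> subst \<sigma> (ListInd C c d l) \<Ztypecolon> subst \<sigma> (inst C l)"
        by (simp only: subst.simps subst_inst subst3, rule ctx_typing.ty_ListInd)
          (use ty_ListInd.IH(1)[THEN conjunct2, rule_format, OF W1]
            ty_ListInd.IH(2)[THEN conjunct2, rule_format, OF W]
            ty_ListInd.IH(3)[THEN conjunct2, rule_format, OF W4]
            ty_ListInd.IH(4)[THEN conjunct2, rule_format, OF W] in \<open>simp_all only: comm\<close>)
    qed
  next
    case ty_Univalence then show ?case by (simp; blast dest: goodD intro: ctx_typing.ty_Univalence
      up W_ctx)
  next
    case ty_FunextE then show ?case by (simp; blast dest: goodD intro: ctx_typing.ty_FunextE up
      W_ctx)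
  next
    case ty_UipE then show ?case by (simp; blast dest: goodD intro: ctx_typing.ty_UipE up W_ctx)
  }
qed

section \<open>Weakening, then well-typed substitutions\<close>

lemma typing_ctx: "\<Gamma> \<turnstile> t \<Ztypecolon> A \<Longrightarrow> ctx \<Gamma>"
  by (induction rule: ctx_typing.inducts(2)[where ?P1.0 = "\<lambda>_. True"]) (auto elim: ctx.cases)

text \<open>Renamings, presented as substitutions so that they form an admissible class
  \<open>W\<close>. The condition compares the entries of the contexts syntactically instead of
  asking for typings of variables: in this form it passes below a binder by a computation with
  indices.\<close>

definition wf_ren :: "tm list \<Rightarrow> (nat \<Rightarrow> tm) \<Rightarrow> tm list \<Rightarrow> bool" where
  "wf_ren \<Delta> \<sigma> \<Gamma> \<longleftrightarrow> ctx \<Delta> \<and> (\<exists>r. \<sigma> = (\<lambda>n. Var (r n)) \<and> (\<forall>n<length \<Gamma>. r n < length \<Delta> \<and>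
     ren (\<lambda>m. m + Suc (r n)) (\<Delta> ! r n) = ren r (ren (\<lambda>m. m + Suc n) (\<Gamma> ! n))))"

lemma wf_ren_up:
  assumes "wf_ren \<Delta> \<sigma> \<Gamma>" "\<Delta> \<turnstile> subst \<sigma> A \<Ztypecolon> Univ Exo j"
  shows "wf_ren (subst \<sigma> A # \<Delta>) (up \<sigma>) (A # \<Gamma>)"
proof -
  from assms(1) obtain r where \<sigma>: "\<sigma> = (\<lambda>n. Var (r n))"
    and "\<forall>n<length \<Gamma>. r n < length \<Delta> \<and>
      ren (\<lambda>m. m + Suc (r n)) (\<Delta> ! r n) = ren r (ren (\<lambda>m. m + Suc n) (\<Gamma> ! n))"
    unfolding wf_ren_def by blast
  then have r: "r n < length \<Delta>"
      "ren (\<lambda>m. m + Suc (r n)) (\<Delta> ! r n) = ren r (ren (\<lambda>m. m + Suc n) (\<Gamma> ! n))"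
    if "n < length \<Gamma>" for n using that by blast+
  have "upren r n < length (subst \<sigma> A # \<Delta>) \<and>
      ren (\<lambda>m. m + Suc (upren r n)) ((subst \<sigma> A # \<Delta>) ! upren r n)
        = ren (upren r) (ren (\<lambda>m. m + Suc n) ((A # \<Gamma>) ! n))" if "n < length (A # \<Gamma>)" for n
  proof (cases n)
    case 0
    moreover have "subst \<sigma> A = ren r A" unfolding ren_as_subst by (rule arg_cong[OF \<sigma>])
    ultimately show ?thesis by (simp add: ren_ren)
  next
    case (Suc k)
    with that have k: "k < length \<Gamma>" by simp
    have "ren (\<lambda>m. m + Suc (Suc (r k))) (\<Delta> ! r k) = wk (ren (\<lambda>m. m + Suc (r k)) (\<Delta> ! r k))"
      by (simp add: ren_ren)
    also have "\<dots> = ren (upren r) (ren (\<lambda>m. m + Suc (Suc k)) (\<Gamma> ! k))"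
      using r(2)[OF k] by (simp add: ren_ren)
    finally show ?thesis using r(1)[OF k] Suc by simp
  qed
  with assms show ?thesis
    unfolding wf_ren_def by (auto simp: \<sigma> up_Var_upren intro: ctx_Cons)
qed

lemma typing_wk:
  assumes "\<Gamma> \<turnstile> t \<Ztypecolon> A" "ctx (B # \<Gamma>)"
  shows "B # \<Gamma> \<turnstile> wk t \<Ztypecolon> wk A"
proof -
  have "wf_ren (B # \<Gamma>) (\<lambda>n. Var (Suc n)) \<Gamma>"
    using assms(2) unfolding wf_ren_def by (auto simp: ren_ren)
  moreover have "\<Delta> \<turnstile> \<sigma> n \<Ztypecolon> subst \<sigma> (ren (\<lambda>m. m + Suc n) (\<Gamma> ! n))"
    if "wf_ren \<Delta> \<sigma> \<Gamma>" "n < length \<Gamma>" for \<Delta> \<sigma> \<Gamma> n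
  proof -
    from that obtain r where "\<sigma> = (\<lambda>n. Var (r n))" "ctx \<Delta>" "r n < length \<Delta>"
      "ren (\<lambda>m. m + Suc (r n)) (\<Delta> ! r n) = ren r (ren (\<lambda>m. m + Suc n) (\<Gamma> ! n))"
      unfolding wf_ren_def by blast
    then show ?thesis using ty_Var[of \<Delta> "r n"] by (metis ren_as_subst)
  qed
  moreover have "ctx \<Delta>" if "wf_ren \<Delta> \<sigma> \<Gamma>" for \<Delta> \<sigma> \<Gamma>
    using that by (simp add: wf_ren_def)
  ultimately have "B # \<Gamma> \<turnstile> subst (\<lambda>n. Var (Suc n)) t \<Ztypecolon> subst (\<lambda>n. Var (Suc n)) A"
    by (intro typing_subst_gen(2)[where W = wf_ren, OF _ _ wf_ren_up assms(1), THEN conjunct2,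
      rule_format])
  then show ?thesis by simp
qed

definition wf_sub :: "tm list \<Rightarrow> (nat \<Rightarrow> tm) \<Rightarrow> tm list \<Rightarrow> bool" where
  "wf_sub \<Delta> \<sigma> \<Gamma> \<longleftrightarrow> ctx \<Delta> \<and>
     (\<forall>n<length \<Gamma>. \<Delta> \<turnstile> \<sigma> n \<Ztypecolon> subst \<sigma> (ren (\<lambda>m. m + Suc n) (\<Gamma> ! n)))"

lemma wf_sub_wk:
  assumes "wf_sub \<Delta> \<sigma> \<Gamma>" "ctx (B # \<Delta>)"
  shows "wf_sub (B # \<Delta>) (\<lambda>n. wk (\<sigma> n)) \<Gamma>"
  using assms typing_wk[of \<Delta> _ _ B] unfolding wf_sub_def
  by (auto simp: ren_subst[symmetric])

lemma wf_sub_scons: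
  assumes "wf_sub \<Delta> \<sigma> \<Gamma>" "\<Delta> \<turnstile> a \<Ztypecolon> subst \<sigma> A"
  shows "wf_sub \<Delta> (a \<cdot> \<sigma>) (A # \<Gamma>)"
  using assms unfolding wf_sub_def
  by (auto simp: nth_Cons subst_ren split: nat.splits)

lemma var_0: "ctx (A # \<Gamma>) \<Longrightarrow> A # \<Gamma> \<turnstile> Var 0 \<Ztypecolon> wk A"
  using ty_Var[of "A # \<Gamma>" 0] by simp

lemma var_Suc: "\<Gamma> \<turnstile> Var n \<Ztypecolon> A \<Longrightarrow> ctx (B # \<Gamma>) \<Longrightarrow> B # \<Gamma> \<turnstile> Var (Suc n) \<Ztypecolon> wk A"
  using typing_wk[of \<Gamma> "Var n" A B] by simp

lemma wf_sub_up:
  assumes "wf_sub \<Delta> \<sigma> \<Gamma>" "\<Delta> \<turnstile> subst \<sigma> A \<Ztypecolon> Univ Exo j"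
  shows "wf_sub (subst \<sigma> A # \<Delta>) (up \<sigma>) (A # \<Gamma>)"
proof -
  have "ctx (subst \<sigma> A # \<Delta>)"
    using assms typing_ctx ctx_Cons by blast
  with wf_sub_wk[OF assms(1) this] var_0[OF this] show ?thesis
    unfolding up_def by (intro wf_sub_scons) (simp_all add: ren_subst)
qed

lemma typing_subst: "\<Gamma> \<turnstile> t \<Ztypecolon> A \<Longrightarrow> wf_sub \<Delta> \<sigma> \<Gamma> \<Longrightarrow> \<Delta> \<turnstile> subst \<sigma> t \<Ztypecolon> subst \<sigma> A"
  by (rule typing_subst_gen(2)[where W = wf_sub, OF _ _ wf_sub_up, THEN conjunct2, rule_format])
    (auto simp only: wf_sub_def)

lemma wf_sub_Var: "ctx \<Gamma> \<Longrightarrow> wf_sub \<Gamma> Var \<Gamma>"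
  unfolding wf_sub_def by (simp add: ty_Var del: add_Suc_right)

lemma typing_inst: "A # \<Gamma> \<turnstile> t \<Ztypecolon> B \<Longrightarrow> \<Gamma> \<turnstile> a \<Ztypecolon> A \<Longrightarrow> \<Gamma> \<turnstile> inst t a \<Ztypecolon> inst B a"
  by (rule typing_subst) (auto intro!: wf_sub_scons wf_sub_Var intro: typing_ctx)

subsection \<open>Exo-types and projections\<close>

text \<open>The universe index is left open and the level is always \<open>Exo\<close>: this is what
  contexts and conversion ask for, and inner types qualify as well.\<close>

definition isty :: "tm list \<Rightarrow> tm \<Rightarrow> bool" where
  "isty \<Gamma> A \<longleftrightarrow> (\<exists>j. \<Gamma> \<turnstile> A \<Ztypecolon> Univ Exo j)"

definition inhab :: "tm list \<Rightarrow> tm \<Rightarrow> bool" where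
  "inhab \<Gamma> A \<longleftrightarrow> (\<exists>t. \<Gamma> \<turnstile> t \<Ztypecolon> A)"

lemma cumul: "i \<le> j \<Longrightarrow> \<Gamma> \<turnstile> A \<Ztypecolon> Univ s i \<Longrightarrow> \<Gamma> \<turnstile> A \<Ztypecolon> Univ s j"
  by (induction rule: dec_induct) (auto intro: ty_cumul)

lemma isty_Exo: "\<Gamma> \<turnstile> A \<Ztypecolon> Univ Exo i \<Longrightarrow> isty \<Gamma> A"
  by (auto simp: isty_def)

lemma isty_Inner: "\<Gamma> \<turnstile> A \<Ztypecolon> Univ Inner i \<Longrightarrow> isty \<Gamma> A"
  by (auto simp: isty_def dest: ty_exo)

lemma isty_ctx: "isty \<Gamma> A \<Longrightarrow> ctx (A # \<Gamma>)"
  by (auto simp: isty_def intro: ctx_Cons typing_ctx)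

lemma ctx_isty: "ctx (A # \<Gamma>) \<Longrightarrow> isty \<Gamma> A"
  by (auto simp: isty_def elim: ctx.cases)

lemma isty_wk: "isty \<Gamma> A \<Longrightarrow> ctx (B # \<Gamma>) \<Longrightarrow> isty (B # \<Gamma>) (wk A)"
  by (fastforce simp: isty_def dest: typing_wk)

lemma isty_subst: "isty \<Gamma> A \<Longrightarrow> wf_sub \<Delta> \<sigma> \<Gamma> \<Longrightarrow> isty \<Delta> (subst \<sigma> A)"
  by (fastforce simp: isty_def dest: typing_subst)

lemma isty_inst: "isty (A # \<Gamma>) B \<Longrightarrow> \<Gamma> \<turnstile> a \<Ztypecolon> A \<Longrightarrow> isty \<Gamma> (inst B a)"
  by (fastforce simp: isty_def dest: typing_inst)

text \<open>Cumulativity raises both types to the maximum of their indices, which the formation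
  rules with a single index require.\<close>

lemma isty_common:
  assumes "isty \<Gamma> A" "isty \<Delta> B"
  obtains j where "\<Gamma> \<turnstile> A \<Ztypecolon> Univ Exo j" "\<Delta> \<turnstile> B \<Ztypecolon> Univ Exo j"
  using assms cumul[of _ "max _ _"] unfolding isty_def by (metis max.cobounded1 max.cobounded2)

lemma isty_Univ: "ctx \<Gamma> \<Longrightarrow> isty \<Gamma> (Univ s i)"
  by (cases s) (auto intro: isty_Exo isty_Inner ty_Univ)

lemma isty_Nat: "ctx \<Gamma> \<Longrightarrow> isty \<Gamma> (Nat s)"
  by (cases s) (auto intro: isty_Exo isty_Inner ty_Nat)

lemma isty_Pi: "isty \<Gamma> A \<Longrightarrow> isty (A # \<Gamma>) B \<Longrightarrow> isty \<Gamma> (Pi Exo A B)"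
  by (erule (1) isty_common) (auto intro: isty_Exo ty_Pi)

lemma isty_Sig: "isty \<Gamma> A \<Longrightarrow> isty (A # \<Gamma>) B \<Longrightarrow> isty \<Gamma> (Sig Exo A B)"
  by (erule (1) isty_common) (auto intro: isty_Exo ty_Sig)

lemma isty_Arr: "isty \<Gamma> A \<Longrightarrow> isty \<Gamma> B \<Longrightarrow> isty \<Gamma> (Arr Exo A B)"
  by (auto intro: isty_Pi isty_wk isty_ctx)

lemma isty_Prod: "isty \<Gamma> A \<Longrightarrow> isty \<Gamma> B \<Longrightarrow> isty \<Gamma> (Prod Exo A B)"
  by (auto intro: isty_Sig isty_wk isty_ctx)

lemma isty_Eq: "isty \<Gamma> A \<Longrightarrow> \<Gamma> \<turnstile> a \<Ztypecolon> A \<Longrightarrow> \<Gamma> \<turnstile> b \<Ztypecolon> A \<Longrightarrow> isty \<Gamma> (Eq Exo A a b)"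
  by (auto simp: isty_def intro: ty_Eq)

lemma isty_List: "isty \<Gamma> A \<Longrightarrow> isty \<Gamma> (List A)"
  by (auto simp: isty_def intro: ty_List)

lemma tconv: "\<Gamma> \<turnstile> t \<Ztypecolon> A \<Longrightarrow> A \<cong> B \<Longrightarrow> isty \<Gamma> B \<Longrightarrow> \<Gamma> \<turnstile> t \<Ztypecolon> B"
  by (auto simp: isty_def intro: ty_conv)

lemma inhab_conv: "inhab \<Gamma> A \<Longrightarrow> A \<cong> B \<Longrightarrow> isty \<Gamma> B \<Longrightarrow> inhab \<Gamma> B"
  unfolding inhab_def by (blast intro: tconv)

text \<open>That the domain is a type is read off from the context in which the body is
  typed.\<close>

lemma tLam: "A # \<Gamma> \<turnstile> b \<Ztypecolon> B \<Longrightarrow> isty (A # \<Gamma>) B \<Longrightarrow> \<Gamma> \<turnstile> Lam Exo b \<Ztypecolon> Pi Exo A B"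
  by (rule isty_common[OF ctx_isty[of A \<Gamma>]]) (auto intro: ty_Lam typing_ctx)

lemma tApp: "\<Gamma> \<turnstile> f \<Ztypecolon> Pi s A B \<Longrightarrow> \<Gamma> \<turnstile> a \<Ztypecolon> A \<Longrightarrow> inst B a = C \<Longrightarrow> \<Gamma> \<turnstile> App s f a \<Ztypecolon> C"
  using ty_App by blast

lemma inhab_Lam: "inhab (A # \<Gamma>) B \<Longrightarrow> isty (A # \<Gamma>) B \<Longrightarrow> inhab \<Gamma> (Pi Exo A B)"
  unfolding inhab_def by (blast intro: tLam)

lemma inhab_App: "inhab \<Gamma> (Pi Exo A B) \<Longrightarrow> \<Gamma> \<turnstile> a \<Ztypecolon> A \<Longrightarrow> inst B a = C \<Longrightarrow> inhab \<Gamma> C"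
  unfolding inhab_def by (blast intro: tApp)

lemma inhab_mp: "inhab \<Gamma> (Arr Exo A B) \<Longrightarrow> inhab \<Gamma> A \<Longrightarrow> inhab \<Gamma> B"
  unfolding inhab_def using ty_App[of \<Gamma> _ Exo A "wk B"] by fastforce

lemma tPair:
  assumes "isty (A # \<Gamma>) B" "\<Gamma> \<turnstile> a \<Ztypecolon> A" "\<Gamma> \<turnstile> b \<Ztypecolon> inst B a"
  shows "\<Gamma> \<turnstile> Pair Exo a b \<Ztypecolon> Sig Exo A B"
proof -
  from assms(1) have "ctx (A # \<Gamma>)" by (auto simp: isty_def dest: typing_ctx)
  then show ?thesis
    by (rule isty_common[OF ctx_isty assms(1)]) (auto intro: ty_Pair assms)
qed

section \<open>Projections and the inversion of formation rules\<close>

definition pr1 :: "tm \<Rightarrow> tm \<Rightarrow> tm" where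
  "pr1 A p = SigInd Exo (wk A) (Var 1) p"

text \<open>The motive is the family \<open>B\<close> at the first projection of the bound pair, so
  the arguments \<open>A\<close> and \<open>B\<close> are there to write it down: abstractions and
  pairs carry no type annotations from which it could be recovered.\<close>

definition pr2 :: "tm \<Rightarrow> tm \<Rightarrow> tm \<Rightarrow> tm" where
  "pr2 A B p = SigInd Exo (subst (pr1 (wk A) (Var 0) \<cdot> shifted 1) B) (Var 0) p"

lemma subst_pr1 [simp]: "subst \<sigma> (pr1 A p) = pr1 (subst \<sigma> A) (subst \<sigma> p)"
  by (simp add: pr1_def)

lemma ren_pr1 [simp]: "ren r (pr1 A p) = pr1 (ren r A) (ren r p)"
  by (simp add: pr1_def)

lemma subst_pr2 [simp]: "subst \<sigma> (pr2 A B p) = pr2 (subst \<sigma> A) (subst (up \<sigma>) B) (subst \<sigma> p)"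
  unfolding pr2_def by (simp only: subst.simps subst_branch) simp

lemma ren_pr2 [simp]: "ren r (pr2 A B p) = pr2 (ren r A) (ren (upren r) B) (ren r p)"
  by (simp only: ren_as_subst subst_pr2 up_Var_upren)

text \<open>Apart from the formation rule, only conversion, cumulativity and the passage to
  exo-types can end such a derivation, and these keep the term; induction on the derivation skips
  them.\<close>

lemma isty_of_Sig: "\<Gamma> \<turnstile> Sig s A B \<Ztypecolon> T \<Longrightarrow> isty \<Gamma> A \<and> isty (A # \<Gamma>) B"
proof (induction "\<Gamma>" "Sig s A B" T rule: ctx_typing.inducts(2)[where ?P1.0 = "\<lambda>_. True"])
  case (ty_Sig \<Gamma> i)
  then show ?case by (cases s) (auto intro: isty_Exo isty_Inner)
qed simp_all

lemma isty_of_Pi: "\<Gamma> \<turnstile> Pi s A B \<Ztypecolon> T \<Longrightarrow> isty \<Gamma> A \<and> isty (A # \<Gamma>) B"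
proof (induction "\<Gamma>" "Pi s A B" T rule: ctx_typing.inducts(2)[where ?P1.0 = "\<lambda>_. True"])
  case (ty_Pi \<Gamma> i)
  then show ?case by (cases s) (auto intro: isty_Exo isty_Inner)
qed simp_all

lemma isty_Pi_iff: "isty \<Gamma> (Pi Exo A B) \<longleftrightarrow> isty \<Gamma> A \<and> isty (A # \<Gamma>) B"
  by (metis isty_Pi isty_def isty_of_Pi)

lemma isty_Sig_iff: "isty \<Gamma> (Sig Exo A B) \<longleftrightarrow> isty \<Gamma> A \<and> isty (A # \<Gamma>) B"
  by (metis isty_Sig isty_def isty_of_Sig)

lemma isty_of_Sig': "isty \<Gamma> (Sig Exo A B) \<Longrightarrow> isty \<Gamma> A" "isty \<Gamma> (Sig Exo A B) \<Longrightarrow> isty (A # \<Gamma>) B"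
  by (simp_all add: isty_Sig_iff)

lemma tpr1:
  assumes "\<Gamma> \<turnstile> p \<Ztypecolon> Sig Exo A B" "isty \<Gamma> A" "isty (A # \<Gamma>) B"
  shows "\<Gamma> \<turnstile> pr1 A p \<Ztypecolon> A"
proof -
  have "isty (Sig Exo A B # \<Gamma>) (wk A)"
    using assms by (intro isty_wk isty_ctx isty_Sig)
  then obtain j where j: "Sig Exo A B # \<Gamma> \<turnstile> wk A \<Ztypecolon> Univ Exo j" by (auto simp: isty_def)
  have "B # A # \<Gamma> \<turnstile> Var 1 \<Ztypecolon> wk (wk A)"
    using assms isty_ctx var_Suc[OF var_0] by simp
  with j assms(1) have "\<Gamma> \<turnstile> SigInd Exo (wk A) (Var 1) p \<Ztypecolon> inst (wk A) p"
    by (intro ty_SigInd) simp_all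
  then show ?thesis by (simp add: pr1_def)
qed

lemma pr1_Pair: "pr1 A (Pair Exo a b) \<cong> a"
  using beta_Sig[of Exo "wk A" "Var 1" a b] by (simp add: pr1_def)

lemma wf_sub_shift1:
  "ctx (B # \<Gamma>) \<Longrightarrow> wf_sub (B # \<Gamma>) (shifted 1) \<Gamma>"
  using wf_sub_wk[OF wf_sub_Var, of \<Gamma> B] by (auto elim: ctx.cases)

lemma wf_sub_shift2:
  "ctx (C # B # \<Gamma>) \<Longrightarrow> wf_sub (C # B # \<Gamma>) (shifted 2) \<Gamma>"
  using wf_sub_wk[OF wf_sub_shift1, of B \<Gamma> C] by (auto elim: ctx.cases)

lemma wf_sub_shift3:
  "ctx (D # C # B # \<Gamma>) \<Longrightarrow> wf_sub (D # C # B # \<Gamma>) (shifted 3) \<Gamma>"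
  using wf_sub_wk[OF wf_sub_shift2, of C B \<Gamma> D] by (auto elim: ctx.cases simp: eval_nat_numeral)

text \<open>The branch of the eliminator must inhabit \<open>B\<close> at the first projection of
  the pair \<open>(x, y)\<close>, whereas \<open>y\<close> inhabits \<open>B\<close> at
  \<open>x\<close>. The computation rule \<open>pr1_Pair\<close>, pushed through \<open>B\<close>,
  makes the two types convertible.\<close>

lemma tpr2:
  assumes p: "\<Gamma> \<turnstile> p \<Ztypecolon> Sig Exo A B" and A: "isty \<Gamma> A" and B: "isty (A # \<Gamma>) B"
  shows "\<Gamma> \<turnstile> pr2 A B p \<Ztypecolon> inst B (pr1 A p)"
proof -
  let ?S = "Sig Exo A B"
  let ?C = "subst (pr1 (wk A) (Var 0) \<cdot> shifted 1) B"
  have S: "isty \<Gamma> ?S" using A B by (rule isty_Sig)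
  have SS: "ctx (?S # \<Gamma>)" using S by (rule isty_ctx)
  have "?S # \<Gamma> \<turnstile> pr1 (wk A) (Var 0) \<Ztypecolon> wk A"
    using isty_of_Sig'[OF isty_wk[OF S SS, simplified]] var_0[OF SS] by (auto intro: tpr1)
  then have C: "isty (?S # \<Gamma>) ?C"
    by (intro isty_subst[OF B] wf_sub_scons wf_sub_shift1 SS) simp
  have B2: "ctx (B # A # \<Gamma>)" using B by (rule isty_ctx)
  have pair: "B # A # \<Gamma> \<turnstile> Pair Exo (Var 1) (Var 0) \<Ztypecolon> wk (wk ?S)"
  proof -
    have "isty (B # A # \<Gamma>) (wk (wk ?S))"
      using isty_wk[OF isty_wk[OF S isty_ctx[OF A]] B2] by simp
    \<comment> \<open>Over \<open>B # A # \<Gamma>\<close> the family at the variable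
      \<open>Var 1\<close> of type \<open>A\<close> is \<open>B\<close> weakened past the second
      component.\<close>
    moreover have "inst (ren (upren Suc) (ren (upren Suc) B)) (Var 1) = wk B"
      unfolding ren_ren subst_ren unfolding ren_as_subst
      by (rule subst_eq) (simp add: upren_def split: nat.split)
    ultimately show ?thesis
      using isty_of_Sig'(2) var_0[OF B2] var_Suc[OF var_0[OF isty_ctx[OF A]] B2]
      by (simp, intro tPair) simp_all
  qed
  have "B # A # \<Gamma> \<turnstile> Var 0 \<Ztypecolon> subst (Pair Exo (Var 1) (Var 0) \<cdot> shifted 2) ?C"
  proof (rule tconv[OF var_0[OF B2]])
    have "wk B = subst (Var 1 \<cdot> shifted 2) B"
      unfolding ren_as_subst by (rule subst_eq) (simp split: nat.split)
    moreover have "subst (Pair Exo (Var 1) (Var 0) \<cdot> shifted 2) ?C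
      = subst (pr1 (wk (wk A)) (Pair Exo (Var 1) (Var 0)) \<cdot> shifted 2) B"
      unfolding subst_subst by (rule subst_eq) (simp split: nat.split)
    ultimately show "wk B \<cong> subst (Pair Exo (Var 1) (Var 0) \<cdot> shifted 2) ?C"
      by (auto intro!: conv_subst_conv simp: conv_sub_def split: nat.split intro: conv_refl
        conv_sym[OF pr1_Pair])
    show "isty (B # A # \<Gamma>) (subst (Pair Exo (Var 1) (Var 0) \<cdot> shifted 2) ?C)"
      by (rule isty_subst[OF C wf_sub_scons[OF wf_sub_shift2[OF B2]]]) (use pair in simp)
  qed
  with C p have "\<Gamma> \<turnstile> SigInd Exo ?C (Var 0) p \<Ztypecolon> inst ?C p"
    unfolding isty_def by (blast intro: ty_SigInd)
  moreover have "inst ?C p = inst B (pr1 A p)"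
    unfolding subst_subst by (rule subst_eq) (simp split: nat.split)
  ultimately show ?thesis by (simp add: pr2_def)
qed

subsection \<open>Exo-equality up to existence of a proof\<close>

lemma scons_shift [simp]: "(Var 0 \<cdot> (\<lambda>n. Var (Suc n))) = Var"
  by (rule ext) (simp split: nat.split)

lemma inst_wk_up [simp]: "inst (ren (upren Suc) B) (Var 0) = B"
  unfolding subst_ren by (rule trans[OF subst_eq subst_Var]) (simp add: upren_def split: nat.split)

lemma subst_ren_upren [simp]:
  "subst (c \<cdot> a \<cdot> \<tau>) (ren (upren Suc) t) = subst (c \<cdot> \<tau>) t"
  "subst (up (a \<cdot> \<tau>)) (ren (upren Suc) t) = subst (up \<tau>) t"
  "subst (up (up \<sigma>)) (ren (upren Suc) t) = ren (upren Suc) (subst (up \<sigma>) t)"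
  unfolding subst_ren ren_subst
  by (rule subst_eq, simp add: up_def upren_def ren_ren split: nat.split)+

lemma typing_Lam_ctx: "A # \<Gamma> \<turnstile> b \<Ztypecolon> B \<Longrightarrow> isty \<Gamma> A"
  using typing_ctx ctx_isty by blast

lemma isty_ctx_tl: "isty \<Gamma> A \<Longrightarrow> ctx \<Gamma>"
  by (auto simp: isty_def dest: typing_ctx)

text \<open>Typings of the type and of both sides are included, so that equations can be chained and
  carried along conversions without separate side conditions on the old sides.\<close>

definition exo_eq :: "tm list \<Rightarrow> tm \<Rightarrow> tm \<Rightarrow> tm \<Rightarrow> bool" where
  "exo_eq \<Gamma> A a b \<longleftrightarrow> isty \<Gamma> A \<and> \<Gamma> \<turnstile> a \<Ztypecolon> A \<and> \<Gamma> \<turnstile> b \<Ztypecolon> A \<and> inhab \<Gamma> (Eq Exo A a b)"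

lemma exo_eqI_conv:
  assumes "isty \<Gamma> A" "\<Gamma> \<turnstile> a \<Ztypecolon> A" "\<Gamma> \<turnstile> b \<Ztypecolon> A" "a \<cong> b"
  shows "exo_eq \<Gamma> A a b"
proof -
  from assms(1) obtain j where "\<Gamma> \<turnstile> A \<Ztypecolon> Univ Exo j" by (auto simp: isty_def)
  then have "\<Gamma> \<turnstile> Refl Exo a \<Ztypecolon> Eq Exo A a a" using assms(2) by (rule ty_Refl)
  then have "\<Gamma> \<turnstile> Refl Exo a \<Ztypecolon> Eq Exo A a b"
    by (rule tconv) (use assms in \<open>auto intro: cong_Eq conv_refl isty_Eq\<close>)
  then show ?thesis using assms unfolding exo_eq_def inhab_def by blast
qed

lemma exo_eq_refl: "isty \<Gamma> A \<Longrightarrow> \<Gamma> \<turnstile> a \<Ztypecolon> A \<Longrightarrow> exo_eq \<Gamma> A a a"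
  by (rule exo_eqI_conv) (auto intro: conv_refl)

lemma exo_eq_conv:
  assumes "exo_eq \<Gamma> A a b" "A \<cong> A'" "a \<cong> a'" "b \<cong> b'" "isty \<Gamma> A'" "\<Gamma> \<turnstile> a' \<Ztypecolon> A'" "\<Gamma> \<turnstile> b' \<Ztypecolon> A'"
  shows "exo_eq \<Gamma> A' a' b'"
  using assms unfolding exo_eq_def by (auto intro: inhab_conv cong_Eq isty_Eq)

text \<open>Induction on the equation with the motive \<open>C x \<rightarrow> C y\<close> and the
  identity as its branch. Below the two end points and the proof, \<open>Var 2\<close> is
  \<open>x\<close> and \<open>Var 1\<close> is \<open>y\<close>; \<open>C\<close> may be any
  exo-type, as the equation is an exo-equality.\<close>

lemma exo_eq_leibniz:
  assumes e: "exo_eq \<Gamma> A a b" and C: "isty (A # \<Gamma>) C" and c: "inhab \<Gamma> (inst C a)"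
  shows "inhab \<Gamma> (inst C b)"
proof -
  let ?E = "Eq Exo (wk (wk A)) (Var 1) (Var 0)"
  let ?C2 = "subst (Var 2 \<cdot> shifted 3) C" and ?C1 = "subst (Var 1 \<cdot> shifted 3) C"
  from e obtain p where A: "isty \<Gamma> A" and a: "\<Gamma> \<turnstile> a \<Ztypecolon> A" and b: "\<Gamma> \<turnstile> b \<Ztypecolon> A"
    and p: "\<Gamma> \<turnstile> p \<Ztypecolon> Eq Exo A a b" unfolding exo_eq_def inhab_def by blast
  have c1: "ctx (A # \<Gamma>)" using A by (rule isty_ctx)
  have A1: "isty (A # \<Gamma>) (wk A)" using A c1 by (rule isty_wk)
  have c2: "ctx (wk A # A # \<Gamma>)" using A1 by (rule isty_ctx)
  have A2: "isty (wk A # A # \<Gamma>) (wk (wk A))" using A1 c2 by (rule isty_wk)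
  note v0 = var_0[OF c2] and v1 = var_Suc[OF var_0[OF c1] c2]
  have E: "isty (wk A # A # \<Gamma>) ?E" using A2 v0 v1 by (intro isty_Eq) simp_all
  then have c3: "ctx (?E # wk A # A # \<Gamma>)" by (rule isty_ctx)
  have C2: "isty (?E # wk A # A # \<Gamma>) ?C2"
    using var_Suc[OF v1 c3]
    by (intro isty_subst[OF C] wf_sub_scons wf_sub_shift3 c3) (simp add: eval_nat_numeral)
  have C1: "isty (?E # wk A # A # \<Gamma>) ?C1"
    using var_Suc[OF v0 c3]
    by (intro isty_subst[OF C] wf_sub_scons wf_sub_shift3 c3) (simp add: eval_nat_numeral)
  have M: "isty (?E # wk A # A # \<Gamma>) (Arr Exo ?C2 ?C1)" using C2 C1 by (rule isty_Arr)
  \<comment> \<open>Kept general in the end points, so that it computes the motive both in the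
    reflexivity branch and in the conclusion.\<close>
  have eq: "subst (x \<cdot> y \<cdot> z \<cdot> \<tau>) (Arr Exo ?C2 ?C1) = Arr Exo (subst (z \<cdot> \<tau>) C) (subst (y \<cdot> \<tau>) C)"
    for x y z \<tau>
    unfolding subst.simps subst_up_wk subst_subst
    by (intro arg_cong2[where f = "Pi Exo"] arg_cong[where f = wk] subst_eq)
      (auto simp: eval_nat_numeral split: nat.split)
  have "A # \<Gamma> \<turnstile> idfun Exo \<Ztypecolon> Arr Exo C C"
    using C isty_ctx[OF C] by (intro tLam isty_wk var_0)
  then have "A # \<Gamma> \<turnstile> idfun Exo \<Ztypecolon> subst (Refl Exo (Var 0) \<cdot> Var 0 \<cdot> Var 0 \<cdot> shifted 1)
    (Arr Exo ?C2 ?C1)"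
    unfolding eq by simp
  with M a b p have "\<Gamma> \<turnstile> EqInd Exo (Arr Exo ?C2 ?C1) (idfun Exo) a b p
      \<Ztypecolon> subst (p \<cdot> b \<cdot> a \<cdot> Var) (Arr Exo ?C2 ?C1)"
    unfolding isty_def by (blast intro: ty_EqInd)
  then have "\<Gamma> \<turnstile> EqInd Exo (Arr Exo ?C2 ?C1) (idfun Exo) a b p \<Ztypecolon> Arr Exo (inst C a) (inst C b)"
    unfolding eq .
  then show ?thesis using c inhab_mp unfolding inhab_def by blast
qed

text \<open>Transport in the family of equations \<open>t a = t x\<close>, starting from reflexivity
  at \<open>x = a\<close>. The type \<open>B\<close> is constant, so both sides have the same
  type.\<close>

lemma exo_eq_cong:
  assumes e: "exo_eq \<Gamma> A a b" and t: "A # \<Gamma> \<turnstile> t \<Ztypecolon> wk B" and B: "isty \<Gamma> B"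
  shows "exo_eq \<Gamma> B (inst t a) (inst t b)"
proof -
  from e have A: "isty \<Gamma> A" and a: "\<Gamma> \<turnstile> a \<Ztypecolon> A" and b: "\<Gamma> \<turnstile> b \<Ztypecolon> A"
    unfolding exo_eq_def by blast+
  have ta: "\<Gamma> \<turnstile> inst t a \<Ztypecolon> B" and tb: "\<Gamma> \<turnstile> inst t b \<Ztypecolon> B"
    using typing_inst[OF t a] typing_inst[OF t b] by simp_all
  have c: "ctx (A # \<Gamma>)" using A by (rule isty_ctx)
  have "inhab \<Gamma> (inst (Eq Exo (wk B) (wk (inst t a)) t) b)"
  proof (rule exo_eq_leibniz[OF e])
    show "isty (A # \<Gamma>) (Eq Exo (wk B) (wk (inst t a)) t)"
      using B c t typing_wk[OF ta c] by (intro isty_Eq isty_wk)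
    show "inhab \<Gamma> (inst (Eq Exo (wk B) (wk (inst t a)) t) a)"
      using exo_eq_refl[OF B ta] by (simp add: exo_eq_def)
  qed
  then show ?thesis using B ta tb by (simp add: exo_eq_def)
qed

lemma exo_eq_trans:
  assumes "exo_eq \<Gamma> A a b" "exo_eq \<Gamma> A b d"
  shows "exo_eq \<Gamma> A a d"
proof -
  from assms have A: "isty \<Gamma> A" and a: "\<Gamma> \<turnstile> a \<Ztypecolon> A" and d: "\<Gamma> \<turnstile> d \<Ztypecolon> A"
    unfolding exo_eq_def by blast+
  have c: "ctx (A # \<Gamma>)" using A by (rule isty_ctx)
  have "inhab \<Gamma> (inst (Eq Exo (wk A) (wk a) (Var 0)) d)"
  proof (rule exo_eq_leibniz[OF assms(2)])
    show "isty (A # \<Gamma>) (Eq Exo (wk A) (wk a) (Var 0))"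
      using A c var_0[OF c] typing_wk[OF a c] by (intro isty_Eq isty_wk)
    show "inhab \<Gamma> (inst (Eq Exo (wk A) (wk a) (Var 0)) b)"
      using assms(1) by (simp add: exo_eq_def)
  qed
  then show ?thesis using A a d by (simp add: exo_eq_def)
qed

text \<open>Congruence along \<open>x \<mapsto> x a\<close>: the argument is fixed, so the type
  \<open>inst B a\<close> of the result is constant even for dependent functions.\<close>

lemma exo_eq_happly:
  assumes e: "exo_eq \<Gamma> (Pi Exo A B) f g" and a: "\<Gamma> \<turnstile> a \<Ztypecolon> A"
  shows "exo_eq \<Gamma> (inst B a) (App Exo f a) (App Exo g a)"
proof -
  let ?P = "Pi Exo A B"
  from e have P: "isty \<Gamma> ?P" unfolding exo_eq_def by blast
  have c: "ctx (?P # \<Gamma>)" using P by (rule isty_ctx)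
  have "?P # \<Gamma> \<turnstile> App Exo (Var 0) (wk a) \<Ztypecolon> wk (inst B a)"
    using var_0[OF c] typing_wk[OF a c] by (auto intro!: tApp)
  then have "exo_eq \<Gamma> (inst B a) (inst (App Exo (Var 0) (wk a)) f)
    (inst (App Exo (Var 0) (wk a)) g)"
    using P a by (intro exo_eq_cong[OF e] isty_inst) (auto simp: isty_Pi_iff)
  then show ?thesis by simp
qed

text \<open>The axiom quantifies over families given as function terms, while \<open>B\<close> is an
  open type. The proof therefore passes to \<open>Lam Exo B\<close>, applies the axiom to products
  of its values, and returns along the beta conversion; domain and family are first put into a
  common universe.\<close>

lemma exo_eq_funext:
  assumes B: "isty (A # \<Gamma>) B" and f: "\<Gamma> \<turnstile> f \<Ztypecolon> Pi Exo A B" and g: "\<Gamma> \<turnstile> g \<Ztypecolon> Pi Exo A B"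
    and e: "exo_eq (A # \<Gamma>) B (App Exo (wk f) (Var 0)) (App Exo (wk g) (Var 0))"
  shows "exo_eq \<Gamma> (Pi Exo A B) f g"
proof -
  have A: "isty \<Gamma> A" using B isty_ctx_tl ctx_isty by blast
  have c0: "ctx \<Gamma>" using A by (rule isty_ctx_tl)
  have c: "ctx (A # \<Gamma>)" using A by (rule isty_ctx)
  obtain j where Aj: "\<Gamma> \<turnstile> A \<Ztypecolon> Univ Exo j" and Bj: "A # \<Gamma> \<turnstile> B \<Ztypecolon> Univ Exo j"
    using A B by (rule isty_common)
  define B' where "B' = Lam Exo B"
  let ?P = "Pi Exo A (App Exo (wk B') (Var 0))"
  have TB: "\<Gamma> \<turnstile> B' \<Ztypecolon> Arr Exo A (Univ Exo j)"
    unfolding B'_def using Bj isty_Univ[OF c] by (auto intro: tLam)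
  have cv: "App Exo (wk B') (Var 0) \<cong> B"
    using beta_Pi[of Exo "ren (upren Suc) B" "Var 0"] by (simp add: B'_def)
  have cP: "?P \<cong> Pi Exo A B" by (intro cong_Pi conv_refl cv)
  have AB: "isty (A # \<Gamma>) (App Exo (wk B') (Var 0))"
    using typing_wk[OF TB c] var_0[OF c] by (intro isty_Exo[of _ _ j] tApp) auto
  then have P: "isty \<Gamma> ?P" using A by (intro isty_Pi)
  have f': "\<Gamma> \<turnstile> f \<Ztypecolon> ?P" and g': "\<Gamma> \<turnstile> g \<Ztypecolon> ?P"
    using f g P by (blast intro: tconv conv_sym[OF cP])+
  have f1: "A # \<Gamma> \<turnstile> App Exo (wk f) (Var 0) \<Ztypecolon> App Exo (wk B') (Var 0)"
    using typing_wk[OF f' c] var_0[OF c] by (auto intro!: tApp)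
  have g1: "A # \<Gamma> \<turnstile> App Exo (wk g) (Var 0) \<Ztypecolon> App Exo (wk B') (Var 0)"
    using typing_wk[OF g' c] var_0[OF c] by (auto intro!: tApp)
  have "exo_eq (A # \<Gamma>) (App Exo (wk B') (Var 0)) (App Exo (wk f) (Var 0)) (App Exo (wk g) (Var 0))"
    by (rule exo_eq_conv[OF e conv_sym[OF cv] conv_refl conv_refl AB f1 g1])
  then have e': "inhab \<Gamma> (Pi Exo A (Eq Exo (App Exo (wk B') (Var 0)) (App Exo (wk f) (Var 0))
    (App Exo (wk g) (Var 0))))"
    unfolding exo_eq_def using AB f1 g1 by (intro inhab_Lam isty_Eq) auto
  have "inhab \<Gamma> (funextE_ty j)"
    using ty_FunextE[OF c0] unfolding inhab_def by blast
  note 1 = inhab_App[OF this[unfolded funextE_ty_def] Aj refl]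
  note 2 = inhab_App[OF 1[simplified] _ refl, of B']
  note 3 = inhab_App[OF 2[simplified] _ refl, of f]
  note 4 = inhab_App[OF 3[simplified] _ refl, of g]
  have "inhab \<Gamma> (Arr Exo (Pi Exo A (Eq Exo (App Exo (wk B') (Var 0)) (App Exo (wk f) (Var 0))
    (App Exo (wk g) (Var 0)))) (Eq Exo ?P f g))"
    using 4 TB f' g' by (simp add: eval_nat_numeral)
  from inhab_mp[OF this e'] have "exo_eq \<Gamma> ?P f g"
    using P f' g' by (simp add: exo_eq_def)
  then show ?thesis
    by (rule exo_eq_conv[OF _ cP conv_refl conv_refl isty_Pi[OF A B] f g])
qed

subsection \<open>Exo-isomorphisms, fibrancy and cofibrancy\<close>

lemma tidfun: "isty \<Gamma> A \<Longrightarrow> \<Gamma> \<turnstile> idfun Exo \<Ztypecolon> Arr Exo A A"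
  by (intro tLam var_0 isty_wk isty_ctx)

lemma tArr_wk: "\<Gamma> \<turnstile> f \<Ztypecolon> Arr Exo A B \<Longrightarrow> ctx (C # \<Gamma>) \<Longrightarrow> C # \<Gamma> \<turnstile> wk f \<Ztypecolon> Arr Exo (wk A) (wk B)"
  using typing_wk[of \<Gamma> f "Arr Exo A B"] by simp

lemma tArr_App: "\<Gamma> \<turnstile> f \<Ztypecolon> Arr s A B \<Longrightarrow> \<Gamma> \<turnstile> a \<Ztypecolon> A \<Longrightarrow> \<Gamma> \<turnstile> App s f a \<Ztypecolon> B"
  by (erule tApp) simp_all

lemma tcomp:
  assumes "\<Gamma> \<turnstile> f \<Ztypecolon> Arr Exo B C" "\<Gamma> \<turnstile> g \<Ztypecolon> Arr Exo A B" "isty \<Gamma> A" "isty \<Gamma> C"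
  shows "\<Gamma> \<turnstile> comp Exo f g \<Ztypecolon> Arr Exo A C"
proof -
  have c: "ctx (A # \<Gamma>)" using assms(3) by (rule isty_ctx)
  have "A # \<Gamma> \<turnstile> App Exo (wk f) (App Exo (wk g) (Var 0)) \<Ztypecolon> wk C"
    by (rule tArr_App[OF tArr_wk[OF assms(1) c] tArr_App[OF tArr_wk[OF assms(2) c] var_0[OF c]]])
  then show ?thesis using isty_wk[OF assms(4) c] by (rule tLam)
qed

text \<open>Exo-isomorphisms are given by equations between composites; evaluated at
  \<open>a\<close>, both sides reduce by beta to the pointwise law used in calculations.\<close>

lemma exo_eq_comp_App:
  assumes e: "exo_eq \<Gamma> (Arr Exo A A) (comp Exo f g) (idfun Exo)" and a: "\<Gamma> \<turnstile> a \<Ztypecolon> A"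
    and t: "\<Gamma> \<turnstile> App Exo f (App Exo g a) \<Ztypecolon> A"
  shows "exo_eq \<Gamma> A (App Exo f (App Exo g a)) a"
proof -
  from e have "isty \<Gamma> A" by (auto simp: exo_eq_def isty_Pi_iff)
  moreover have "exo_eq \<Gamma> A (App Exo (comp Exo f g) a) (App Exo (idfun Exo) a)"
    using exo_eq_happly[OF e a] by simp
  moreover have "App Exo (comp Exo f g) a \<cong> App Exo f (App Exo g a)"
    using beta_Pi[of Exo "App Exo (wk f) (App Exo (wk g) (Var 0))" a] by simp
  moreover have "App Exo (idfun Exo) a \<cong> a"
    using beta_Pi[of Exo "Var 0" a] by simp
  ultimately show ?thesis using a t conv_refl by (metis exo_eq_conv)
qed

lemma exo_eq_comp:
  assumes f: "\<Gamma> \<turnstile> f \<Ztypecolon> Arr Exo B A" and g: "\<Gamma> \<turnstile> g \<Ztypecolon> Arr Exo A B" and A: "isty \<Gamma> A"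
    and e: "exo_eq (A # \<Gamma>) (wk A) (App Exo (wk f) (App Exo (wk g) (Var 0))) (Var 0)"
  shows "exo_eq \<Gamma> (Arr Exo A A) (comp Exo f g) (idfun Exo)"
proof (rule exo_eq_funext)
  have c: "ctx (A # \<Gamma>)" using A by (rule isty_ctx)
  show A1: "isty (A # \<Gamma>) (wk A)" using A c by (rule isty_wk)
  show f1: "\<Gamma> \<turnstile> comp Exo f g \<Ztypecolon> Arr Exo A A" using f g A A by (rule tcomp)
  show g1: "\<Gamma> \<turnstile> idfun Exo \<Ztypecolon> Arr Exo A A" using A by (rule tidfun)
  have "App Exo (wk (comp Exo f g)) (Var 0) \<cong> App Exo (wk f) (App Exo (wk g) (Var 0))"
    using beta_Pi[of Exo "App Exo (wk (wk f)) (App Exo (wk (wk g)) (Var 0))" "Var 0"] by simp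
  moreover have "App Exo (wk (idfun Exo)) (Var 0) \<cong> Var 0"
    using beta_Pi[of Exo "Var 0" "Var 0"] by simp
  ultimately show "exo_eq (A # \<Gamma>) (wk A) (App Exo (wk (comp Exo f g)) (Var 0))
    (App Exo (wk (idfun Exo)) (Var 0))"
    by (intro exo_eq_conv[OF e conv_refl conv_sym conv_sym A1]
        tArr_App[OF tArr_wk[OF f1 c] var_0[OF c]] tArr_App[OF tArr_wk[OF g1 c] var_0[OF c]])
qed

section \<open>The components of an exo-isomorphism\<close>

definition iso_laws :: "tm \<Rightarrow> tm \<Rightarrow> tm \<Rightarrow> tm \<Rightarrow> tm" where
  "iso_laws A B f g = Prod Exo (Eq Exo (Arr Exo B B) (comp Exo f g) (idfun Exo))
     (Eq Exo (Arr Exo A A) (comp Exo g f) (idfun Exo))"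

lemma subst_iso_laws [simp]:
  "subst \<sigma> (iso_laws A B f g) = iso_laws (subst \<sigma> A) (subst \<sigma> B) (subst \<sigma> f) (subst \<sigma> g)"
  by (simp add: iso_laws_def)

lemma ren_iso_laws [simp]:
  "ren r (iso_laws A B f g) = iso_laws (ren r A) (ren r B) (ren r f) (ren r g)"
  by (simp add: iso_laws_def)

text \<open>\<open>exo_iso\<close> is cut at its binders into pieces that have the maps as
  parameters instead of variables; substitution then commutes with each piece and the components can
  be projected one at a time.\<close>

definition iso_tail :: "tm \<Rightarrow> tm \<Rightarrow> tm \<Rightarrow> tm" where
  "iso_tail A B f = Sig Exo (Arr Exo B A) (iso_laws (wk A) (wk B) (wk f) (Var 0))"

lemma subst_iso_tail [simp]:
  "subst \<sigma> (iso_tail A B f) = iso_tail (subst \<sigma> A) (subst \<sigma> B) (subst \<sigma> f)"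
  by (simp add: iso_tail_def)

lemma ren_iso_tail [simp]:
  "ren r (iso_tail A B f) = iso_tail (ren r A) (ren r B) (ren r f)"
  by (simp add: iso_tail_def)

lemma exo_iso_alt: "exo_iso A B = Sig Exo (Arr Exo A B) (iso_tail (wk A) (wk B) (Var 0))"
  by (simp add: exo_iso_def iso_tail_def iso_laws_def)

lemma subst_exo_iso [simp]: "subst \<sigma> (exo_iso A B) = exo_iso (subst \<sigma> A) (subst \<sigma> B)"
  by (simp add: exo_iso_alt)

lemma ren_exo_iso [simp]: "ren r (exo_iso A B) = exo_iso (ren r A) (ren r B)"
  by (simp add: exo_iso_alt)

lemma subst_is_fibrant [simp]: "subst \<sigma> (is_fibrant i A) = is_fibrant i (subst \<sigma> A)"
  by (simp add: is_fibrant_def)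

lemma ren_is_fibrant [simp]: "ren r (is_fibrant i A) = is_fibrant i (ren r A)"
  by (simp add: is_fibrant_def)

lemma fibrant_match_alt: "fibrant_match i p = pr1 (Univ Inner i) p"
  by (simp add: fibrant_match_def pr1_def)

lemma subst_fibrant_match [simp]: "subst \<sigma> (fibrant_match i p) = fibrant_match i (subst \<sigma> p)"
  by (simp add: fibrant_match_alt)

lemma ren_fibrant_match [simp]: "ren r (fibrant_match i p) = fibrant_match i (ren r p)"
  by (simp add: fibrant_match_alt)

lemma subst_is_contr [simp]: "subst \<sigma> (is_contr A) = is_contr (subst \<sigma> A)"
  by (simp add: is_contr_def)

lemma ren_is_contr [simp]: "ren r (is_contr A) = is_contr (ren r A)"
  by (simp add: is_contr_def)

lemma isty_iso_laws:
  assumes "isty \<Gamma> A" "isty \<Gamma> B" "\<Gamma> \<turnstile> f \<Ztypecolon> Arr Exo A B" "\<Gamma> \<turnstile> g \<Ztypecolon> Arr Exo B A"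
  shows "isty \<Gamma> (iso_laws A B f g)"
  unfolding iso_laws_def using assms by (intro isty_Prod isty_Eq isty_Arr tcomp tidfun)

lemma isty_iso_tail:
  assumes A: "isty \<Gamma> A" and B: "isty \<Gamma> B" and f: "\<Gamma> \<turnstile> f \<Ztypecolon> Arr Exo A B"
  shows "isty \<Gamma> (iso_tail A B f)"
proof -
  have BA: "isty \<Gamma> (Arr Exo B A)" using B A by (rule isty_Arr)
  then have c: "ctx (Arr Exo B A # \<Gamma>)" by (rule isty_ctx)
  show ?thesis
    unfolding iso_tail_def
    using var_0[OF c] by (intro isty_Sig BA isty_iso_laws isty_wk A B c tArr_wk f) simp
qed

lemma isty_exo_iso:
  assumes A: "isty \<Gamma> A" and B: "isty \<Gamma> B"
  shows "isty \<Gamma> (exo_iso A B)"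
proof -
  have AB: "isty \<Gamma> (Arr Exo A B)" using A B by (rule isty_Arr)
  then have c: "ctx (Arr Exo A B # \<Gamma>)" by (rule isty_ctx)
  show ?thesis
    unfolding exo_iso_alt
    using var_0[OF c] by (intro isty_Sig AB isty_iso_tail isty_wk A B c) simp
qed

lemma isty_is_fibrant:
  assumes "isty \<Gamma> A"
  shows "isty \<Gamma> (is_fibrant i A)"
proof -
  have U: "isty \<Gamma> (Univ Inner i)" using assms by (intro isty_Univ isty_ctx_tl)
  then have c: "ctx (Univ Inner i # \<Gamma>)" by (rule isty_ctx)
  have "isty (Univ Inner i # \<Gamma>) (Var 0)" using var_0[OF c] by (auto intro: isty_Inner)
  then show ?thesis
    unfolding is_fibrant_def by (intro isty_Sig U isty_exo_iso isty_wk assms c)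
qed

definition iso_to :: "tm \<Rightarrow> tm \<Rightarrow> tm \<Rightarrow> tm" where
  "iso_to A B w = pr1 (Arr Exo A B) w"

definition iso_from :: "tm \<Rightarrow> tm \<Rightarrow> tm \<Rightarrow> tm" where
  "iso_from A B w = pr1 (Arr Exo B A) (pr2 (Arr Exo A B) (iso_tail (wk A) (wk B) (Var 0)) w)"

lemma subst_iso_to [simp]: "subst \<sigma> (iso_to A B w) = iso_to (subst \<sigma> A) (subst \<sigma> B) (subst \<sigma> w)"
  by (simp add: iso_to_def)

lemma ren_iso_to [simp]: "ren r (iso_to A B w) = iso_to (ren r A) (ren r B) (ren r w)"
  by (simp add: iso_to_def)

lemma subst_iso_from [simp]:
  "subst \<sigma> (iso_from A B w) = iso_from (subst \<sigma> A) (subst \<sigma> B) (subst \<sigma> w)"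
  by (simp add: iso_from_def)

lemma ren_iso_from [simp]: "ren r (iso_from A B w) = iso_from (ren r A) (ren r B) (ren r w)"
  by (simp add: iso_from_def)

lemma tpr1': "\<Gamma> \<turnstile> p \<Ztypecolon> Sig Exo A B \<Longrightarrow> isty \<Gamma> (Sig Exo A B) \<Longrightarrow> \<Gamma> \<turnstile> pr1 A p \<Ztypecolon> A"
  by (simp add: tpr1 isty_Sig_iff)

lemma tpr2':
  "\<Gamma> \<turnstile> p \<Ztypecolon> Sig Exo A B \<Longrightarrow> isty \<Gamma> (Sig Exo A B) \<Longrightarrow> inst B (pr1 A p) = C \<Longrightarrow> \<Gamma> \<turnstile> pr2 A B p \<Ztypecolon> C"
  using tpr2 by (auto simp: isty_Sig_iff)

lemma exo_iso_elim:
  assumes w: "\<Gamma> \<turnstile> w \<Ztypecolon> exo_iso A B" and A: "isty \<Gamma> A" and B: "isty \<Gamma> B"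
  shows "\<Gamma> \<turnstile> iso_to A B w \<Ztypecolon> Arr Exo A B" (is "_ \<turnstile> ?f \<Ztypecolon> _")
    and "\<Gamma> \<turnstile> iso_from A B w \<Ztypecolon> Arr Exo B A" (is "_ \<turnstile> ?g \<Ztypecolon> _")
    and "\<Gamma> \<turnstile> b \<Ztypecolon> B \<Longrightarrow> exo_eq \<Gamma> B (App Exo (iso_to A B w) (App Exo (iso_from A B w) b)) b"
    and "\<Gamma> \<turnstile> a \<Ztypecolon> A \<Longrightarrow> exo_eq \<Gamma> A (App Exo (iso_from A B w) (App Exo (iso_to A B w) a)) a"
proof -
  note w' = w[unfolded exo_iso_alt] and ty = isty_exo_iso[OF A B, unfolded exo_iso_alt]
  show f: "\<Gamma> \<turnstile> ?f \<Ztypecolon> Arr Exo A B"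
    unfolding iso_to_def using w' ty by (rule tpr1')
  let ?q = "pr2 (Arr Exo A B) (iso_tail (wk A) (wk B) (Var 0)) w"
  have q: "\<Gamma> \<turnstile> ?q \<Ztypecolon> iso_tail A B ?f"
    by (rule tpr2'[OF w' ty]) (simp add: iso_to_def)
  note q' = q[unfolded iso_tail_def[of A B ?f]] and ty2 =
    isty_iso_tail[OF A B f, unfolded iso_tail_def[of A B ?f]]
  show g: "\<Gamma> \<turnstile> ?g \<Ztypecolon> Arr Exo B A"
    unfolding iso_from_def using q' ty2 by (rule tpr1')
  obtain l where l: "\<Gamma> \<turnstile> l \<Ztypecolon> iso_laws A B ?f ?g"
    using tpr2'[OF q' ty2 refl] by (auto simp: iso_from_def)
  note l' = l[unfolded iso_laws_def] and ty3 = isty_iso_laws[OF A B f g, unfolded iso_laws_def]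
  have "inhab \<Gamma> (Eq Exo (Arr Exo B B) (comp Exo ?f ?g) (idfun Exo))"
    using tpr1'[OF l' ty3] by (auto simp: inhab_def)
  then have 1: "exo_eq \<Gamma> (Arr Exo B B) (comp Exo ?f ?g) (idfun Exo)"
    unfolding exo_eq_def by (intro conjI isty_Arr A B tcomp[OF f g] tcomp[OF g f] tidfun)
  have "inhab \<Gamma> (Eq Exo (Arr Exo A A) (comp Exo ?g ?f) (idfun Exo))"
    using tpr2'[OF l' ty3 refl] by (auto simp: inhab_def)
  then have 2: "exo_eq \<Gamma> (Arr Exo A A) (comp Exo ?g ?f) (idfun Exo)"
    unfolding exo_eq_def by (intro conjI isty_Arr A B tcomp[OF f g] tcomp[OF g f] tidfun)
  show "exo_eq \<Gamma> B (App Exo ?f (App Exo ?g b)) b" if b: "\<Gamma> \<turnstile> b \<Ztypecolon> B"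
    by (rule exo_eq_comp_App[OF 1 b tArr_App[OF f tArr_App[OF g b]]])
  show "exo_eq \<Gamma> A (App Exo ?g (App Exo ?f a)) a" if a: "\<Gamma> \<turnstile> a \<Ztypecolon> A"
    by (rule exo_eq_comp_App[OF 2 a tArr_App[OF g tArr_App[OF f a]]])
qed

text \<open>The conclusion keeps the match \<open>R\<close> visible as the first component and hides
  the maps and laws in \<open>e\<close>: \<open>fibrant_match\<close> of such a pair reduces to
  \<open>R\<close>, which is what the contractibility clause will refer to.\<close>

lemma is_fibrantI:
  assumes X: "isty \<Gamma> X" and R: "\<Gamma> \<turnstile> R \<Ztypecolon> Univ Inner i"
    and f: "\<Gamma> \<turnstile> f \<Ztypecolon> Arr Exo X R" and g: "\<Gamma> \<turnstile> g \<Ztypecolon> Arr Exo R X"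
    and fg: "exo_eq (R # \<Gamma>) (wk R) (App Exo (wk f) (App Exo (wk g) (Var 0))) (Var 0)"
    and gf: "exo_eq (X # \<Gamma>) (wk X) (App Exo (wk g) (App Exo (wk f) (Var 0))) (Var 0)"
  shows "\<exists>e. \<Gamma> \<turnstile> Pair Exo R e \<Ztypecolon> is_fibrant i X"
proof -
  have R': "isty \<Gamma> R" using R by (rule isty_Inner)
  obtain e1 where e1: "\<Gamma> \<turnstile> e1 \<Ztypecolon> Eq Exo (Arr Exo R R) (comp Exo f g) (idfun Exo)"
    using exo_eq_comp[OF f g R' fg] unfolding exo_eq_def inhab_def by blast
  obtain e2 where e2: "\<Gamma> \<turnstile> e2 \<Ztypecolon> Eq Exo (Arr Exo X X) (comp Exo g f) (idfun Exo)"
    using exo_eq_comp[OF g f X gf] unfolding exo_eq_def inhab_def by blast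
  have "\<Gamma> \<turnstile> Pair Exo e1 e2 \<Ztypecolon> iso_laws X R f g"
    using isty_iso_laws[OF X R' f g] unfolding iso_laws_def
    by (intro tPair e1) (use e2 in \<open>simp_all add: isty_Sig_iff\<close>)
  then have "\<Gamma> \<turnstile> Pair Exo g (Pair Exo e1 e2) \<Ztypecolon> iso_tail X R f"
    using isty_iso_tail[OF X R' f] unfolding iso_tail_def
    by (intro tPair g) (simp_all add: isty_Sig_iff)
  then have "\<Gamma> \<turnstile> Pair Exo f (Pair Exo g (Pair Exo e1 e2)) \<Ztypecolon> exo_iso X R"
    using isty_exo_iso[OF X R'] unfolding exo_iso_alt
    by (intro tPair f) (simp_all add: isty_Sig_iff)
  then have "\<Gamma> \<turnstile> Pair Exo R (Pair Exo f (Pair Exo g (Pair Exo e1 e2))) \<Ztypecolon> is_fibrant i X"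
    using isty_is_fibrant[OF X] unfolding is_fibrant_def
    by (intro tPair R) (simp_all add: isty_Sig_iff)
  then show ?thesis by blast
qed

section \<open>Products of families, contractible families and the clauses of cofibrancy\<close>

definition sections :: "tm \<Rightarrow> tm \<Rightarrow> tm" where
  "sections A Y = Pi Exo A (App Exo (wk Y) (Var 0))"

lemma subst_sections [simp]: "subst \<sigma> (sections A Y) = sections (subst \<sigma> A) (subst \<sigma> Y)"
  by (simp add: sections_def)

lemma ren_sections [simp]: "ren r (sections A Y) = sections (ren r A) (ren r Y)"
  by (simp add: sections_def)

lemma tUniv_App: "\<Gamma> \<turnstile> Y \<Ztypecolon> Arr Exo A (Univ s i) \<Longrightarrow> \<Gamma> \<turnstile> a \<Ztypecolon> A \<Longrightarrow> \<Gamma> \<turnstile> App Exo Y a \<Ztypecolon> Univ s i"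
  by (rule tArr_App)

lemma isty_sections:
  assumes "isty \<Gamma> A" "\<Gamma> \<turnstile> Y \<Ztypecolon> Arr Exo A (Univ Inner i)"
  shows "isty \<Gamma> (sections A Y)"
proof -
  have c: "ctx (A # \<Gamma>)" using assms(1) by (rule isty_ctx)
  have "A # \<Gamma> \<turnstile> App Exo (wk Y) (Var 0) \<Ztypecolon> Univ Inner i"
    using tArr_wk[OF assms(2) c] var_0[OF c] by (intro tUniv_App) simp_all
  then show ?thesis unfolding sections_def by (intro isty_Pi assms(1) isty_Inner)
qed

lemma sections_App: "\<Gamma> \<turnstile> f \<Ztypecolon> sections A Y \<Longrightarrow> \<Gamma> \<turnstile> a \<Ztypecolon> A \<Longrightarrow> \<Gamma> \<turnstile> App Exo f a \<Ztypecolon> App Exo Y a"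
  unfolding sections_def by (erule tApp) simp_all

lemma exo_eq_sections_App:
  "exo_eq \<Gamma> (sections A Y) f g \<Longrightarrow> \<Gamma> \<turnstile> a \<Ztypecolon> A \<Longrightarrow> exo_eq \<Gamma> (App Exo Y a) (App Exo f a) (App Exo g a)"
  unfolding sections_def by (drule (1) exo_eq_happly) simp

lemma t_is_contr:
  assumes "\<Gamma> \<turnstile> A \<Ztypecolon> Univ Inner i"
  shows "\<Gamma> \<turnstile> is_contr A \<Ztypecolon> Univ Inner i"
proof -
  have c: "ctx (A # \<Gamma>)" using assms by (intro isty_ctx isty_Inner)
  have A1: "A # \<Gamma> \<turnstile> wk A \<Ztypecolon> Univ Inner i" using typing_wk[OF assms c] by simp
  have c2: "ctx (wk A # A # \<Gamma>)" using A1 by (intro isty_ctx isty_Inner)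
  have A2: "wk A # A # \<Gamma> \<turnstile> wk (wk A) \<Ztypecolon> Univ Inner i" using typing_wk[OF A1 c2] by simp
  show ?thesis
    unfolding is_contr_def using var_0[OF c2] var_Suc[OF var_0[OF c] c2]
    by (intro ty_Sig ty_Pi ty_Eq assms A1 A2) simp_all
qed

lemma conv_is_contr: "A \<cong> A' \<Longrightarrow> is_contr A \<cong> is_contr A'"
  unfolding is_contr_def by (intro conv_cong conv_refl conv_ren)

definition contr_family :: "tm \<Rightarrow> tm \<Rightarrow> tm" where
  "contr_family A Y = Pi Exo A (is_contr (App Exo (wk Y) (Var 0)))"

lemma subst_contr_family [simp]:
  "subst \<sigma> (contr_family A Y) = contr_family (subst \<sigma> A) (subst \<sigma> Y)"
  by (simp add: contr_family_def)

lemma ren_contr_family [simp]: "ren r (contr_family A Y) = contr_family (ren r A) (ren r Y)"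
  by (simp add: contr_family_def)

lemma isty_contr_family:
  assumes "isty \<Gamma> A" "\<Gamma> \<turnstile> Y \<Ztypecolon> Arr Exo A (Univ Inner i)"
  shows "isty \<Gamma> (contr_family A Y)"
proof -
  have c: "ctx (A # \<Gamma>)" using assms(1) by (rule isty_ctx)
  have "A # \<Gamma> \<turnstile> App Exo (wk Y) (Var 0) \<Ztypecolon> Univ Inner i"
    using tArr_wk[OF assms(2) c] var_0[OF c] by (intro tUniv_App) simp_all
  then show ?thesis unfolding contr_family_def by (intro isty_Pi assms(1) isty_Inner t_is_contr)
qed

definition cof_fibrant :: "nat \<Rightarrow> tm \<Rightarrow> tm" where
  "cof_fibrant i A = Pi Exo (Arr Exo A (Univ Inner i)) (is_fibrant i (sections (wk A) (Var 0)))"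

definition cof_contr :: "nat \<Rightarrow> tm \<Rightarrow> tm \<Rightarrow> tm" where
  "cof_contr i A F = Pi Exo (Arr Exo A (Univ Inner i))
     (Arr Exo (contr_family (wk A) (Var 0)) (is_contr (fibrant_match i (App Exo (wk F) (Var 0)))))"

lemma subst_cof [simp]:
  "subst \<sigma> (cof_fibrant i A) = cof_fibrant i (subst \<sigma> A)"
  "subst \<sigma> (cof_contr i A F) = cof_contr i (subst \<sigma> A) (subst \<sigma> F)"
  by (simp_all add: cof_fibrant_def cof_contr_def)

lemma ren_cof [simp]:
  "ren r (cof_fibrant i A) = cof_fibrant i (ren r A)"
  "ren r (cof_contr i A F) = cof_contr i (ren r A) (ren r F)"
  by (simp_all add: cof_fibrant_def cof_contr_def)

lemma is_cofibrant_alt: "is_cofibrant i A = Sig Exo (cof_fibrant i A) (cof_contr i (wk A) (Var 0))"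
  by (simp add: is_cofibrant_def cof_fibrant_def cof_contr_def sections_def contr_family_def)

lemma ren_is_cofibrant [simp]: "ren r (is_cofibrant i A) = is_cofibrant i (ren r A)"
  by (simp add: is_cofibrant_alt)

lemma t_fibrant_match:
  "\<Gamma> \<turnstile> p \<Ztypecolon> is_fibrant i X \<Longrightarrow> isty \<Gamma> X \<Longrightarrow> \<Gamma> \<turnstile> fibrant_match i p \<Ztypecolon> Univ Inner i"
  unfolding fibrant_match_alt using isty_is_fibrant[of \<Gamma> X i]
  by (intro tpr1') (simp_all add: is_fibrant_def)

lemma isty_Arr_Univ: "isty \<Gamma> A \<Longrightarrow> isty \<Gamma> (Arr Exo A (Univ s i))"
  by (intro isty_Arr isty_Univ isty_ctx_tl)

lemma isty_cof_fibrant: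
  assumes A: "isty \<Gamma> A"
  shows "isty \<Gamma> (cof_fibrant i A)"
proof -
  let ?F = "Arr Exo A (Univ Inner i)"
  have F: "isty \<Gamma> ?F" using A by (rule isty_Arr_Univ)
  have c: "ctx (?F # \<Gamma>)" using F by (rule isty_ctx)
  have Y: "?F # \<Gamma> \<turnstile> Var 0 \<Ztypecolon> Arr Exo (wk A) (Univ Inner i)" using var_0[OF c] by simp
  show ?thesis
    unfolding cof_fibrant_def by (intro isty_Pi F isty_is_fibrant isty_sections[OF _ Y] isty_wk A c)
qed

lemma t_cof_fibrant_App:
  "\<Gamma> \<turnstile> F \<Ztypecolon> cof_fibrant i A \<Longrightarrow> \<Gamma> \<turnstile> Y \<Ztypecolon> Arr Exo A (Univ Inner i) \<Longrightarrow>
    \<Gamma> \<turnstile> App Exo F Y \<Ztypecolon> is_fibrant i (sections A Y)"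
  unfolding cof_fibrant_def by (erule tApp) simp_all

lemma isty_cof_contr_body:
  assumes A: "isty \<Gamma> A" and F: "\<Gamma> \<turnstile> F \<Ztypecolon> cof_fibrant i A"
  shows "isty (Arr Exo A (Univ Inner i) # \<Gamma>)
    (Arr Exo (contr_family (wk A) (Var 0)) (is_contr (fibrant_match i (App Exo (wk F) (Var 0)))))"
proof -
  let ?F = "Arr Exo A (Univ Inner i)"
  have c: "ctx (?F # \<Gamma>)" using A by (intro isty_ctx isty_Arr_Univ)
  have A1: "isty (?F # \<Gamma>) (wk A)" using A c by (rule isty_wk)
  have Y: "?F # \<Gamma> \<turnstile> Var 0 \<Ztypecolon> Arr Exo (wk A) (Univ Inner i)" using var_0[OF c] by simp
  have F1: "?F # \<Gamma> \<turnstile> wk F \<Ztypecolon> cof_fibrant i (wk A)" using typing_wk[OF F c] by simp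
  have "?F # \<Gamma> \<turnstile> fibrant_match i (App Exo (wk F) (Var 0)) \<Ztypecolon> Univ Inner i"
    by (rule t_fibrant_match[OF t_cof_fibrant_App[OF F1 Y] isty_sections[OF A1 Y]])
  then show ?thesis
    by (intro isty_Arr isty_contr_family[OF A1 Y] isty_Inner t_is_contr)
qed

lemma isty_is_cofibrant:
  assumes A: "isty \<Gamma> A"
  shows "isty \<Gamma> (is_cofibrant i A)"
proof -
  have C: "isty \<Gamma> (cof_fibrant i A)" using A by (rule isty_cof_fibrant)
  then have c: "ctx (cof_fibrant i A # \<Gamma>)" by (rule isty_ctx)
  have A1: "isty (cof_fibrant i A # \<Gamma>) (wk A)" using A c by (rule isty_wk)
  show ?thesis
    unfolding is_cofibrant_alt cof_contr_def
    using isty_cof_contr_body[OF A1, of "Var 0" i] var_0[OF c]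
    by (intro isty_Sig[OF C] isty_Pi[OF isty_Arr_Univ[OF A1]]) (simp del: ren.simps add: ren_cof)
qed

section \<open>The data contained in a witness of cofibrancy\<close>

definition cof_witness :: "nat \<Rightarrow> tm \<Rightarrow> tm \<Rightarrow> tm \<Rightarrow> tm" where
  "cof_witness i A c Y = App Exo (pr1 (cof_fibrant i A) c) Y"

definition cof_match :: "nat \<Rightarrow> tm \<Rightarrow> tm \<Rightarrow> tm \<Rightarrow> tm" where
  "cof_match i A c Y = fibrant_match i (cof_witness i A c Y)"

definition cof_iso :: "nat \<Rightarrow> tm \<Rightarrow> tm \<Rightarrow> tm \<Rightarrow> tm" where
  "cof_iso i A c Y = pr2 (Univ Inner i) (exo_iso (wk (sections A Y)) (Var 0)) (cof_witness i A c Y)"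

definition cof_to :: "nat \<Rightarrow> tm \<Rightarrow> tm \<Rightarrow> tm \<Rightarrow> tm" where
  "cof_to i A c Y = iso_to (sections A Y) (cof_match i A c Y) (cof_iso i A c Y)"

definition cof_from :: "nat \<Rightarrow> tm \<Rightarrow> tm \<Rightarrow> tm \<Rightarrow> tm" where
  "cof_from i A c Y = iso_from (sections A Y) (cof_match i A c Y) (cof_iso i A c Y)"

lemma subst_cof_terms [simp]:
  "subst \<sigma> (cof_match i A c Y) = cof_match i (subst \<sigma> A) (subst \<sigma> c) (subst \<sigma> Y)"
  "subst \<sigma> (cof_to i A c Y) = cof_to i (subst \<sigma> A) (subst \<sigma> c) (subst \<sigma> Y)"
  "subst \<sigma> (cof_from i A c Y) = cof_from i (subst \<sigma> A) (subst \<sigma> c) (subst \<sigma> Y)"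
  by (simp_all add: cof_witness_def cof_match_def cof_iso_def cof_to_def cof_from_def)

lemma ren_cof_terms [simp]:
  "ren r (cof_match i A c Y) = cof_match i (ren r A) (ren r c) (ren r Y)"
  "ren r (cof_to i A c Y) = cof_to i (ren r A) (ren r c) (ren r Y)"
  "ren r (cof_from i A c Y) = cof_from i (ren r A) (ren r c) (ren r Y)"
  by (simp_all add: cof_witness_def cof_match_def cof_iso_def cof_to_def cof_from_def)

text \<open>Match and maps are extracted from one and the same witness. The second component of
  \<open>c\<close> is typed over its first projection, so its clause on contractibility speaks of
  \<open>cof_match\<close> itself and not of some other match.\<close>

lemma cof_elim:
  assumes A: "isty \<Gamma> A" and c: "\<Gamma> \<turnstile> c \<Ztypecolon> is_cofibrant i A"
    and Y: "\<Gamma> \<turnstile> Y \<Ztypecolon> Arr Exo A (Univ Inner i)"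
  shows t_cof_match: "\<Gamma> \<turnstile> cof_match i A c Y \<Ztypecolon> Univ Inner i"
    and t_cof_to: "\<Gamma> \<turnstile> cof_to i A c Y \<Ztypecolon> Arr Exo (sections A Y) (cof_match i A c Y)"
    and t_cof_from: "\<Gamma> \<turnstile> cof_from i A c Y \<Ztypecolon> Arr Exo (cof_match i A c Y) (sections A Y)"
    and cof_to_from: "\<Gamma> \<turnstile> b \<Ztypecolon> cof_match i A c Y \<Longrightarrow>
      exo_eq \<Gamma> (cof_match i A c Y) (App Exo (cof_to i A c Y) (App Exo (cof_from i A c Y) b)) b"
    and cof_from_to: "\<Gamma> \<turnstile> f \<Ztypecolon> sections A Y \<Longrightarrow>
      exo_eq \<Gamma> (sections A Y) (App Exo (cof_from i A c Y) (App Exo (cof_to i A c Y) f)) f"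
    and cof_match_contr: "inhab \<Gamma> (contr_family A Y) \<Longrightarrow> inhab \<Gamma> (is_contr (cof_match i A c Y))"
proof -
  note c' = c[unfolded is_cofibrant_alt] and ty = isty_is_cofibrant[OF A, of i, unfolded
    is_cofibrant_alt]
  have F: "\<Gamma> \<turnstile> pr1 (cof_fibrant i A) c \<Ztypecolon> cof_fibrant i A" using c' ty by (rule tpr1')
  have S: "isty \<Gamma> (sections A Y)" using A Y by (rule isty_sections)
  have w: "\<Gamma> \<turnstile> cof_witness i A c Y \<Ztypecolon> is_fibrant i (sections A Y)"
    unfolding cof_witness_def using F Y by (rule t_cof_fibrant_App)
  show M: "\<Gamma> \<turnstile> cof_match i A c Y \<Ztypecolon> Univ Inner i"
    unfolding cof_match_def using w S by (rule t_fibrant_match)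
  have iso: "\<Gamma> \<turnstile> cof_iso i A c Y \<Ztypecolon> exo_iso (sections A Y) (cof_match i A c Y)"
    unfolding cof_iso_def
    by (rule tpr2'[OF w[unfolded is_fibrant_def] isty_is_fibrant[OF S, unfolded is_fibrant_def]])
      (simp add: cof_match_def fibrant_match_alt)
  note el = exo_iso_elim[OF iso S isty_Inner[OF M], folded cof_to_def cof_from_def]
  show "\<Gamma> \<turnstile> cof_to i A c Y \<Ztypecolon> Arr Exo (sections A Y) (cof_match i A c Y)" by (rule el(1))
  show "\<Gamma> \<turnstile> cof_from i A c Y \<Ztypecolon> Arr Exo (cof_match i A c Y) (sections A Y)" by (rule el(2))
  show "\<Gamma> \<turnstile> b \<Ztypecolon> cof_match i A c Y \<Longrightarrow>
      exo_eq \<Gamma> (cof_match i A c Y) (App Exo (cof_to i A c Y) (App Exo (cof_from i A c Y) b)) b"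
    by (rule el(3))
  show "\<Gamma> \<turnstile> f \<Ztypecolon> sections A Y \<Longrightarrow>
      exo_eq \<Gamma> (sections A Y) (App Exo (cof_from i A c Y) (App Exo (cof_to i A c Y) f)) f"
    by (rule el(4))
  show "inhab \<Gamma> (is_contr (cof_match i A c Y))" if k: "inhab \<Gamma> (contr_family A Y)"
  proof -
    have "inhab \<Gamma> (cof_contr i A (pr1 (cof_fibrant i A) c))"
      using tpr2'[OF c' ty refl] unfolding inhab_def by auto
    from inhab_App[OF this[unfolded cof_contr_def] Y refl]
    have "inhab \<Gamma> (Arr Exo (contr_family A Y) (is_contr (cof_match i A c Y)))"
      by (simp add: cof_match_def cof_witness_def)
    then show ?thesis using k by (rule inhab_mp)
  qed
qed

subsection \<open>The types \<open>T n Y\<close> and restriction of sections\<close>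

declare conv_trans [trans]

lemma conv_App: "f \<cong> f' \<Longrightarrow> App s f a \<cong> App s f' a"
  by (intro cong_App conv_refl)

lemma conv_App2: "f \<cong> f' \<Longrightarrow> App s (App s f a) b \<cong> App s (App s f' a) b"
  by (intro conv_App)

text \<open>The reduct is a separate premise, so that the simplifier can evaluate the substitution
  before it is compared with the intended term.\<close>

lemma conv_beta: "inst b a = t \<Longrightarrow> App s (Lam s b) a \<cong> t"
  using beta_Pi by blast

lemma conv_beta2: "inst (subst (up (a \<cdot> Var)) b) a' = t \<Longrightarrow> App s (App s (Lam s (Lam s b)) a) a' \<cong> t"
  by (rule conv_trans[OF conv_App[OF beta_Pi]]) (auto intro: conv_beta)

lemma sections_conv: "sections A (Lam Exo B) \<cong> Pi Exo A B"
  unfolding sections_def by (intro cong_Pi conv_refl) (auto intro: conv_beta)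

lemma tLCons: "isty \<Gamma> A \<Longrightarrow> \<Gamma> \<turnstile> a \<Ztypecolon> A \<Longrightarrow> \<Gamma> \<turnstile> l \<Ztypecolon> List A \<Longrightarrow> \<Gamma> \<turnstile> LCons a l \<Ztypecolon> List A"
  unfolding isty_def by (blast intro: ty_LCons)

lemma tLNil: "isty \<Gamma> A \<Longrightarrow> \<Gamma> \<turnstile> LNil \<Ztypecolon> List A"
  unfolding isty_def by (blast intro: ty_LNil)

lemma tNatInd: "isty (Nat Exo # \<Gamma>) C \<Longrightarrow> \<Gamma> \<turnstile> c \<Ztypecolon> inst C (NZero Exo) \<Longrightarrow>
    C # Nat Exo # \<Gamma> \<turnstile> d \<Ztypecolon> subst (NSuc Exo (Var 1) \<cdot> shifted 2) C \<Longrightarrow>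
    \<Gamma> \<turnstile> n \<Ztypecolon> Nat Exo \<Longrightarrow> inst C n = T \<Longrightarrow> \<Gamma> \<turnstile> NatInd Exo C c d n \<Ztypecolon> T"
  unfolding isty_def by (blast intro: ty_NatInd)

lemma tListInd: "isty (List A # \<Gamma>) C \<Longrightarrow> \<Gamma> \<turnstile> c \<Ztypecolon> inst C LNil \<Longrightarrow>
    subst (Var 0 \<cdot> shifted 2) C # wk (List A) # A # \<Gamma>
      \<turnstile> d \<Ztypecolon> subst (LCons (Var 2) (Var 1) \<cdot> shifted 3) C \<Longrightarrow>
    \<Gamma> \<turnstile> l \<Ztypecolon> List A \<Longrightarrow> inst C l = T \<Longrightarrow> \<Gamma> \<turnstile> ListInd C c d l \<Ztypecolon> T"
  unfolding isty_def by (blast intro: ty_ListInd)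

abbreviation fams :: "nat \<Rightarrow> tm \<Rightarrow> tm" where
  "fams i A \<equiv> Arr Exo (List A) (Univ Inner i)"

text \<open>One operation for families on lists and for their sections, since both are functions of
  a list. A section of \<open>Y\<close> then becomes a section of \<open>tail Y a\<close>, up to
  beta in the type.\<close>

definition tail :: "tm \<Rightarrow> tm \<Rightarrow> tm" where
  "tail f a = Lam Exo (App Exo (wk f) (LCons (wk a) (Var 0)))"

lemma subst_tail [simp]: "subst \<sigma> (tail f a) = tail (subst \<sigma> f) (subst \<sigma> a)"
  by (simp add: tail_def)

lemma ren_tail [simp]: "ren r (tail f a) = tail (ren r f) (ren r a)"
  by (simp add: tail_def)

lemma conv_tail_App: "App Exo (tail f a) l \<cong> App Exo f (LCons a l)"
  unfolding tail_def by (rule conv_beta) simp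

lemma t_tail_fam:
  assumes A: "isty \<Gamma> A" and Y: "\<Gamma> \<turnstile> Y \<Ztypecolon> fams i A" and a: "\<Gamma> \<turnstile> a \<Ztypecolon> A"
  shows "\<Gamma> \<turnstile> tail Y a \<Ztypecolon> fams i A"
proof -
  have c: "ctx (List A # \<Gamma>)" using A by (intro isty_ctx isty_List)
  have "List A # \<Gamma> \<turnstile> LCons (wk a) (Var 0) \<Ztypecolon> wk (List A)"
    using isty_wk[OF A c] typing_wk[OF a c] var_0[OF c] by (simp add: tLCons)
  then have "List A # \<Gamma> \<turnstile> App Exo (wk Y) (LCons (wk a) (Var 0)) \<Ztypecolon> wk (Univ Inner i)"
    by (rule tArr_App[OF tArr_wk[OF Y c]])
  then show ?thesis
    unfolding tail_def by (rule tLam) (simp add: isty_Univ c)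
qed

lemma t_tail:
  assumes A: "isty \<Gamma> A" and Y: "\<Gamma> \<turnstile> Y \<Ztypecolon> fams i A" and a: "\<Gamma> \<turnstile> a \<Ztypecolon> A"
    and f: "\<Gamma> \<turnstile> f \<Ztypecolon> sections (List A) Y"
  shows "\<Gamma> \<turnstile> tail f a \<Ztypecolon> sections (List A) (tail Y a)"
proof -
  have c: "ctx (List A # \<Gamma>)" using A by (intro isty_ctx isty_List)
  have l: "List A # \<Gamma> \<turnstile> LCons (wk a) (Var 0) \<Ztypecolon> wk (List A)"
    using isty_wk[OF A c] typing_wk[OF a c] var_0[OF c] by (simp add: tLCons)
  have "List A # \<Gamma> \<turnstile> App Exo (wk f) (LCons (wk a) (Var 0)) \<Ztypecolon> App Exo (wk Y) (LCons (wk a) (Var 0))"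
    using typing_wk[OF f c] l by (simp add: sections_App)
  moreover have "isty (List A # \<Gamma>) (App Exo (wk Y) (LCons (wk a) (Var 0)))"
    using tArr_App[OF tArr_wk[OF Y c] l] by (auto intro: isty_Inner)
  ultimately have "\<Gamma> \<turnstile> tail f a \<Ztypecolon> Pi Exo (List A) (App Exo (wk Y) (LCons (wk a) (Var 0)))"
    unfolding tail_def by (rule tLam)
  then show ?thesis
    by (rule tconv) (auto simp: tail_def intro: conv_sym[OF sections_conv]
        isty_sections[OF isty_List[OF A] t_tail_fam[OF A Y a], unfolded tail_def])
qed

text \<open>\<open>step_fam (T n) Y\<close> is \<open>\<lambda>a. T n (\<lambda>l. Y (a :: l))\<close>.\<close>

definition step_fam :: "tm \<Rightarrow> tm \<Rightarrow> tm" where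
  "step_fam t Y = Lam Exo (App Exo (wk t) (tail (wk Y) (Var 0)))"

lemma subst_step_fam [simp]: "subst \<sigma> (step_fam t Y) = step_fam (subst \<sigma> t) (subst \<sigma> Y)"
  by (simp add: step_fam_def)

lemma ren_step_fam [simp]: "ren r (step_fam t Y) = step_fam (ren r t) (ren r Y)"
  by (simp add: step_fam_def)

lemma conv_step_fam_App: "App Exo (step_fam t Y) a \<cong> App Exo t (tail Y a)"
  unfolding step_fam_def by (rule conv_beta) simp

lemma t_step_fam:
  assumes A: "isty \<Gamma> A" and t: "\<Gamma> \<turnstile> t \<Ztypecolon> Arr Exo (fams i A) (Univ Inner i)" and Y: "\<Gamma> \<turnstile> Y \<Ztypecolon> fams i A"
  shows "\<Gamma> \<turnstile> step_fam t Y \<Ztypecolon> Arr Exo A (Univ Inner i)"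
proof -
  have c: "ctx (A # \<Gamma>)" using A by (rule isty_ctx)
  have "A # \<Gamma> \<turnstile> wk Y \<Ztypecolon> fams i (wk A)" using typing_wk[OF Y c] by simp
  then have "A # \<Gamma> \<turnstile> tail (wk Y) (Var 0) \<Ztypecolon> wk (fams i A)"
    using t_tail_fam[OF isty_wk[OF A c] _ var_0[OF c]] by simp
  then have "A # \<Gamma> \<turnstile> App Exo (wk t) (tail (wk Y) (Var 0)) \<Ztypecolon> wk (Univ Inner i)"
    by (rule tArr_App[OF tArr_wk[OF t c]])
  then show ?thesis
    unfolding step_fam_def by (rule tLam) (simp add: isty_Univ c)
qed

definition cofib :: "nat \<Rightarrow> tm list \<Rightarrow> tm \<Rightarrow> tm \<Rightarrow> bool" where
  "cofib i \<Gamma> A c \<longleftrightarrow> isty \<Gamma> A \<and> \<Gamma> \<turnstile> c \<Ztypecolon> is_cofibrant i A"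

lemma cofib_isty: "cofib i \<Gamma> A c \<Longrightarrow> isty \<Gamma> A"
  by (simp add: cofib_def)

lemma cofib_ctx: "cofib i \<Gamma> A c \<Longrightarrow> ctx \<Gamma>"
  using cofib_isty isty_ctx_tl by blast

lemma cofib_wk: "cofib i \<Gamma> A c \<Longrightarrow> ctx (B # \<Gamma>) \<Longrightarrow> cofib i (B # \<Gamma>) (wk A) (wk c)"
  unfolding cofib_def using typing_wk[of \<Gamma> c "is_cofibrant i A" B] by (auto intro: isty_wk)

lemma isty_fams: "cofib i \<Gamma> A c \<Longrightarrow> isty \<Gamma> (fams i A)"
  by (intro isty_Arr_Univ isty_List cofib_isty)

lemma cofib_typing: "cofib i \<Gamma> A c \<Longrightarrow> \<Gamma> \<turnstile> c \<Ztypecolon> is_cofibrant i A"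
  by (simp add: cofib_def)

text \<open>The premise \<open>cofib\<close> occurs twice, once for the type and once for its
  witness; hence the repeated argument in later instantiations.\<close>

lemmas cofib_elim = cof_elim[OF cofib_isty cofib_typing]

text \<open>
  \<open>App Exo (lev i A c n) Y\<close> is the type \<open>T n Y\<close>. In it and in the definitions that follow, \<open>c\<close> is a
  witness of the cofibrancy of \<open>A\<close>.
\<close>

definition lev :: "nat \<Rightarrow> tm \<Rightarrow> tm \<Rightarrow> tm \<Rightarrow> tm" where
  "lev i A c n = NatInd Exo (Arr Exo (fams i (wk A)) (Univ Inner i))
     (Lam Exo (App Exo (Var 0) LNil))
     (Lam Exo (cof_match i (wk (wk (wk A))) (wk (wk (wk c))) (step_fam (Var 1) (Var 0)))) n"

lemma subst_lev [simp]: "subst \<sigma> (lev i A c n) = lev i (subst \<sigma> A) (subst \<sigma> c) (subst \<sigma> n)"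
  by (simp add: lev_def)

lemma ren_lev [simp]: "ren r (lev i A c n) = lev i (ren r A) (ren r c) (ren r n)"
  by (simp add: lev_def)

lemma conv_lev_NZero: "App Exo (lev i A c (NZero Exo)) Y \<cong> App Exo Y LNil"
  unfolding lev_def by (rule conv_trans[OF conv_App[OF beta_NZero]]) (simp add: conv_beta)

text \<open>Only the outer recursion is unfolded; the recursive value that the computation rule
  produces is then folded back into \<open>lev\<close>.\<close>

lemma conv_lev_NSuc:
  "App Exo (lev i A c (NSuc Exo n)) Y \<cong> cof_match i A c (step_fam (lev i A c n) Y)"
  by (subst lev_def, rule conv_trans[OF conv_App[OF beta_NSuc]], fold lev_def) (simp add: conv_beta)

lemma t_lev:
  assumes A: "cofib i \<Gamma> A c" and n: "\<Gamma> \<turnstile> n \<Ztypecolon> Nat Exo"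
  shows "\<Gamma> \<turnstile> lev i A c n \<Ztypecolon> Arr Exo (fams i A) (Univ Inner i)"
  unfolding lev_def
proof (rule tNatInd[OF _ _ _ n])
  let ?C = "Arr Exo (fams i (wk A)) (Univ Inner i)"
  have c0: "ctx \<Gamma>" using A by (rule cofib_ctx)
  have c1: "ctx (Nat Exo # \<Gamma>)" using c0 by (intro isty_ctx isty_Nat)
  note A1 = cofib_wk[OF A c1]
  show C: "isty (Nat Exo # \<Gamma>) ?C" by (intro isty_Arr isty_fams[OF A1] isty_Univ c1)
  show "inst ?C n = Arr Exo (fams i A) (Univ Inner i)" by simp
  have cF: "ctx (fams i A # \<Gamma>)" by (intro isty_ctx isty_fams[OF A])
  have "fams i A # \<Gamma> \<turnstile> App Exo (Var 0) LNil \<Ztypecolon> Univ Inner i"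
    using var_0[OF cF] tLNil[OF isty_wk[OF cofib_isty[OF A] cF]]
    by (intro tUniv_App) simp_all
  then show "\<Gamma> \<turnstile> Lam Exo (App Exo (Var 0) LNil) \<Ztypecolon> inst ?C (NZero Exo)"
    using cF by (auto intro!: tLam isty_Univ)
  have c2: "ctx (?C # Nat Exo # \<Gamma>)" using C by (rule isty_ctx)
  note A2 = cofib_wk[OF A1 c2]
  let ?F = "fams i (wk (wk A))"
  have c3: "ctx (?F # ?C # Nat Exo # \<Gamma>)" by (intro isty_ctx isty_fams[OF A2])
  note A3 = cofib_wk[OF A2 c3]
  have Y: "?F # ?C # Nat Exo # \<Gamma> \<turnstile> Var 0 \<Ztypecolon> fams i (wk (wk (wk A)))" using var_0[OF c3] by simp
  \<comment> \<open>Below the abstraction over the family, \<open>Var 0\<close> is that family and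
    \<open>Var 1\<close> is the recursive value, itself a function of the family; it can thus be
    applied to the tail families.\<close>
  have IH: "?F # ?C # Nat Exo # \<Gamma> \<turnstile> Var 1 \<Ztypecolon> Arr Exo (fams i (wk (wk (wk A)))) (Univ Inner i)"
    using var_Suc[OF var_0[OF c2] c3] by simp
  have "?F # ?C # Nat Exo # \<Gamma> \<turnstile> cof_match i (wk (wk (wk A))) (wk (wk (wk c)))
    (step_fam (Var 1) (Var 0))
      \<Ztypecolon> Univ Inner i"
    using A3 t_step_fam[OF cofib_isty[OF A3] IH Y] unfolding cofib_def by (blast intro: t_cof_match)
  then show "?C # Nat Exo # \<Gamma> \<turnstile> Lam Exo (cof_match i (wk (wk (wk A))) (wk (wk (wk c)))
    (step_fam (Var 1) (Var 0)))
      \<Ztypecolon> subst (NSuc Exo (Var 1) \<cdot> shifted 2) ?C"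
    using c3 by (auto intro!: tLam isty_Univ)
qed

lemma tLam2:
  "B # A # \<Gamma> \<turnstile> b \<Ztypecolon> C \<Longrightarrow> isty (B # A # \<Gamma>) C \<Longrightarrow> \<Gamma> \<turnstile> Lam Exo (Lam Exo b) \<Ztypecolon> Pi Exo A (Pi Exo B C)"
  using typing_Lam_ctx by (intro tLam isty_Pi)

lemma t_lev_App:
  "cofib i \<Gamma> A c \<Longrightarrow> \<Gamma> \<turnstile> n \<Ztypecolon> Nat Exo \<Longrightarrow> \<Gamma> \<turnstile> Y \<Ztypecolon> fams i A \<Longrightarrow>
    \<Gamma> \<turnstile> App Exo (lev i A c n) Y \<Ztypecolon> Univ Inner i"
  by (rule tUniv_App[OF t_lev])

text \<open>The family and the section are quantified inside the motive because the recursive value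
  is applied to \<open>tail Y a\<close> and \<open>tail f a\<close>.\<close>

definition read_ty :: "nat \<Rightarrow> tm \<Rightarrow> tm \<Rightarrow> tm \<Rightarrow> tm" where
  "read_ty i A c n = Pi Exo (fams i A) (Pi Exo (sections (List (wk A)) (Var 0))
     (App Exo (lev i (wk (wk A)) (wk (wk c)) (wk (wk n))) (Var 1)))"

definition read_step :: "nat \<Rightarrow> tm \<Rightarrow> tm \<Rightarrow> tm \<Rightarrow> tm \<Rightarrow> tm \<Rightarrow> tm \<Rightarrow> tm" where
  "read_step i A c n r Y f = App Exo (cof_to i A c (step_fam (lev i A c n) Y))
     (Lam Exo (App Exo (App Exo (wk r) (tail (wk Y) (Var 0))) (tail (wk f) (Var 0))))"

text \<open>In the successor branch \<open>Var 3\<close> is the predecessor, \<open>Var 2\<close>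
  the recursive value, and \<open>Var 1\<close> and \<open>Var 0\<close> are the family and the
  section bound by the two abstractions.\<close>

definition read :: "nat \<Rightarrow> tm \<Rightarrow> tm \<Rightarrow> tm \<Rightarrow> tm" where
  "read i A c n = NatInd Exo (read_ty i (wk A) (wk c) (Var 0))
     (Lam Exo (Lam Exo (App Exo (Var 0) LNil)))
     (Lam Exo (Lam Exo (read_step i (wk (wk (wk (wk A)))) (wk (wk (wk (wk c)))) (Var 3) (Var 2)
       (Var 1) (Var 0)))) n"

lemma subst_read_ty [simp]: "subst \<sigma> (read_ty i A c n) = read_ty i (subst \<sigma> A) (subst \<sigma> c)
  (subst \<sigma> n)"
  by (simp add: read_ty_def)

lemma ren_read_ty [simp]: "ren r (read_ty i A c n) = read_ty i (ren r A) (ren r c) (ren r n)"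
  by (simp add: read_ty_def)

lemma subst_read_step [simp]: "subst \<sigma> (read_step i A c n r Y f) =
    read_step i (subst \<sigma> A) (subst \<sigma> c) (subst \<sigma> n) (subst \<sigma> r) (subst \<sigma> Y) (subst \<sigma> f)"
  by (simp add: read_step_def)

lemma ren_read_step [simp]: "ren \<rho> (read_step i A c n r Y f) =
    read_step i (ren \<rho> A) (ren \<rho> c) (ren \<rho> n) (ren \<rho> r) (ren \<rho> Y) (ren \<rho> f)"
  by (simp add: read_step_def)

lemma subst_read [simp]: "subst \<sigma> (read i A c n) = read i (subst \<sigma> A) (subst \<sigma> c) (subst \<sigma> n)"
  by (simp add: read_def eval_nat_numeral)

lemma ren_read [simp]: "ren r (read i A c n) = read i (ren r A) (ren r c) (ren r n)"
  by (simp add: read_def eval_nat_numeral)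

lemma conv_read_NZero: "App Exo (App Exo (read i A c (NZero Exo)) Y) f \<cong> App Exo f LNil"
  unfolding read_def by (rule conv_trans[OF conv_App2[OF beta_NZero]]) (simp add: conv_beta2)

lemma conv_read_NSuc: "App Exo (App Exo (read i A c (NSuc Exo n)) Y) f
    \<cong> read_step i A c n (read i A c n) Y f"
  by (subst read_def, rule conv_trans[OF conv_App2[OF beta_NSuc]], fold read_def)
    (simp add: conv_beta2 eval_nat_numeral)

lemma isty_read_ty:
  assumes A: "cofib i \<Gamma> A c" and n: "\<Gamma> \<turnstile> n \<Ztypecolon> Nat Exo"
  shows "isty \<Gamma> (read_ty i A c n)"
proof -
  let ?S = "sections (List (wk A)) (Var 0)"
  have F: "isty \<Gamma> (fams i A)" using A by (rule isty_fams)
  have c1: "ctx (fams i A # \<Gamma>)" using F by (rule isty_ctx)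
  note A1 = cofib_wk[OF A c1]
  have Y: "fams i A # \<Gamma> \<turnstile> Var 0 \<Ztypecolon> fams i (wk A)" using var_0[OF c1] by simp
  have S: "isty (fams i A # \<Gamma>) ?S" by (rule isty_sections[OF isty_List[OF cofib_isty[OF A1]] Y])
  have c2: "ctx (?S # fams i A # \<Gamma>)" using S by (rule isty_ctx)
  have "?S # fams i A # \<Gamma> \<turnstile> App Exo (lev i (wk (wk A)) (wk (wk c)) (wk (wk n))) (Var 1) \<Ztypecolon> Univ
    Inner i"
    using typing_wk[OF typing_wk[OF n c1] c2] var_Suc[OF Y c2]
    by (intro t_lev_App cofib_wk[OF A1 c2]) simp_all
  then show ?thesis
    unfolding read_ty_def by (intro isty_Pi[OF F] isty_Pi[OF S] isty_Inner)
qed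

lemma t_read_App:
  assumes r: "\<Gamma> \<turnstile> r \<Ztypecolon> read_ty i A c n" and Y: "\<Gamma> \<turnstile> Y \<Ztypecolon> fams i A"
    and f: "\<Gamma> \<turnstile> f \<Ztypecolon> sections (List A) Y"
  shows "\<Gamma> \<turnstile> App Exo (App Exo r Y) f \<Ztypecolon> App Exo (lev i A c n) Y"
  by (rule tApp[OF tApp[OF r[unfolded read_ty_def] Y refl, simplified] f]) simp

text \<open>A body is naturally typed by the reduct of \<open>step_fam\<close> at its argument; the
  conversion to the unreduced family, which the match is formed from, is done once here.\<close>

lemma t_step_sections:
  assumes A: "cofib i \<Gamma> A c" and n: "\<Gamma> \<turnstile> n \<Ztypecolon> Nat Exo" and Y: "\<Gamma> \<turnstile> Y \<Ztypecolon> fams i A"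
    and t: "A # \<Gamma> \<turnstile> t \<Ztypecolon> App Exo (wk (lev i A c n)) (tail (wk Y) (Var 0))"
  shows "\<Gamma> \<turnstile> Lam Exo t \<Ztypecolon> sections A (step_fam (lev i A c n) Y)"
proof -
  have c: "ctx (A # \<Gamma>)" using t by (rule typing_ctx)
  note A1 = cofib_wk[OF A c]
  have Y1: "A # \<Gamma> \<turnstile> wk Y \<Ztypecolon> fams i (wk A)" using typing_wk[OF Y c] by simp
  have "\<Gamma> \<turnstile> Lam Exo t \<Ztypecolon> Pi Exo A (App Exo (wk (lev i A c n)) (tail (wk Y) (Var 0)))"
    using t_lev_App[OF A1 typing_wk[OF n c, simplified]
      t_tail_fam[OF cofib_isty[OF A1] Y1 var_0[OF c]]]
    by (intro tLam[OF t] isty_Inner[of _ _ i]) simp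
  then show ?thesis
    unfolding step_fam_def
    by (rule tconv[OF _ conv_sym[OF sections_conv] isty_sections[OF cofib_isty[OF A]
          t_step_fam[OF cofib_isty[OF A] t_lev[OF A n] Y], unfolded step_fam_def]])
qed

lemma t_read_step_arg:
  assumes A: "cofib i \<Gamma> A c" and n: "\<Gamma> \<turnstile> n \<Ztypecolon> Nat Exo" and r: "\<Gamma> \<turnstile> r \<Ztypecolon> read_ty i A c n"
    and Y: "\<Gamma> \<turnstile> Y \<Ztypecolon> fams i A" and f: "\<Gamma> \<turnstile> f \<Ztypecolon> sections (List A) Y"
  shows "\<Gamma> \<turnstile> Lam Exo (App Exo (App Exo (wk r) (tail (wk Y) (Var 0))) (tail (wk f) (Var 0)))
    \<Ztypecolon> sections A (step_fam (lev i A c n) Y)"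
proof (rule t_step_sections[OF A n Y])
  have c: "ctx (A # \<Gamma>)" using A by (intro isty_ctx cofib_isty)
  have A1: "isty (A # \<Gamma>) (wk A)" using cofib_isty[OF A] c by (rule isty_wk)
  have Y1: "A # \<Gamma> \<turnstile> wk Y \<Ztypecolon> fams i (wk A)" using typing_wk[OF Y c] by simp
  have f1: "A # \<Gamma> \<turnstile> wk f \<Ztypecolon> sections (List (wk A)) (wk Y)" using typing_wk[OF f c] by simp
  have r1: "A # \<Gamma> \<turnstile> wk r \<Ztypecolon> read_ty i (wk A) (wk c) (wk n)" using typing_wk[OF r c] by simp
  show "A # \<Gamma> \<turnstile> App Exo (App Exo (wk r) (tail (wk Y) (Var 0))) (tail (wk f) (Var 0))
      \<Ztypecolon> App Exo (wk (lev i A c n)) (tail (wk Y) (Var 0))"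
    using t_read_App[OF r1 t_tail_fam[OF A1 Y1 var_0[OF c]] t_tail[OF A1 Y1 var_0[OF c] f1]] by simp
qed

lemma t_read_step:
  assumes A: "cofib i \<Gamma> A c" and n: "\<Gamma> \<turnstile> n \<Ztypecolon> Nat Exo" and r: "\<Gamma> \<turnstile> r \<Ztypecolon> read_ty i A c n"
    and Y: "\<Gamma> \<turnstile> Y \<Ztypecolon> fams i A" and f: "\<Gamma> \<turnstile> f \<Ztypecolon> sections (List A) Y"
  shows "\<Gamma> \<turnstile> read_step i A c n r Y f \<Ztypecolon> App Exo (lev i A c (NSuc Exo n)) Y"
proof (rule tconv)
  show "\<Gamma> \<turnstile> read_step i A c n r Y f \<Ztypecolon> cof_match i A c (step_fam (lev i A c n) Y)"
    unfolding read_step_def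
    by (rule tArr_App[OF cofib_elim(2)[OF A A t_step_fam[OF cofib_isty[OF A] t_lev[OF A n] Y]]
          t_read_step_arg[OF assms]])
  show "cof_match i A c (step_fam (lev i A c n) Y) \<cong> App Exo (lev i A c (NSuc Exo n)) Y"
    by (rule conv_sym[OF conv_lev_NSuc])
  show "isty \<Gamma> (App Exo (lev i A c (NSuc Exo n)) Y)"
    by (rule isty_Inner[OF t_lev_App[OF A ty_NSuc[OF n] Y]])
qed

lemma t_read:
  assumes A: "cofib i \<Gamma> A c" and n: "\<Gamma> \<turnstile> n \<Ztypecolon> Nat Exo"
  shows "\<Gamma> \<turnstile> read i A c n \<Ztypecolon> read_ty i A c n"
  unfolding read_def
proof (rule tNatInd[OF _ _ _ n])
  let ?C = "read_ty i (wk A) (wk c) (Var 0)"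
  have c0: "ctx \<Gamma>" using A by (rule cofib_ctx)
  have c1: "ctx (Nat Exo # \<Gamma>)" using c0 by (intro isty_ctx isty_Nat)
  note A1 = cofib_wk[OF A c1]
  show C: "isty (Nat Exo # \<Gamma>) ?C" using var_0[OF c1] by (intro isty_read_ty[OF A1]) simp
  show "inst ?C n = read_ty i A c n" by simp
  {
    let ?S = "sections (List (wk A)) (Var 0)"
    have cF: "ctx (fams i A # \<Gamma>)" by (intro isty_ctx isty_fams[OF A])
    note AF = cofib_wk[OF A cF]
    have Y: "fams i A # \<Gamma> \<turnstile> Var 0 \<Ztypecolon> fams i (wk A)" using var_0[OF cF] by simp
    have cS: "ctx (?S # fams i A # \<Gamma>)"
      by (rule isty_ctx[OF isty_sections[OF isty_List[OF cofib_isty[OF AF]] Y]])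
    note AS = cofib_wk[OF AF cS]
    have Y': "?S # fams i A # \<Gamma> \<turnstile> Var 1 \<Ztypecolon> fams i (wk (wk A))" using var_Suc[OF Y cS] by simp
    have f: "?S # fams i A # \<Gamma> \<turnstile> Var 0 \<Ztypecolon> sections (List (wk (wk A))) (Var 1)"
      using var_0[OF cS] by simp
    have T: "isty (?S # fams i A # \<Gamma>) (App Exo (lev i (wk (wk A)) (wk (wk c)) (NZero Exo)) (Var 1))"
      by (rule isty_Inner[OF t_lev_App[OF AS ty_NZero[OF cS] Y']])
    have "?S # fams i A # \<Gamma> \<turnstile> App Exo (Var 0) LNil
        \<Ztypecolon> App Exo (lev i (wk (wk A)) (wk (wk c)) (NZero Exo)) (Var 1)"
      by (rule tconv[OF sections_App[OF f tLNil[OF cofib_isty[OF AS]]] conv_sym[OF conv_lev_NZero]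
        T])
    from tLam2[OF this T]
    show "\<Gamma> \<turnstile> Lam Exo (Lam Exo (App Exo (Var 0) LNil)) \<Ztypecolon> inst ?C (NZero Exo)"
      by (simp add: read_ty_def)
  }
  have c2: "ctx (?C # Nat Exo # \<Gamma>)" using C by (rule isty_ctx)
  note A2 = cofib_wk[OF A1 c2]
  let ?F = "fams i (wk (wk A))"
  have c3: "ctx (?F # ?C # Nat Exo # \<Gamma>)" by (intro isty_ctx isty_fams[OF A2])
  note A3 = cofib_wk[OF A2 c3]
  let ?S = "sections (List (wk (wk (wk A)))) (Var 0)"
  have Y3: "?F # ?C # Nat Exo # \<Gamma> \<turnstile> Var 0 \<Ztypecolon> fams i (wk (wk (wk A)))" using var_0[OF c3] by simp
  have c4: "ctx (?S # ?F # ?C # Nat Exo # \<Gamma>)"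
    by (rule isty_ctx[OF isty_sections[OF isty_List[OF cofib_isty[OF A3]] Y3]])
  note A4 = cofib_wk[OF A3 c4]
  let ?\<Delta> = "?S # ?F # ?C # Nat Exo # \<Gamma>"
  let ?A = "wk (wk (wk (wk A)))" and ?c = "wk (wk (wk (wk c)))"
  have f: "?\<Delta> \<turnstile> Var 0 \<Ztypecolon> sections (List ?A) (Var 1)" using var_0[OF c4] by simp
  have Y: "?\<Delta> \<turnstile> Var 1 \<Ztypecolon> fams i ?A" using var_Suc[OF Y3 c4] by simp
  have r: "?\<Delta> \<turnstile> Var 2 \<Ztypecolon> read_ty i ?A ?c (Var 3)"
    using var_Suc[OF var_Suc[OF var_0[OF c2] c3] c4] by (simp add: eval_nat_numeral)
  have m: "?\<Delta> \<turnstile> Var 3 \<Ztypecolon> Nat Exo"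
    using var_Suc[OF var_Suc[OF var_Suc[OF var_0[OF c1] c2] c3] c4] by (simp add: eval_nat_numeral)
  from tLam2[OF t_read_step[OF A4 m r Y f] isty_Inner[OF t_lev_App[OF A4 ty_NSuc[OF m] Y]]]
  show "?C # Nat Exo # \<Gamma> \<turnstile> Lam Exo (Lam Exo (read_step i ?A ?c (Var 3) (Var 2) (Var 1) (Var 0)))
      \<Ztypecolon> subst (NSuc Exo (Var 1) \<cdot> shifted 2) ?C"
    by (simp add: read_ty_def eval_nat_numeral)
qed

subsection \<open>Evaluation at a list\<close>

definition tower_fam :: "nat \<Rightarrow> tm \<Rightarrow> tm \<Rightarrow> tm \<Rightarrow> tm" where
  "tower_fam i A c Y = Lam Exo (App Exo (lev i (wk A) (wk c) (Var 0)) (wk Y))"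

abbreviation tower :: "nat \<Rightarrow> tm \<Rightarrow> tm \<Rightarrow> tm \<Rightarrow> tm" where
  "tower i A c Y \<equiv> sections (Nat Exo) (tower_fam i A c Y)"

text \<open>
  The step of the recursion on lists replaces a point \<open>h\<close> of \<open>\<Prod>n. T n Y\<close> by the point of
  \<open>\<Prod>n. T n (\<lambda>l. Y (a :: l))\<close> that is obtained from the components \<open>h (n + 1)\<close>.
\<close>

definition peel :: "nat \<Rightarrow> tm \<Rightarrow> tm \<Rightarrow> tm \<Rightarrow> tm \<Rightarrow> tm \<Rightarrow> tm" where
  "peel i A c a Y h = Lam Exo (App Exo
     (App Exo (cof_from i (wk A) (wk c) (step_fam (lev i (wk A) (wk c) (Var 0)) (wk Y)))
       (App Exo (wk h) (NSuc Exo (Var 0))))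
     (wk a))"

definition look_ty :: "nat \<Rightarrow> tm \<Rightarrow> tm \<Rightarrow> tm \<Rightarrow> tm" where
  "look_ty i A c l = Pi Exo (fams i A) (Pi Exo (tower i (wk A) (wk c) (Var 0))
     (App Exo (Var 1) (wk (wk l))))"

definition look_step :: "nat \<Rightarrow> tm \<Rightarrow> tm \<Rightarrow> tm \<Rightarrow> tm \<Rightarrow> tm \<Rightarrow> tm \<Rightarrow> tm" where
  "look_step i A c a b Y h = App Exo (App Exo b (tail Y a)) (peel i A c a Y h)"

text \<open>In the branch for \<open>LCons\<close>, \<open>Var 4\<close> is the head,
  \<open>Var 2\<close> the recursive value for the tail, and \<open>Var 1\<close> and
  \<open>Var 0\<close> are the family and the point to be evaluated.\<close>

definition look :: "nat \<Rightarrow> tm \<Rightarrow> tm \<Rightarrow> tm \<Rightarrow> tm" where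
  "look i A c l = ListInd (look_ty i (wk A) (wk c) (Var 0))
     (Lam Exo (Lam Exo (App Exo (Var 0) (NZero Exo))))
     (Lam Exo (Lam Exo (look_step i (wk (wk (wk (wk (wk A))))) (wk (wk (wk (wk (wk c)))))
       (Var 4) (Var 2) (Var 1) (Var 0)))) l"

lemma subst_tower_fam [simp]:
  "subst \<sigma> (tower_fam i A c Y) = tower_fam i (subst \<sigma> A) (subst \<sigma> c) (subst \<sigma> Y)"
  by (simp add: tower_fam_def)

lemma ren_tower_fam [simp]:
  "ren r (tower_fam i A c Y) = tower_fam i (ren r A) (ren r c) (ren r Y)"
  by (simp add: tower_fam_def)

lemma subst_peel [simp]: "subst \<sigma> (peel i A c a Y h) =
    peel i (subst \<sigma> A) (subst \<sigma> c) (subst \<sigma> a) (subst \<sigma> Y) (subst \<sigma> h)"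
  by (simp add: peel_def)

lemma ren_peel [simp]: "ren r (peel i A c a Y h) =
    peel i (ren r A) (ren r c) (ren r a) (ren r Y) (ren r h)"
  by (simp add: peel_def)

lemma subst_look_ty [simp]: "subst \<sigma> (look_ty i A c l) = look_ty i (subst \<sigma> A) (subst \<sigma> c)
  (subst \<sigma> l)"
  by (simp add: look_ty_def)

lemma ren_look_ty [simp]: "ren r (look_ty i A c l) = look_ty i (ren r A) (ren r c) (ren r l)"
  by (simp add: look_ty_def)

lemma subst_look_step [simp]: "subst \<sigma> (look_step i A c a b Y h) =
    look_step i (subst \<sigma> A) (subst \<sigma> c) (subst \<sigma> a) (subst \<sigma> b) (subst \<sigma> Y) (subst \<sigma> h)"
  by (simp add: look_step_def)

lemma ren_look_step [simp]: "ren r (look_step i A c a b Y h) =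
    look_step i (ren r A) (ren r c) (ren r a) (ren r b) (ren r Y) (ren r h)"
  by (simp add: look_step_def)

lemma subst_look [simp]: "subst \<sigma> (look i A c l) = look i (subst \<sigma> A) (subst \<sigma> c) (subst \<sigma> l)"
  by (simp add: look_def eval_nat_numeral)

lemma ren_look [simp]: "ren r (look i A c l) = look i (ren r A) (ren r c) (ren r l)"
  by (simp add: look_def eval_nat_numeral)

lemma conv_tower_fam_App: "App Exo (tower_fam i A c Y) n \<cong> App Exo (lev i A c n) Y"
  unfolding tower_fam_def by (rule conv_beta) simp

lemma conv_peel_App: "App Exo (peel i A c a Y h) n \<cong>
    App Exo (App Exo (cof_from i A c (step_fam (lev i A c n) Y)) (App Exo h (NSuc Exo n))) a"
  unfolding peel_def by (rule conv_beta) simp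

lemma conv_look_LNil: "App Exo (App Exo (look i A c LNil) Y) h \<cong> App Exo h (NZero Exo)"
  unfolding look_def by (rule conv_trans[OF conv_App2[OF beta_LNil]]) (simp add: conv_beta2)

lemma conv_look_LCons: "App Exo (App Exo (look i A c (LCons a l)) Y) h
    \<cong> look_step i A c a (look i A c l) Y h"
  by (subst look_def, rule conv_trans[OF conv_App2[OF beta_LCons]], fold look_def)
    (simp add: conv_beta2 eval_nat_numeral)

lemma t_tower_fam:
  assumes A: "cofib i \<Gamma> A c" and Y: "\<Gamma> \<turnstile> Y \<Ztypecolon> fams i A"
  shows "\<Gamma> \<turnstile> tower_fam i A c Y \<Ztypecolon> Arr Exo (Nat Exo) (Univ Inner i)"
proof -
  have c: "ctx (Nat Exo # \<Gamma>)" using cofib_ctx[OF A] by (intro isty_ctx isty_Nat)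
  have "Nat Exo # \<Gamma> \<turnstile> App Exo (lev i (wk A) (wk c) (Var 0)) (wk Y) \<Ztypecolon> wk (Univ Inner i)"
    using t_lev_App[OF cofib_wk[OF A c], of "Var 0" "wk Y"] var_0[OF c] typing_wk[OF Y c] by simp
  then show ?thesis unfolding tower_fam_def by (rule tLam) (simp add: isty_Univ c)
qed

lemma isty_tower:
  assumes "cofib i \<Gamma> A c" "\<Gamma> \<turnstile> Y \<Ztypecolon> fams i A"
  shows "isty \<Gamma> (tower i A c Y)"
  by (rule isty_sections[OF isty_Nat[OF cofib_ctx[OF assms(1)]] t_tower_fam[OF assms]])

lemma t_tower_App:
  assumes A: "cofib i \<Gamma> A c" and Y: "\<Gamma> \<turnstile> Y \<Ztypecolon> fams i A" and h: "\<Gamma> \<turnstile> h \<Ztypecolon> tower i A c Y"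
    and n: "\<Gamma> \<turnstile> n \<Ztypecolon> Nat Exo"
  shows "\<Gamma> \<turnstile> App Exo h n \<Ztypecolon> App Exo (lev i A c n) Y"
  by (rule tconv[OF sections_App[OF h n] conv_tower_fam_App isty_Inner[OF t_lev_App[OF A n Y]]])

lemma t_tower_Lam:
  assumes A: "cofib i \<Gamma> A c" and Y: "\<Gamma> \<turnstile> Y \<Ztypecolon> fams i A"
    and t: "Nat Exo # \<Gamma> \<turnstile> t \<Ztypecolon> App Exo (lev i (wk A) (wk c) (Var 0)) (wk Y)"
  shows "\<Gamma> \<turnstile> Lam Exo t \<Ztypecolon> tower i A c Y"
proof (rule tconv)
  have c: "ctx (Nat Exo # \<Gamma>)" using t by (rule typing_ctx)
  show "\<Gamma> \<turnstile> Lam Exo t \<Ztypecolon> Pi Exo (Nat Exo) (App Exo (lev i (wk A) (wk c) (Var 0)) (wk Y))"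
    using var_0[OF c] typing_wk[OF Y c]
    by (intro tLam[OF t] isty_Inner[of _ _ i] t_lev_App cofib_wk[OF A c]) simp_all
  show "Pi Exo (Nat Exo) (App Exo (lev i (wk A) (wk c) (Var 0)) (wk Y)) \<cong> tower i A c Y"
    unfolding tower_fam_def by (rule conv_sym[OF sections_conv])
  show "isty \<Gamma> (tower i A c Y)" using A Y by (rule isty_tower)
qed

lemma t_tower_NSuc:
  assumes A: "cofib i \<Gamma> A c" and Y: "\<Gamma> \<turnstile> Y \<Ztypecolon> fams i A" and h: "\<Gamma> \<turnstile> h \<Ztypecolon> tower i A c Y"
    and n: "\<Gamma> \<turnstile> n \<Ztypecolon> Nat Exo"
  shows "\<Gamma> \<turnstile> App Exo h (NSuc Exo n) \<Ztypecolon> cof_match i A c (step_fam (lev i A c n) Y)"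
  by (rule tconv[OF t_tower_App[OF A Y h ty_NSuc[OF n]] conv_lev_NSuc
      isty_Inner[OF cofib_elim(1)[OF A A t_step_fam[OF cofib_isty[OF A] t_lev[OF A n] Y]]]])

lemma t_step_App:
  assumes A: "cofib i \<Gamma> A c" and Y: "\<Gamma> \<turnstile> Y \<Ztypecolon> fams i A" and n: "\<Gamma> \<turnstile> n \<Ztypecolon> Nat Exo"
    and g: "\<Gamma> \<turnstile> g \<Ztypecolon> sections A (step_fam (lev i A c n) Y)" and a: "\<Gamma> \<turnstile> a \<Ztypecolon> A"
  shows "\<Gamma> \<turnstile> App Exo g a \<Ztypecolon> App Exo (lev i A c n) (tail Y a)"
  by (rule tconv[OF sections_App[OF g a] conv_step_fam_App
        isty_Inner[OF t_lev_App[OF A n t_tail_fam[OF cofib_isty[OF A] Y a]]]])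

lemma t_from_App:
  assumes A: "cofib i \<Gamma> A c" and Y: "\<Gamma> \<turnstile> Y \<Ztypecolon> fams i A" and h: "\<Gamma> \<turnstile> h \<Ztypecolon> tower i A c Y"
    and n: "\<Gamma> \<turnstile> n \<Ztypecolon> Nat Exo"
  shows "\<Gamma> \<turnstile> App Exo (cof_from i A c (step_fam (lev i A c n) Y)) (App Exo h (NSuc Exo n))
    \<Ztypecolon> sections A (step_fam (lev i A c n) Y)"
  by (rule tArr_App[OF cofib_elim(3)[OF A A t_step_fam[OF cofib_isty[OF A] t_lev[OF A n] Y]]
        t_tower_NSuc[OF assms]])

text \<open>\<open>h (n + 1)\<close> lies in the match of the product of all
  \<open>T n (tail Y a)\<close>. Sent back along \<open>cof_from\<close> it is a function on
  \<open>A\<close>, and its value at \<open>a\<close> has the type of the \<open>n\<close>-th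
  component over \<open>tail Y a\<close>.\<close>

lemma t_peel:
  assumes A: "cofib i \<Gamma> A c" and a: "\<Gamma> \<turnstile> a \<Ztypecolon> A" and Y: "\<Gamma> \<turnstile> Y \<Ztypecolon> fams i A"
    and h: "\<Gamma> \<turnstile> h \<Ztypecolon> tower i A c Y"
  shows "\<Gamma> \<turnstile> peel i A c a Y h \<Ztypecolon> tower i A c (tail Y a)"
  unfolding peel_def
proof (rule t_tower_Lam[OF A t_tail_fam[OF cofib_isty[OF A] Y a]])
  have c: "ctx (Nat Exo # \<Gamma>)" using cofib_ctx[OF A] by (intro isty_ctx isty_Nat)
  note A1 = cofib_wk[OF A c] and a1 = typing_wk[OF a c]
  have Y1: "Nat Exo # \<Gamma> \<turnstile> wk Y \<Ztypecolon> fams i (wk A)" using typing_wk[OF Y c] by simp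
  have h1: "Nat Exo # \<Gamma> \<turnstile> wk h \<Ztypecolon> tower i (wk A) (wk c) (wk Y)" using typing_wk[OF h c] by simp
  have n: "Nat Exo # \<Gamma> \<turnstile> Var 0 \<Ztypecolon> Nat Exo" using var_0[OF c] by simp
  show "Nat Exo # \<Gamma> \<turnstile> App Exo (App Exo (cof_from i (wk A) (wk c)
    (step_fam (lev i (wk A) (wk c) (Var 0)) (wk Y)))
       (App Exo (wk h) (NSuc Exo (Var 0)))) (wk a) \<Ztypecolon> App Exo (lev i (wk A) (wk c) (Var 0))
         (wk (tail Y a))"
    using t_step_App[OF A1 Y1 n t_from_App[OF A1 Y1 h1 n] a1] by simp
qed

lemma isty_look_ty:
  assumes A: "cofib i \<Gamma> A c" and l: "\<Gamma> \<turnstile> l \<Ztypecolon> List A"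
  shows "isty \<Gamma> (look_ty i A c l)"
proof -
  let ?S = "tower i (wk A) (wk c) (Var 0)"
  have F: "isty \<Gamma> (fams i A)" using A by (rule isty_fams)
  have c1: "ctx (fams i A # \<Gamma>)" using F by (rule isty_ctx)
  note A1 = cofib_wk[OF A c1]
  have Y: "fams i A # \<Gamma> \<turnstile> Var 0 \<Ztypecolon> fams i (wk A)" using var_0[OF c1] by simp
  have S: "isty (fams i A # \<Gamma>) ?S" by (rule isty_tower[OF A1 Y])
  have c2: "ctx (?S # fams i A # \<Gamma>)" using S by (rule isty_ctx)
  have "?S # fams i A # \<Gamma> \<turnstile> App Exo (Var 1) (wk (wk l)) \<Ztypecolon> Univ Inner i"
    using typing_wk[OF typing_wk[OF l c1] c2] var_Suc[OF Y c2] by (intro tUniv_App) simp_all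
  then show ?thesis
    unfolding look_ty_def by (intro isty_Pi[OF F] isty_Pi[OF S] isty_Inner)
qed

lemma t_look_App:
  assumes b: "\<Gamma> \<turnstile> b \<Ztypecolon> look_ty i A c l" and Y: "\<Gamma> \<turnstile> Y \<Ztypecolon> fams i A"
    and h: "\<Gamma> \<turnstile> h \<Ztypecolon> tower i A c Y"
  shows "\<Gamma> \<turnstile> App Exo (App Exo b Y) h \<Ztypecolon> App Exo Y l"
  by (rule tApp[OF tApp[OF b[unfolded look_ty_def] Y refl, simplified] h]) simp

lemma t_look_step:
  assumes A: "cofib i \<Gamma> A c" and a: "\<Gamma> \<turnstile> a \<Ztypecolon> A" and l: "\<Gamma> \<turnstile> l \<Ztypecolon> List A"
    and b: "\<Gamma> \<turnstile> b \<Ztypecolon> look_ty i A c l" and Y: "\<Gamma> \<turnstile> Y \<Ztypecolon> fams i A"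
    and h: "\<Gamma> \<turnstile> h \<Ztypecolon> tower i A c Y"
  shows "\<Gamma> \<turnstile> look_step i A c a b Y h \<Ztypecolon> App Exo Y (LCons a l)"
  unfolding look_step_def
  by (rule tconv[OF t_look_App[OF b t_tail_fam[OF cofib_isty[OF A] Y a] t_peel[OF A a Y h]]
    conv_tail_App
        isty_Inner[OF tUniv_App[OF Y tLCons[OF cofib_isty[OF A] a l]]]])

lemma t_look:
  assumes A: "cofib i \<Gamma> A c" and l: "\<Gamma> \<turnstile> l \<Ztypecolon> List A"
  shows "\<Gamma> \<turnstile> look i A c l \<Ztypecolon> look_ty i A c l"
  unfolding look_def
proof (rule tListInd[OF _ _ _ l])
  let ?C = "look_ty i (wk A) (wk c) (Var 0)"
  have c0: "ctx \<Gamma>" using A by (rule cofib_ctx)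
  have L: "isty \<Gamma> (List A)" using cofib_isty[OF A] by (rule isty_List)
  have c1: "ctx (List A # \<Gamma>)" using L by (rule isty_ctx)
  show "isty (List A # \<Gamma>) ?C"
    using var_0[OF c1] by (intro isty_look_ty cofib_wk[OF A c1]) simp
  show "inst ?C l = look_ty i A c l" by simp
  {
    let ?S = "tower i (wk A) (wk c) (Var 0)"
    have cF: "ctx (fams i A # \<Gamma>)" by (intro isty_ctx isty_fams[OF A])
    note AF = cofib_wk[OF A cF]
    have Y: "fams i A # \<Gamma> \<turnstile> Var 0 \<Ztypecolon> fams i (wk A)" using var_0[OF cF] by simp
    have cS: "ctx (?S # fams i A # \<Gamma>)" by (rule isty_ctx[OF isty_tower[OF AF Y]])
    note AS = cofib_wk[OF AF cS]
    have Y': "?S # fams i A # \<Gamma> \<turnstile> Var 1 \<Ztypecolon> fams i (wk (wk A))" using var_Suc[OF Y cS] by simp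
    have h: "?S # fams i A # \<Gamma> \<turnstile> Var 0 \<Ztypecolon> tower i (wk (wk A)) (wk (wk c)) (Var 1)"
      using var_0[OF cS] by simp
    have T: "isty (?S # fams i A # \<Gamma>) (App Exo (Var 1) LNil)"
      by (rule isty_Inner[OF tUniv_App[OF Y' tLNil[OF cofib_isty[OF AS]]]])
    \<comment> \<open>The component at zero has type \<open>T 0 Y\<close>, which computes to the
      value of \<open>Y\<close> at the empty list.\<close>
    have "?S # fams i A # \<Gamma> \<turnstile> App Exo (Var 0) (NZero Exo) \<Ztypecolon> App Exo (Var 1) LNil"
      by (rule tconv[OF t_tower_App[OF AS Y' h ty_NZero[OF cS]] conv_lev_NZero T])
    from tLam2[OF this T]
    show "\<Gamma> \<turnstile> Lam Exo (Lam Exo (App Exo (Var 0) (NZero Exo))) \<Ztypecolon> inst ?C LNil"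
      by (simp add: look_ty_def)
  }
  have ca: "ctx (A # \<Gamma>)" by (rule isty_ctx[OF cofib_isty[OF A]])
  note A1 = cofib_wk[OF A ca]
  have c2: "ctx (wk (List A) # A # \<Gamma>)" by (rule isty_ctx[OF isty_wk[OF L ca]])
  note A2 = cofib_wk[OF A1 c2]
  \<comment> \<open>The motive at the tail, with the substitution of the elimination rule already
    carried out; \<open>Var 0\<close> is the tail.\<close>
  let ?I = "look_ty i (wk (wk A)) (wk (wk c)) (Var 0)"
  have c3: "ctx (?I # wk (List A) # A # \<Gamma>)"
    using var_0[OF c2] by (intro isty_ctx isty_look_ty[OF A2]) simp
  note A3 = cofib_wk[OF A2 c3]
  let ?F = "fams i (wk (wk (wk A)))"
  have c4: "ctx (?F # ?I # wk (List A) # A # \<Gamma>)" by (rule isty_ctx[OF isty_fams[OF A3]])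
  note A4 = cofib_wk[OF A3 c4]
  let ?S = "tower i (wk (wk (wk (wk A)))) (wk (wk (wk (wk c)))) (Var 0)"
  have Y4: "?F # ?I # wk (List A) # A # \<Gamma> \<turnstile> Var 0 \<Ztypecolon> fams i (wk (wk (wk (wk A))))"
    using var_0[OF c4] by simp
  have c5: "ctx (?S # ?F # ?I # wk (List A) # A # \<Gamma>)" by (rule isty_ctx[OF isty_tower[OF A4 Y4]])
  note A5 = cofib_wk[OF A4 c5]
  let ?\<Delta> = "?S # ?F # ?I # wk (List A) # A # \<Gamma>"
  let ?A = "wk (wk (wk (wk (wk A))))" and ?c = "wk (wk (wk (wk (wk c))))"
  have h: "?\<Delta> \<turnstile> Var 0 \<Ztypecolon> tower i ?A ?c (Var 1)" using var_0[OF c5] by simp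
  have Y: "?\<Delta> \<turnstile> Var 1 \<Ztypecolon> fams i ?A" using var_Suc[OF Y4 c5] by simp
  have b: "?\<Delta> \<turnstile> Var 2 \<Ztypecolon> look_ty i ?A ?c (Var 3)"
    using var_Suc[OF var_Suc[OF var_0[OF c3] c4] c5] by (simp add: eval_nat_numeral)
  have l: "?\<Delta> \<turnstile> Var 3 \<Ztypecolon> List ?A"
    using var_Suc[OF var_Suc[OF var_Suc[OF var_0[OF c2] c3] c4] c5] by (simp add: eval_nat_numeral)
  have a: "?\<Delta> \<turnstile> Var 4 \<Ztypecolon> ?A"
    using var_Suc[OF var_Suc[OF var_Suc[OF var_Suc[OF var_0[OF ca] c2] c3] c4] c5] by
      (simp add: eval_nat_numeral)
  from tLam2[OF t_look_step[OF A5 a l b Y h]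
      isty_Inner[OF tUniv_App[OF Y tLCons[OF cofib_isty[OF A5] a l]]]]
  show "subst (Var 0 \<cdot> shifted 2) ?C # wk (List A) # A # \<Gamma>
      \<turnstile> Lam Exo (Lam Exo (look_step i ?A ?c (Var 4) (Var 2) (Var 1) (Var 0)))
      \<Ztypecolon> subst (LCons (Var 2) (Var 1) \<cdot> shifted 3) ?C"
    by (simp add: look_ty_def eval_nat_numeral)
qed

subsection \<open>The two maps are inverse to each other\<close>

lemma sections_ext:
  assumes A: "isty \<Gamma> A" and Y: "\<Gamma> \<turnstile> Y \<Ztypecolon> Arr Exo A (Univ Inner i)"
    and f: "\<Gamma> \<turnstile> f \<Ztypecolon> sections A Y" and g: "\<Gamma> \<turnstile> g \<Ztypecolon> sections A Y"
    and e: "exo_eq (A # \<Gamma>) (App Exo (wk Y) (Var 0)) (App Exo (wk f) (Var 0))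
      (App Exo (wk g) (Var 0))"
  shows "exo_eq \<Gamma> (sections A Y) f g"
proof -
  have "isty (A # \<Gamma>) (App Exo (wk Y) (Var 0))" using e by (simp add: exo_eq_def)
  then show ?thesis using f g e unfolding sections_def by (rule exo_eq_funext)
qed

lemma exo_eq_App:
  assumes e: "exo_eq \<Gamma> A a b" and f: "\<Gamma> \<turnstile> f \<Ztypecolon> Arr Exo A B" and B: "isty \<Gamma> B"
  shows "exo_eq \<Gamma> B (App Exo f a) (App Exo f b)"
proof -
  have c: "ctx (A # \<Gamma>)" using e by (auto simp: exo_eq_def intro: isty_ctx)
  have "A # \<Gamma> \<turnstile> App Exo (wk f) (Var 0) \<Ztypecolon> wk B"
    by (rule tArr_App[OF tArr_wk[OF f c] var_0[OF c]])
  from exo_eq_cong[OF e this B] show ?thesis by simp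
qed

lemma inhab_wk: "inhab \<Gamma> A \<Longrightarrow> ctx (B # \<Gamma>) \<Longrightarrow> inhab (B # \<Gamma>) (wk A)"
  unfolding inhab_def by (blast intro: typing_wk)

lemma inhab_var_0: "ctx (A # \<Gamma>) \<Longrightarrow> inhab (A # \<Gamma>) (wk A)"
  unfolding inhab_def by (blast intro: var_0)

lemma inhab_Arr: "inhab (A # \<Gamma>) (wk B) \<Longrightarrow> isty \<Gamma> B \<Longrightarrow> inhab \<Gamma> (Arr Exo A B)"
  by (intro inhab_Lam isty_wk) (auto simp: inhab_def dest: typing_ctx)

lemma inhab_NatInd: "isty (Nat Exo # \<Gamma>) C \<Longrightarrow> inhab \<Gamma> (inst C (NZero Exo)) \<Longrightarrow>
    inhab (C # Nat Exo # \<Gamma>) (subst (NSuc Exo (Var 1) \<cdot> shifted 2) C) \<Longrightarrow>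
    \<Gamma> \<turnstile> n \<Ztypecolon> Nat Exo \<Longrightarrow> inhab \<Gamma> (inst C n)"
  unfolding inhab_def by (blast intro: tNatInd[OF _ _ _ _ refl])

lemma inhab_ListInd: "isty (List A # \<Gamma>) C \<Longrightarrow> inhab \<Gamma> (inst C LNil) \<Longrightarrow>
    inhab (subst (Var 0 \<cdot> shifted 2) C # wk (List A) # A # \<Gamma>)
      (subst (LCons (Var 2) (Var 1) \<cdot> shifted 3) C) \<Longrightarrow>
    \<Gamma> \<turnstile> l \<Ztypecolon> List A \<Longrightarrow> inhab \<Gamma> (inst C l)"
  unfolding inhab_def by (blast intro: tListInd[OF _ _ _ _ refl])

definition all_read :: "nat \<Rightarrow> tm \<Rightarrow> tm \<Rightarrow> tm \<Rightarrow> tm \<Rightarrow> tm" where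
  "all_read i A c Y f = Lam Exo (App Exo (App Exo (read i (wk A) (wk c) (Var 0)) (wk Y)) (wk f))"

definition all_look :: "nat \<Rightarrow> tm \<Rightarrow> tm \<Rightarrow> tm \<Rightarrow> tm \<Rightarrow> tm" where
  "all_look i A c Y h = Lam Exo (App Exo (App Exo (look i (wk A) (wk c) (Var 0)) (wk Y)) (wk h))"

lemma subst_all [simp]:
  "subst \<sigma> (all_read i A c Y f) = all_read i (subst \<sigma> A) (subst \<sigma> c) (subst \<sigma> Y) (subst \<sigma> f)"
  "subst \<sigma> (all_look i A c Y f) = all_look i (subst \<sigma> A) (subst \<sigma> c) (subst \<sigma> Y) (subst \<sigma> f)"
  by (simp_all add: all_read_def all_look_def)

lemma ren_all [simp]:
  "ren r (all_read i A c Y f) = all_read i (ren r A) (ren r c) (ren r Y) (ren r f)"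
  "ren r (all_look i A c Y f) = all_look i (ren r A) (ren r c) (ren r Y) (ren r f)"
  by (simp_all add: all_read_def all_look_def)

lemma conv_all_read_App: "App Exo (all_read i A c Y f) n \<cong> App Exo (App Exo (read i A c n) Y) f"
  unfolding all_read_def by (rule conv_beta) simp

lemma conv_all_look_App: "App Exo (all_look i A c Y h) l \<cong> App Exo (App Exo (look i A c l) Y) h"
  unfolding all_look_def by (rule conv_beta) simp

text \<open>A judgmental fact: below the abstraction, \<open>look\<close> meets an
  \<open>LCons\<close> and unfolds to the evaluation of the peeled point. It lets the induction
  hypothesis on levels be applied to a section that itself comes from a point.\<close>

lemma conv_tail_all_look: "tail (all_look i A c Y h) a \<cong> all_look i A c (tail Y a)
  (peel i A c a Y h)"
proof -
  have "tail (all_look i A c Y h) a = Lam Exo (App Exo (all_look i (wk A) (wk c) (wk Y) (wk h))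
    (LCons (wk a) (Var 0)))"
    by (simp add: tail_def)
  also have "\<dots> \<cong> Lam Exo (look_step i (wk A) (wk c) (wk a) (look i (wk A) (wk c) (Var 0)) (wk Y)
    (wk h))"
    by (intro cong_Lam conv_trans[OF conv_all_look_App conv_look_LCons])
  also have "\<dots> = all_look i A c (tail Y a) (peel i A c a Y h)"
    by (simp add: look_step_def all_look_def)
  finally show ?thesis .
qed

lemma t_all_read:
  assumes A: "cofib i \<Gamma> A c" and Y: "\<Gamma> \<turnstile> Y \<Ztypecolon> fams i A" and f: "\<Gamma> \<turnstile> f \<Ztypecolon> sections (List A) Y"
  shows "\<Gamma> \<turnstile> all_read i A c Y f \<Ztypecolon> tower i A c Y"
  unfolding all_read_def
proof (rule t_tower_Lam[OF A Y])
  have c: "ctx (Nat Exo # \<Gamma>)" using cofib_ctx[OF A] by (intro isty_ctx isty_Nat)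
  show "Nat Exo # \<Gamma> \<turnstile> App Exo (App Exo (read i (wk A) (wk c) (Var 0)) (wk Y)) (wk f)
      \<Ztypecolon> App Exo (lev i (wk A) (wk c) (Var 0)) (wk Y)"
    using t_read_App[OF t_read[OF cofib_wk[OF A c]]] var_0[OF c] typing_wk[OF Y c] typing_wk[OF f c]
    by simp
qed

lemma t_all_look:
  assumes A: "cofib i \<Gamma> A c" and Y: "\<Gamma> \<turnstile> Y \<Ztypecolon> fams i A" and h: "\<Gamma> \<turnstile> h \<Ztypecolon> tower i A c Y"
  shows "\<Gamma> \<turnstile> all_look i A c Y h \<Ztypecolon> sections (List A) Y"
  unfolding all_look_def sections_def
proof (rule tLam)
  have c: "ctx (List A # \<Gamma>)" using cofib_isty[OF A] by (intro isty_ctx isty_List)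
  show t: "List A # \<Gamma> \<turnstile> App Exo (App Exo (look i (wk A) (wk c) (Var 0)) (wk Y)) (wk h)
      \<Ztypecolon> App Exo (wk Y) (Var 0)"
    using t_look_App[OF t_look[OF cofib_wk[OF A c]]] var_0[OF c] typing_wk[OF Y c] typing_wk[OF h c]
    by simp
  show "isty (List A # \<Gamma>) (App Exo (wk Y) (Var 0))"
    using typing_wk[OF Y c] var_0[OF c] by (intro isty_Inner[OF tUniv_App]) simp_all
qed

text \<open>The context in which the statements about all families and all sections are proved, with
  \<open>Var 1\<close> as the family and \<open>Var 0\<close> as the section;
  \<open>fams_tower_ctx\<close> plays the same role for points of the tower.\<close>

lemma fams_section_ctx:
  assumes A: "cofib i \<Gamma> A c"
  defines "\<Delta> \<equiv> sections (List (wk A)) (Var 0) # fams i A # \<Gamma>"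
  shows "cofib i \<Delta> (wk (wk A)) (wk (wk c))" "\<Delta> \<turnstile> Var 1 \<Ztypecolon> fams i (wk (wk A))"
    "\<Delta> \<turnstile> Var 0 \<Ztypecolon> sections (List (wk (wk A))) (Var 1)"
    "\<Gamma> \<turnstile> t \<Ztypecolon> B \<Longrightarrow> \<Delta> \<turnstile> wk (wk t) \<Ztypecolon> wk (wk B)"
    "\<Gamma> \<turnstile> l \<Ztypecolon> List B \<Longrightarrow> \<Delta> \<turnstile> wk (wk l) \<Ztypecolon> List (wk (wk B))"
proof -
  have c1: "ctx (fams i A # \<Gamma>)" using A by (intro isty_ctx isty_fams)
  note A1 = cofib_wk[OF A c1]
  have Y: "fams i A # \<Gamma> \<turnstile> Var 0 \<Ztypecolon> fams i (wk A)" using var_0[OF c1] by simp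
  have c2: "ctx \<Delta>"
    unfolding \<Delta>_def by (rule isty_ctx[OF isty_sections[OF isty_List[OF cofib_isty[OF A1]] Y]])
  note c2' = c2[unfolded \<Delta>_def]
  show "cofib i \<Delta> (wk (wk A)) (wk (wk c))" unfolding \<Delta>_def by (rule cofib_wk[OF A1 c2'])
  show "\<Delta> \<turnstile> Var 1 \<Ztypecolon> fams i (wk (wk A))" unfolding \<Delta>_def using var_Suc[OF Y c2'] by simp
  show "\<Delta> \<turnstile> Var 0 \<Ztypecolon> sections (List (wk (wk A))) (Var 1)" unfolding \<Delta>_def using var_0[OF c2'] by simp
  show *: "\<Gamma> \<turnstile> t \<Ztypecolon> B \<Longrightarrow> \<Delta> \<turnstile> wk (wk t) \<Ztypecolon> wk (wk B)" for t B
    unfolding \<Delta>_def by (intro typing_wk c1 c2')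
  show "\<Gamma> \<turnstile> l \<Ztypecolon> List B \<Longrightarrow> \<Delta> \<turnstile> wk (wk l) \<Ztypecolon> List (wk (wk B))"
    using *[of l "List B"] by simp
qed

lemma fams_tower_ctx:
  assumes A: "cofib i \<Gamma> A c"
  defines "\<Delta> \<equiv> tower i (wk A) (wk c) (Var 0) # fams i A # \<Gamma>"
  shows "cofib i \<Delta> (wk (wk A)) (wk (wk c))" "\<Delta> \<turnstile> Var 1 \<Ztypecolon> fams i (wk (wk A))"
    "\<Delta> \<turnstile> Var 0 \<Ztypecolon> tower i (wk (wk A)) (wk (wk c)) (Var 1)"
    "\<Gamma> \<turnstile> t \<Ztypecolon> B \<Longrightarrow> \<Delta> \<turnstile> wk (wk t) \<Ztypecolon> wk (wk B)"
    "\<Gamma> \<turnstile> n \<Ztypecolon> Nat Exo \<Longrightarrow> \<Delta> \<turnstile> wk (wk n) \<Ztypecolon> Nat Exo"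
proof -
  have c1: "ctx (fams i A # \<Gamma>)" using A by (intro isty_ctx isty_fams)
  note A1 = cofib_wk[OF A c1]
  have Y: "fams i A # \<Gamma> \<turnstile> Var 0 \<Ztypecolon> fams i (wk A)" using var_0[OF c1] by simp
  have c2: "ctx \<Delta>" unfolding \<Delta>_def by (rule isty_ctx[OF isty_tower[OF A1 Y]])
  note c2' = c2[unfolded \<Delta>_def]
  show "cofib i \<Delta> (wk (wk A)) (wk (wk c))" unfolding \<Delta>_def by (rule cofib_wk[OF A1 c2'])
  show "\<Delta> \<turnstile> Var 1 \<Ztypecolon> fams i (wk (wk A))" unfolding \<Delta>_def using var_Suc[OF Y c2'] by simp
  show "\<Delta> \<turnstile> Var 0 \<Ztypecolon> tower i (wk (wk A)) (wk (wk c)) (Var 1)"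
    unfolding \<Delta>_def using var_0[OF c2'] by simp
  show *: "\<Gamma> \<turnstile> t \<Ztypecolon> B \<Longrightarrow> \<Delta> \<turnstile> wk (wk t) \<Ztypecolon> wk (wk B)" for t B
    unfolding \<Delta>_def by (intro typing_wk c1 c2')
  show "\<Gamma> \<turnstile> n \<Ztypecolon> Nat Exo \<Longrightarrow> \<Delta> \<turnstile> wk (wk n) \<Ztypecolon> Nat Exo"
    using *[of n "Nat Exo"] by simp
qed

section \<open>Restriction after evaluation, by induction on the level\<close>

definition read_look_ty :: "nat \<Rightarrow> tm \<Rightarrow> tm \<Rightarrow> tm \<Rightarrow> tm" where
  "read_look_ty i A c n = Pi Exo (fams i A) (Pi Exo (tower i (wk A) (wk c) (Var 0))
     (Eq Exo (App Exo (lev i (wk (wk A)) (wk (wk c)) (wk (wk n))) (Var 1))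
       (App Exo (App Exo (read i (wk (wk A)) (wk (wk c)) (wk (wk n))) (Var 1))
         (all_look i (wk (wk A)) (wk (wk c)) (Var 1) (Var 0)))
       (App Exo (Var 0) (wk (wk n)))))"

lemma subst_read_look_ty [simp]:
  "subst \<sigma> (read_look_ty i A c n) = read_look_ty i (subst \<sigma> A) (subst \<sigma> c) (subst \<sigma> n)"
  by (simp add: read_look_ty_def)

lemma ren_read_look_ty [simp]:
  "ren r (read_look_ty i A c n) = read_look_ty i (ren r A) (ren r c) (ren r n)"
  by (simp add: read_look_ty_def)

lemma t_read_all_look:
  assumes A: "cofib i \<Gamma> A c" and n: "\<Gamma> \<turnstile> n \<Ztypecolon> Nat Exo" and Y: "\<Gamma> \<turnstile> Y \<Ztypecolon> fams i A"
    and h: "\<Gamma> \<turnstile> h \<Ztypecolon> tower i A c Y"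
  shows "\<Gamma> \<turnstile> App Exo (App Exo (read i A c n) Y) (all_look i A c Y h) \<Ztypecolon> App Exo (lev i A c n) Y"
  by (rule t_read_App[OF t_read[OF A n] Y t_all_look[OF A Y h]])

lemma isty_read_look_ty:
  assumes A: "cofib i \<Gamma> A c" and n: "\<Gamma> \<turnstile> n \<Ztypecolon> Nat Exo"
  shows "isty \<Gamma> (read_look_ty i A c n)"
proof -
  note D = fams_tower_ctx[OF A] and n2 = fams_tower_ctx(5)[OF A n]
  show ?thesis
    unfolding read_look_ty_def
    by (rule isty_Pi[OF isty_fams[OF A] isty_Pi[OF typing_Lam_ctx[OF D(3)] isty_Eq[OF
        isty_Inner[OF t_lev_App[OF D(1) n2 D(2)]] t_read_all_look[OF D(1) n2 D(2,3)]
        t_tower_App[OF D(1-3) n2]]]])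
qed

lemma read_look_elim:
  assumes A: "cofib i \<Gamma> A c" and n: "\<Gamma> \<turnstile> n \<Ztypecolon> Nat Exo" and Y: "\<Gamma> \<turnstile> Y \<Ztypecolon> fams i A"
    and h: "\<Gamma> \<turnstile> h \<Ztypecolon> tower i A c Y" and e: "inhab \<Gamma> (read_look_ty i A c n)"
  shows "exo_eq \<Gamma> (App Exo (lev i A c n) Y)
    (App Exo (App Exo (read i A c n) Y) (all_look i A c Y h)) (App Exo h n)"
proof -
  have "inhab \<Gamma> (Eq Exo (App Exo (lev i A c n) Y)
      (App Exo (App Exo (read i A c n) Y) (all_look i A c Y h)) (App Exo h n))"
    by (rule inhab_App[OF inhab_App[OF e[unfolded read_look_ty_def] Y refl, simplified] h]) simp
  then show ?thesis
    using isty_Inner[OF t_lev_App[OF A n Y]] t_read_all_look[OF A n Y h] t_tower_App[OF A Y h n]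
    by (simp add: exo_eq_def)
qed

lemma read_look_intro:
  assumes A: "cofib i \<Gamma> A c" and n: "\<Gamma> \<turnstile> n \<Ztypecolon> Nat Exo"
    and e: "exo_eq (tower i (wk A) (wk c) (Var 0) # fams i A # \<Gamma>)
      (App Exo (lev i (wk (wk A)) (wk (wk c)) (wk (wk n))) (Var 1))
      (App Exo (App Exo (read i (wk (wk A)) (wk (wk c)) (wk (wk n))) (Var 1))
        (all_look i (wk (wk A)) (wk (wk c)) (Var 1) (Var 0)))
      (App Exo (Var 0) (wk (wk n)))"
  shows "inhab \<Gamma> (read_look_ty i A c n)"
  using isty_read_look_ty[OF A n] e unfolding read_look_ty_def
  by (intro inhab_Lam) (auto simp: exo_eq_def isty_Pi_iff)

text \<open>Both sides compute to the same term: restriction at zero evaluates at the empty list,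
  where \<open>look\<close> returns the component at zero. Reflexivity is enough.\<close>

lemma read_look_NZero:
  assumes A: "cofib i \<Gamma> A c" and Y: "\<Gamma> \<turnstile> Y \<Ztypecolon> fams i A" and h: "\<Gamma> \<turnstile> h \<Ztypecolon> tower i A c Y"
  shows "exo_eq \<Gamma> (App Exo (lev i A c (NZero Exo)) Y)
    (App Exo (App Exo (read i A c (NZero Exo)) Y) (all_look i A c Y h)) (App Exo h (NZero Exo))"
proof -
  have n: "\<Gamma> \<turnstile> NZero Exo \<Ztypecolon> Nat Exo" by (rule ty_NZero[OF cofib_ctx[OF A]])
  have "App Exo (App Exo (read i A c (NZero Exo)) Y) (all_look i A c Y h) \<cong> App Exo h (NZero Exo)"
    by (rule conv_trans[OF conv_read_NZero conv_trans[OF conv_all_look_App conv_look_LNil]])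
  then show ?thesis
    by (rule exo_eqI_conv[OF isty_Inner[OF t_lev_App[OF A n Y]] t_read_all_look[OF A n Y h]
      t_tower_App[OF A Y h n]])
qed

text \<open>The left-hand side is \<open>cof_to\<close> of the function sending \<open>a\<close> to
  the restriction, over \<open>tail Y a\<close>, of the tail of the evaluated section. By the
  hypothesis its value at \<open>a\<close> is the \<open>n\<close>-th component of the peeled point,
  that is, \<open>cof_from\<close> of \<open>h (n + 1)\<close> at \<open>a\<close>. Extensionality
  identifies the two functions, and \<open>cof_to\<close> cancels \<open>cof_from\<close>.\<close>

lemma read_look_NSuc:
  assumes A: "cofib i \<Gamma> A c" and n: "\<Gamma> \<turnstile> n \<Ztypecolon> Nat Exo" and Y: "\<Gamma> \<turnstile> Y \<Ztypecolon> fams i A"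
    and h: "\<Gamma> \<turnstile> h \<Ztypecolon> tower i A c Y" and e: "inhab \<Gamma> (read_look_ty i A c n)"
  shows "exo_eq \<Gamma> (App Exo (lev i A c (NSuc Exo n)) Y)
    (App Exo (App Exo (read i A c (NSuc Exo n)) Y) (all_look i A c Y h)) (App Exo h (NSuc Exo n))"
proof -
  define S where "S = step_fam (lev i A c n) Y"
  let ?x = "App Exo h (NSuc Exo n)"
  let ?g = "App Exo (cof_from i A c S) ?x"
  let ?G = "Lam Exo (App Exo (App Exo (wk (read i A c n)) (tail (wk Y) (Var 0)))
      (tail (wk (all_look i A c Y h)) (Var 0)))"
  have A0: "isty \<Gamma> A" using A by (rule cofib_isty)
  have S: "\<Gamma> \<turnstile> S \<Ztypecolon> Arr Exo A (Univ Inner i)"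
    unfolding S_def by (rule t_step_fam[OF A0 t_lev[OF A n] Y])
  note el = cofib_elim[OF A A S]
  have x: "\<Gamma> \<turnstile> ?x \<Ztypecolon> cof_match i A c S" unfolding S_def by (rule t_tower_NSuc[OF A Y h n])
  have g: "\<Gamma> \<turnstile> ?g \<Ztypecolon> sections A S" by (rule tArr_App[OF el(3) x])
  have G: "\<Gamma> \<turnstile> ?G \<Ztypecolon> sections A S"
    unfolding S_def by (rule t_read_step_arg[OF A n t_read[OF A n] Y t_all_look[OF A Y h]])
  have Gg: "exo_eq \<Gamma> (sections A S) ?G ?g"
  proof (rule sections_ext[OF A0 S G g])
    have c: "ctx (A # \<Gamma>)" using A0 by (rule isty_ctx)
    note A1 = cofib_wk[OF A c] and a = var_0[OF c]
    have n1: "A # \<Gamma> \<turnstile> wk n \<Ztypecolon> Nat Exo" using typing_wk[OF n c] by simp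
    have Y1: "A # \<Gamma> \<turnstile> wk Y \<Ztypecolon> fams i (wk A)" using typing_wk[OF Y c] by simp
    have h1: "A # \<Gamma> \<turnstile> wk h \<Ztypecolon> tower i (wk A) (wk c) (wk Y)" using typing_wk[OF h c] by simp
    have e1: "inhab (A # \<Gamma>) (read_look_ty i (wk A) (wk c) (wk n))" using inhab_wk[OF e c] by simp
    have S1: "A # \<Gamma> \<turnstile> wk S \<Ztypecolon> Arr Exo (wk A) (Univ Inner i)" using typing_wk[OF S c] by simp
    \<comment> \<open>The hypothesis is used over the extra variable \<open>a\<close>, at the family
      \<open>tail Y a\<close> and the peeled point: the reason why it quantifies over both.\<close>
    note IH = read_look_elim[OF A1 n1 t_tail_fam[OF cofib_isty[OF A1] Y1 a] t_peel[OF A1 a Y1 h1]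
      e1]
    show "exo_eq (A # \<Gamma>) (App Exo (wk S) (Var 0)) (App Exo (wk ?G) (Var 0))
      (App Exo (wk ?g) (Var 0))"
    proof (rule exo_eq_conv[OF IH])
      show "App Exo (lev i (wk A) (wk c) (wk n)) (tail (wk Y) (Var 0)) \<cong> App Exo (wk S) (Var 0)"
        unfolding S_def using conv_sym[OF conv_step_fam_App] by simp
      have "App Exo (wk ?G) (Var 0) \<cong> App Exo (App Exo (read i (wk A) (wk c) (wk n))
        (tail (wk Y) (Var 0)))
          (tail (all_look i (wk A) (wk c) (wk Y) (wk h)) (Var 0))"
        by (simp add: conv_beta)
      also have "\<dots> \<cong> App Exo (App Exo (read i (wk A) (wk c) (wk n)) (tail (wk Y) (Var 0)))
          (all_look i (wk A) (wk c) (tail (wk Y) (Var 0))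
            (peel i (wk A) (wk c) (Var 0) (wk Y) (wk h)))"
        by (intro cong_App conv_refl conv_tail_all_look)
      finally show "App Exo (App Exo (read i (wk A) (wk c) (wk n)) (tail (wk Y) (Var 0)))
          (all_look i (wk A) (wk c) (tail (wk Y) (Var 0))
            (peel i (wk A) (wk c) (Var 0) (wk Y) (wk h)))
        \<cong> App Exo (wk ?G) (Var 0)" by (rule conv_sym)
      show "App Exo (peel i (wk A) (wk c) (Var 0) (wk Y) (wk h)) (wk n) \<cong> App Exo (wk ?g) (Var 0)"
        unfolding S_def using conv_peel_App by simp
      show "isty (A # \<Gamma>) (App Exo (wk S) (Var 0))" by (rule isty_Inner[OF tUniv_App[OF S1 a]])
      show "A # \<Gamma> \<turnstile> App Exo (wk ?G) (Var 0) \<Ztypecolon> App Exo (wk S) (Var 0)"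
        by (rule sections_App[OF typing_wk[OF G c, unfolded ren_sections] a])
      show "A # \<Gamma> \<turnstile> App Exo (wk ?g) (Var 0) \<Ztypecolon> App Exo (wk S) (Var 0)"
        by (rule sections_App[OF typing_wk[OF g c, unfolded ren_sections] a])
    qed
  qed
  have "exo_eq \<Gamma> (cof_match i A c S) (App Exo (cof_to i A c S) ?G) ?x"
    by (rule exo_eq_trans[OF exo_eq_App[OF Gg el(2) isty_Inner[OF el(1)]] el(4)[OF x]])
  then show ?thesis
  proof (rule exo_eq_conv)
    show "cof_match i A c S \<cong> App Exo (lev i A c (NSuc Exo n)) Y"
      unfolding S_def by (rule conv_sym[OF conv_lev_NSuc])
    show "App Exo (cof_to i A c S) ?G
        \<cong> App Exo (App Exo (read i A c (NSuc Exo n)) Y) (all_look i A c Y h)"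
      unfolding S_def using conv_sym[OF conv_read_NSuc[unfolded read_step_def]] .
    show "?x \<cong> ?x" by (rule conv_refl)
    show "isty \<Gamma> (App Exo (lev i A c (NSuc Exo n)) Y)"
      by (rule isty_Inner[OF t_lev_App[OF A ty_NSuc[OF n] Y]])
    show "\<Gamma> \<turnstile> App Exo (App Exo (read i A c (NSuc Exo n)) Y) (all_look i A c Y h)
        \<Ztypecolon> App Exo (lev i A c (NSuc Exo n)) Y" by (rule t_read_all_look[OF A ty_NSuc[OF n] Y h])
    show "\<Gamma> \<turnstile> ?x \<Ztypecolon> App Exo (lev i A c (NSuc Exo n)) Y" by (rule t_tower_App[OF A Y h ty_NSuc[OF n]])
  qed
qed

lemma read_look:
  assumes A: "cofib i \<Gamma> A c" and n: "\<Gamma> \<turnstile> n \<Ztypecolon> Nat Exo"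
  shows "inhab \<Gamma> (read_look_ty i A c n)"
proof -
  let ?C = "read_look_ty i (wk A) (wk c) (Var 0)"
  have c0: "ctx \<Gamma>" using A by (rule cofib_ctx)
  have c1: "ctx (Nat Exo # \<Gamma>)" using c0 by (intro isty_ctx isty_Nat)
  note A1 = cofib_wk[OF A c1]
  have m: "Nat Exo # \<Gamma> \<turnstile> Var 0 \<Ztypecolon> Nat Exo" using var_0[OF c1] by simp
  have C: "isty (Nat Exo # \<Gamma>) ?C" by (rule isty_read_look_ty[OF A1 m])
  have c2: "ctx (?C # Nat Exo # \<Gamma>)" using C by (rule isty_ctx)
  note A2 = cofib_wk[OF A1 c2]
  have m2: "?C # Nat Exo # \<Gamma> \<turnstile> Var 1 \<Ztypecolon> Nat Exo" using var_Suc[OF m c2] by simp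
  have IH: "inhab (?C # Nat Exo # \<Gamma>) (read_look_ty i (wk (wk A)) (wk (wk c)) (Var 1))"
    using inhab_var_0[OF c2] by simp
  have "inhab \<Gamma> (inst ?C n)"
  proof (rule inhab_NatInd[OF C _ _ n])
    note D = fams_tower_ctx[OF A]
    have "inhab \<Gamma> (read_look_ty i A c (NZero Exo))"
      using read_look_NZero[OF D(1-3)] by (intro read_look_intro[OF A ty_NZero[OF c0]]) simp
    then show "inhab \<Gamma> (inst ?C (NZero Exo))" by simp
    note D2 = fams_tower_ctx[OF A2]
    \<comment> \<open>The hypothesis is moved past the family and the point that the new instance
      binds, where it can be instantiated afresh.\<close>
    have IH2: "inhab (tower i (wk (wk (wk A))) (wk (wk (wk c))) (Var 0) # fams i (wk (wk A)) # ?C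
      # Nat Exo # \<Gamma>)
        (read_look_ty i (wk (wk (wk (wk A)))) (wk (wk (wk (wk c)))) (wk (wk (Var 1))))"
      using IH D2(4) unfolding inhab_def by fastforce
    have "inhab (?C # Nat Exo # \<Gamma>) (read_look_ty i (wk (wk A)) (wk (wk c)) (NSuc Exo (Var 1)))"
      using read_look_NSuc[OF D2(1) D2(5)[OF m2] D2(2-3)] IH2
      by (intro read_look_intro[OF A2 ty_NSuc[OF m2]]) simp
    then show "inhab (?C # Nat Exo # \<Gamma>) (subst (NSuc Exo (Var 1) \<cdot> shifted 2) ?C)" by simp
  qed
  then show ?thesis by simp
qed

lemma all_read_all_look:
  assumes A: "cofib i \<Gamma> A c" and Y: "\<Gamma> \<turnstile> Y \<Ztypecolon> fams i A" and h: "\<Gamma> \<turnstile> h \<Ztypecolon> tower i A c Y"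
  shows "exo_eq \<Gamma> (tower i A c Y) (all_read i A c Y (all_look i A c Y h)) h"
proof (rule sections_ext[OF isty_Nat[OF cofib_ctx[OF A]] t_tower_fam[OF A Y]
      t_all_read[OF A Y t_all_look[OF A Y h]] h])
  let ?N = "Nat Exo # \<Gamma>"
  let ?r = "all_read i A c Y (all_look i A c Y h)"
  have c: "ctx ?N" using cofib_ctx[OF A] by (intro isty_ctx isty_Nat)
  note A1 = cofib_wk[OF A c]
  have n: "?N \<turnstile> Var 0 \<Ztypecolon> Nat Exo" using var_0[OF c] by simp
  have Y1: "?N \<turnstile> wk Y \<Ztypecolon> fams i (wk A)" using typing_wk[OF Y c] by simp
  have h1: "?N \<turnstile> wk h \<Ztypecolon> tower i (wk A) (wk c) (wk Y)" using typing_wk[OF h c] by simp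
  have r1: "?N \<turnstile> wk ?r \<Ztypecolon> tower i (wk A) (wk c) (wk Y)"
    using t_all_read[OF A1 Y1 t_all_look[OF A1 Y1 h1]] by simp
  show "exo_eq ?N (App Exo (wk (tower_fam i A c Y)) (Var 0)) (App Exo (wk ?r) (Var 0))
    (App Exo (wk h) (Var 0))"
  proof (rule exo_eq_conv[OF read_look_elim[OF A1 n Y1 h1 read_look[OF A1 n]]])
    show "App Exo (lev i (wk A) (wk c) (Var 0)) (wk Y) \<cong> App Exo (wk (tower_fam i A c Y)) (Var 0)"
      using conv_sym[OF conv_tower_fam_App] by simp
    show "App Exo (App Exo (read i (wk A) (wk c) (Var 0)) (wk Y))
      (all_look i (wk A) (wk c) (wk Y) (wk h))
        \<cong> App Exo (wk ?r) (Var 0)"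
      using conv_sym[OF conv_all_read_App] by simp
    show "App Exo (wk h) (Var 0) \<cong> App Exo (wk h) (Var 0)" by (rule conv_refl)
    show "isty ?N (App Exo (wk (tower_fam i A c Y)) (Var 0))"
      using isty_Inner[OF tUniv_App[OF t_tower_fam[OF A1 Y1] n]] by simp
    show "?N \<turnstile> App Exo (wk ?r) (Var 0) \<Ztypecolon> App Exo (wk (tower_fam i A c Y)) (Var 0)"
      using sections_App[OF r1 n] by simp
    show "?N \<turnstile> App Exo (wk h) (Var 0) \<Ztypecolon> App Exo (wk (tower_fam i A c Y)) (Var 0)"
      using sections_App[OF h1 n] by simp
  qed
qed

section \<open>Evaluation after restriction, by induction on the list\<close>

definition look_read_ty :: "nat \<Rightarrow> tm \<Rightarrow> tm \<Rightarrow> tm \<Rightarrow> tm" where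
  "look_read_ty i A c l = Pi Exo (fams i A) (Pi Exo (sections (List (wk A)) (Var 0))
     (Eq Exo (App Exo (Var 1) (wk (wk l)))
       (App Exo (App Exo (look i (wk (wk A)) (wk (wk c)) (wk (wk l))) (Var 1))
         (all_read i (wk (wk A)) (wk (wk c)) (Var 1) (Var 0)))
       (App Exo (Var 0) (wk (wk l)))))"

lemma subst_look_read_ty [simp]:
  "subst \<sigma> (look_read_ty i A c n) = look_read_ty i (subst \<sigma> A) (subst \<sigma> c) (subst \<sigma> n)"
  by (simp add: look_read_ty_def)

lemma ren_look_read_ty [simp]:
  "ren r (look_read_ty i A c n) = look_read_ty i (ren r A) (ren r c) (ren r n)"
  by (simp add: look_read_ty_def)

lemma t_look_all_read:
  assumes A: "cofib i \<Gamma> A c" and l: "\<Gamma> \<turnstile> l \<Ztypecolon> List A" and Y: "\<Gamma> \<turnstile> Y \<Ztypecolon> fams i A"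
    and f: "\<Gamma> \<turnstile> f \<Ztypecolon> sections (List A) Y"
  shows "\<Gamma> \<turnstile> App Exo (App Exo (look i A c l) Y) (all_read i A c Y f) \<Ztypecolon> App Exo Y l"
  by (rule t_look_App[OF t_look[OF A l] Y t_all_read[OF A Y f]])

lemma isty_look_read_ty:
  assumes A: "cofib i \<Gamma> A c" and l: "\<Gamma> \<turnstile> l \<Ztypecolon> List A"
  shows "isty \<Gamma> (look_read_ty i A c l)"
proof -
  note D = fams_section_ctx[OF A] and l2 = fams_section_ctx(5)[OF A l]
  show ?thesis
    unfolding look_read_ty_def
    by (rule isty_Pi[OF isty_fams[OF A] isty_Pi[OF typing_Lam_ctx[OF D(3)] isty_Eq[OF
        isty_Inner[OF tUniv_App[OF D(2) l2]] t_look_all_read[OF D(1) l2 D(2,3)]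
        sections_App[OF D(3) l2]]]])
qed

lemma look_read_elim:
  assumes A: "cofib i \<Gamma> A c" and l: "\<Gamma> \<turnstile> l \<Ztypecolon> List A" and Y: "\<Gamma> \<turnstile> Y \<Ztypecolon> fams i A"
    and f: "\<Gamma> \<turnstile> f \<Ztypecolon> sections (List A) Y" and e: "inhab \<Gamma> (look_read_ty i A c l)"
  shows "exo_eq \<Gamma> (App Exo Y l) (App Exo (App Exo (look i A c l) Y) (all_read i A c Y f))
    (App Exo f l)"
proof -
  have "inhab \<Gamma> (Eq Exo (App Exo Y l)
      (App Exo (App Exo (look i A c l) Y) (all_read i A c Y f)) (App Exo f l))"
    by (rule inhab_App[OF inhab_App[OF e[unfolded look_read_ty_def] Y refl, simplified] f]) simp
  then show ?thesis
    using isty_Inner[OF tUniv_App[OF Y l]] t_look_all_read[OF A l Y f] sections_App[OF f l]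
    by (simp add: exo_eq_def)
qed

lemma look_read_intro:
  assumes A: "cofib i \<Gamma> A c" and l: "\<Gamma> \<turnstile> l \<Ztypecolon> List A"
    and e: "exo_eq (sections (List (wk A)) (Var 0) # fams i A # \<Gamma>)
      (App Exo (Var 1) (wk (wk l)))
      (App Exo (App Exo (look i (wk (wk A)) (wk (wk c)) (wk (wk l))) (Var 1))
        (all_read i (wk (wk A)) (wk (wk c)) (Var 1) (Var 0)))
      (App Exo (Var 0) (wk (wk l)))"
  shows "inhab \<Gamma> (look_read_ty i A c l)"
  using isty_look_read_ty[OF A l] e unfolding look_read_ty_def
  by (intro inhab_Lam) (auto simp: exo_eq_def isty_Pi_iff)

lemma look_read_LNil:
  assumes A: "cofib i \<Gamma> A c" and Y: "\<Gamma> \<turnstile> Y \<Ztypecolon> fams i A"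
    and f: "\<Gamma> \<turnstile> f \<Ztypecolon> sections (List A) Y"
  shows "exo_eq \<Gamma> (App Exo Y LNil) (App Exo (App Exo (look i A c LNil) Y) (all_read i A c Y f))
    (App Exo f LNil)"
proof -
  have l: "\<Gamma> \<turnstile> LNil \<Ztypecolon> List A" by (rule tLNil[OF cofib_isty[OF A]])
  have "App Exo (App Exo (look i A c LNil) Y) (all_read i A c Y f) \<cong> App Exo f LNil"
    by (rule conv_trans[OF conv_look_LNil conv_trans[OF conv_all_read_App conv_read_NZero]])
  then show ?thesis
    by (rule exo_eqI_conv[OF isty_Inner[OF tUniv_App[OF Y l]] t_look_all_read[OF A l Y f]
      sections_App[OF f l]])
qed

text \<open>The component at \<open>n + 1\<close> is an image under \<open>cof_to\<close>, and
  peeling applies \<open>cof_from\<close> to it. The two cancel, and the value at \<open>a\<close>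
  of the function that remains is the restriction of \<open>tail f a\<close>.\<close>

lemma peel_all_read_App:
  assumes A: "cofib i \<Gamma> A c" and Y: "\<Gamma> \<turnstile> Y \<Ztypecolon> fams i A"
    and f: "\<Gamma> \<turnstile> f \<Ztypecolon> sections (List A) Y" and a: "\<Gamma> \<turnstile> a \<Ztypecolon> A" and n: "\<Gamma> \<turnstile> n \<Ztypecolon> Nat Exo"
  shows "exo_eq \<Gamma> (App Exo (tower_fam i A c (tail Y a)) n)
    (App Exo (peel i A c a Y (all_read i A c Y f)) n)
    (App Exo (all_read i A c (tail Y a) (tail f a)) n)"
proof -
  define S where "S = step_fam (lev i A c n) Y"
  let ?G = "Lam Exo (App Exo (App Exo (wk (read i A c n)) (tail (wk Y) (Var 0)))
    (tail (wk f) (Var 0)))"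
  have A0: "isty \<Gamma> A" using A by (rule cofib_isty)
  have S: "\<Gamma> \<turnstile> S \<Ztypecolon> Arr Exo A (Univ Inner i)"
    unfolding S_def by (rule t_step_fam[OF A0 t_lev[OF A n] Y])
  have G: "\<Gamma> \<turnstile> ?G \<Ztypecolon> sections A S"
    unfolding S_def by (rule t_read_step_arg[OF A n t_read[OF A n] Y f])
  have Ya: "\<Gamma> \<turnstile> tail Y a \<Ztypecolon> fams i A" by (rule t_tail_fam[OF A0 Y a])
  note r = t_all_read[OF A Y f]
  have "exo_eq \<Gamma> (App Exo S a) (App Exo (App Exo (cof_from i A c S) (App Exo (cof_to i A c S) ?G))
    a) (App Exo ?G a)"
    by (rule exo_eq_sections_App[OF cofib_elim(5)[OF A A S G] a])
  then show ?thesis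
  proof (rule exo_eq_conv)
    show "App Exo S a \<cong> App Exo (tower_fam i A c (tail Y a)) n"
      unfolding S_def by (rule conv_trans[OF conv_step_fam_App conv_sym[OF conv_tower_fam_App]])
    have "App Exo (all_read i A c Y f) (NSuc Exo n) \<cong> App Exo (cof_to i A c S) ?G"
      unfolding S_def using conv_trans[OF conv_all_read_App
        conv_read_NSuc[unfolded read_step_def]] .
    then have "App Exo (peel i A c a Y (all_read i A c Y f)) n
        \<cong> App Exo (App Exo (cof_from i A c S) (App Exo (cof_to i A c S) ?G)) a"
      using conv_peel_App unfolding S_def by (blast intro: conv_trans cong_App conv_refl)
    then show "App Exo (App Exo (cof_from i A c S) (App Exo (cof_to i A c S) ?G)) a
        \<cong> App Exo (peel i A c a Y (all_read i A c Y f)) n" by (rule conv_sym)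
    have "App Exo ?G a \<cong> App Exo (App Exo (read i A c n) (tail Y a)) (tail f a)"
      by (rule conv_beta) simp
    then show "App Exo ?G a \<cong> App Exo (all_read i A c (tail Y a) (tail f a)) n"
      by (rule conv_trans[OF _ conv_sym[OF conv_all_read_App]])
    show "isty \<Gamma> (App Exo (tower_fam i A c (tail Y a)) n)"
      by (rule isty_Inner[OF tUniv_App[OF t_tower_fam[OF A Ya] n]])
    show "\<Gamma> \<turnstile> App Exo (peel i A c a Y (all_read i A c Y f)) n \<Ztypecolon> App Exo
      (tower_fam i A c (tail Y a)) n"
      by (rule sections_App[OF t_peel[OF A a Y r] n])
    show "\<Gamma> \<turnstile> App Exo (all_read i A c (tail Y a) (tail f a)) n \<Ztypecolon> App Exo
      (tower_fam i A c (tail Y a)) n"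
      by (rule sections_App[OF t_all_read[OF A Ya t_tail[OF A0 Y a f]] n])
  qed
qed

lemma peel_all_read:
  assumes A: "cofib i \<Gamma> A c" and Y: "\<Gamma> \<turnstile> Y \<Ztypecolon> fams i A"
    and f: "\<Gamma> \<turnstile> f \<Ztypecolon> sections (List A) Y" and a: "\<Gamma> \<turnstile> a \<Ztypecolon> A"
  shows "exo_eq \<Gamma> (tower i A c (tail Y a)) (peel i A c a Y (all_read i A c Y f))
    (all_read i A c (tail Y a) (tail f a))"
proof (rule sections_ext)
  have A0: "isty \<Gamma> A" using A by (rule cofib_isty)
  have Ya: "\<Gamma> \<turnstile> tail Y a \<Ztypecolon> fams i A" by (rule t_tail_fam[OF A0 Y a])
  show "isty \<Gamma> (Nat Exo)" by (rule isty_Nat[OF cofib_ctx[OF A]])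
  show "\<Gamma> \<turnstile> tower_fam i A c (tail Y a) \<Ztypecolon> Arr Exo (Nat Exo) (Univ Inner i)"
    by (rule t_tower_fam[OF A Ya])
  show "\<Gamma> \<turnstile> peel i A c a Y (all_read i A c Y f) \<Ztypecolon> tower i A c (tail Y a)"
    by (rule t_peel[OF A a Y t_all_read[OF A Y f]])
  show "\<Gamma> \<turnstile> all_read i A c (tail Y a) (tail f a) \<Ztypecolon> tower i A c (tail Y a)"
    by (rule t_all_read[OF A Ya t_tail[OF A0 Y a f]])
  let ?N = "Nat Exo # \<Gamma>"
  have c: "ctx ?N" using cofib_ctx[OF A] by (intro isty_ctx isty_Nat)
  have n: "?N \<turnstile> Var 0 \<Ztypecolon> Nat Exo" using var_0[OF c] by simp
  have Y1: "?N \<turnstile> wk Y \<Ztypecolon> fams i (wk A)" using typing_wk[OF Y c] by simp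
  have f1: "?N \<turnstile> wk f \<Ztypecolon> sections (List (wk A)) (wk Y)" using typing_wk[OF f c] by simp
  show "exo_eq ?N (App Exo (wk (tower_fam i A c (tail Y a))) (Var 0))
      (App Exo (wk (peel i A c a Y (all_read i A c Y f))) (Var 0))
      (App Exo (wk (all_read i A c (tail Y a) (tail f a))) (Var 0))"
    using peel_all_read_App[OF cofib_wk[OF A c] Y1 f1 typing_wk[OF a c] n] by simp
qed

text \<open>Evaluation at \<open>a :: l\<close> is evaluation at \<open>l\<close> of the peeled
  point. Peeling the restrictions of \<open>f\<close> gives the restrictions of
  \<open>tail f a\<close>, so the hypothesis for \<open>l\<close> yields \<open>tail f a\<close> at
  \<open>l\<close>, which computes to \<open>f (a :: l)\<close>.\<close>

lemma look_read_LCons: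
  assumes A: "cofib i \<Gamma> A c" and a: "\<Gamma> \<turnstile> a \<Ztypecolon> A" and l: "\<Gamma> \<turnstile> l \<Ztypecolon> List A"
    and Y: "\<Gamma> \<turnstile> Y \<Ztypecolon> fams i A" and f: "\<Gamma> \<turnstile> f \<Ztypecolon> sections (List A) Y"
    and e: "inhab \<Gamma> (look_read_ty i A c l)"
  shows "exo_eq \<Gamma> (App Exo Y (LCons a l))
    (App Exo (App Exo (look i A c (LCons a l)) Y) (all_read i A c Y f)) (App Exo f (LCons a l))"
proof -
  have A0: "isty \<Gamma> A" using A by (rule cofib_isty)
  have al: "\<Gamma> \<turnstile> LCons a l \<Ztypecolon> List A" by (rule tLCons[OF A0 a l])
  have Ya: "\<Gamma> \<turnstile> tail Y a \<Ztypecolon> fams i A" by (rule t_tail_fam[OF A0 Y a])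
  have T: "isty \<Gamma> (App Exo (tail Y a) l)" by (rule isty_Inner[OF tUniv_App[OF Ya l]])
  \<comment> \<open>With the family fixed, evaluation at \<open>l\<close> is a non-dependent
    function of the point; the exo-equality of points can therefore be carried through it by
    congruence, without transport.\<close>
  have b: "\<Gamma> \<turnstile> App Exo (look i A c l) (tail Y a) \<Ztypecolon> Arr Exo (tower i A c (tail Y a))
    (App Exo (tail Y a) l)"
    by (rule tApp[OF t_look[OF A l, unfolded look_ty_def] Ya]) simp
  have "exo_eq \<Gamma> (App Exo (tail Y a) l)
      (App Exo (App Exo (look i A c l) (tail Y a)) (peel i A c a Y (all_read i A c Y f)))
      (App Exo (tail f a) l)"
    by (rule exo_eq_trans[OF exo_eq_App[OF peel_all_read[OF A Y f a] b T]
          look_read_elim[OF A l Ya t_tail[OF A0 Y a f] e]])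
  then show ?thesis
    by (rule exo_eq_conv[OF _ conv_tail_App conv_sym[OF conv_look_LCons[unfolded look_step_def]]
      conv_tail_App
        isty_Inner[OF tUniv_App[OF Y al]] t_look_all_read[OF A al Y f] sections_App[OF f al]])
qed

lemma look_read:
  assumes A: "cofib i \<Gamma> A c" and l: "\<Gamma> \<turnstile> l \<Ztypecolon> List A"
  shows "inhab \<Gamma> (look_read_ty i A c l)"
proof -
  let ?C = "look_read_ty i (wk A) (wk c) (Var 0)"
  have L: "isty \<Gamma> (List A)" using cofib_isty[OF A] by (rule isty_List)
  have c1: "ctx (List A # \<Gamma>)" using L by (rule isty_ctx)
  have C: "isty (List A # \<Gamma>) ?C"
    using var_0[OF c1] by (intro isty_look_read_ty cofib_wk[OF A c1]) simp
  have "inhab \<Gamma> (inst ?C l)"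
  proof (rule inhab_ListInd[OF C _ _ l])
    note D = fams_section_ctx[OF A]
    have "inhab \<Gamma> (look_read_ty i A c LNil)"
      using look_read_LNil[OF D(1-3)] by (intro look_read_intro[OF A tLNil[OF cofib_isty[OF A]]])
        simp
    then show "inhab \<Gamma> (inst ?C LNil)" by simp
    have ca: "ctx (A # \<Gamma>)" by (rule isty_ctx[OF cofib_isty[OF A]])
    note A1 = cofib_wk[OF A ca]
    have c2: "ctx (wk (List A) # A # \<Gamma>)" by (rule isty_ctx[OF isty_wk[OF L ca]])
    note A2 = cofib_wk[OF A1 c2]
    let ?I = "look_read_ty i (wk (wk A)) (wk (wk c)) (Var 0)"
    have c3: "ctx (?I # wk (List A) # A # \<Gamma>)"
      using var_0[OF c2] by (intro isty_ctx isty_look_read_ty[OF A2]) simp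
    note A3 = cofib_wk[OF A2 c3]
    let ?\<Delta> = "?I # wk (List A) # A # \<Gamma>"
    let ?A = "wk (wk (wk A))" and ?c = "wk (wk (wk c))"
    have l: "?\<Delta> \<turnstile> Var 1 \<Ztypecolon> List ?A" using var_Suc[OF var_0[OF c2] c3] by simp
    have a: "?\<Delta> \<turnstile> Var 2 \<Ztypecolon> ?A"
      using var_Suc[OF var_Suc[OF var_0[OF ca] c2] c3] by (simp add: eval_nat_numeral)
    have IH: "inhab ?\<Delta> (look_read_ty i ?A ?c (Var 1))" using inhab_var_0[OF c3] by simp
    note D = fams_section_ctx[OF A3]
    \<comment> \<open>As before, the hypothesis is weakened past the bound family and section so
      that it can be applied to their tails.\<close>
    have IH2: "inhab (sections (List (wk ?A)) (Var 0) # fams i ?A # ?\<Delta>)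
        (look_read_ty i (wk (wk ?A)) (wk (wk ?c)) (wk (wk (Var 1))))"
      using IH D(4) unfolding inhab_def by fastforce
    have "inhab ?\<Delta> (look_read_ty i ?A ?c (LCons (Var 2) (Var 1)))"
      using look_read_LCons[OF D(1) D(4)[OF a] D(5)[OF l] D(2,3) IH2]
      by (intro look_read_intro[OF A3 tLCons[OF cofib_isty[OF A3] a l]]) simp
    then show "inhab (subst (Var 0 \<cdot> shifted 2) ?C # wk (List A) # A # \<Gamma>)
        (subst (LCons (Var 2) (Var 1) \<cdot> shifted 3) ?C)" by simp
  qed
  then show ?thesis by simp
qed

lemma all_look_all_read:
  assumes A: "cofib i \<Gamma> A c" and Y: "\<Gamma> \<turnstile> Y \<Ztypecolon> fams i A" and f: "\<Gamma> \<turnstile> f \<Ztypecolon> sections (List A) Y"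
  shows "exo_eq \<Gamma> (sections (List A) Y) (all_look i A c Y (all_read i A c Y f)) f"
proof (rule sections_ext[OF isty_List[OF cofib_isty[OF A]] Y
  t_all_look[OF A Y t_all_read[OF A Y f]] f])
  let ?N = "List A # \<Gamma>"
  let ?r = "all_look i A c Y (all_read i A c Y f)"
  have c: "ctx ?N" using cofib_isty[OF A] by (intro isty_ctx isty_List)
  note A1 = cofib_wk[OF A c]
  have l: "?N \<turnstile> Var 0 \<Ztypecolon> List (wk A)" using var_0[OF c] by simp
  have Y1: "?N \<turnstile> wk Y \<Ztypecolon> fams i (wk A)" using typing_wk[OF Y c] by simp
  have f1: "?N \<turnstile> wk f \<Ztypecolon> sections (List (wk A)) (wk Y)" using typing_wk[OF f c] by simp
  show "exo_eq ?N (App Exo (wk Y) (Var 0)) (App Exo (wk ?r) (Var 0)) (App Exo (wk f) (Var 0))"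
  proof (rule exo_eq_conv[OF look_read_elim[OF A1 l Y1 f1 look_read[OF A1 l]] conv_refl _
    conv_refl])
    show "App Exo (App Exo (look i (wk A) (wk c) (Var 0)) (wk Y))
      (all_read i (wk A) (wk c) (wk Y) (wk f))
        \<cong> App Exo (wk ?r) (Var 0)"
      using conv_sym[OF conv_all_look_App] by simp
    show "isty ?N (App Exo (wk Y) (Var 0))" by (rule isty_Inner[OF tUniv_App[OF Y1 l]])
    show "?N \<turnstile> App Exo (wk ?r) (Var 0) \<Ztypecolon> App Exo (wk Y) (Var 0)"
      using sections_App[OF t_all_look[OF A1 Y1 t_all_read[OF A1 Y1 f1]] l] by simp
    show "?N \<turnstile> App Exo (wk f) (Var 0) \<Ztypecolon> App Exo (wk Y) (Var 0)" by (rule sections_App[OF f1 l])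
  qed
qed

subsection \<open>Contractibility\<close>

lemma contr_family_App:
  "inhab \<Gamma> (contr_family A Y) \<Longrightarrow> \<Gamma> \<turnstile> a \<Ztypecolon> A \<Longrightarrow> inhab \<Gamma> (is_contr (App Exo Y a))"
  unfolding contr_family_def by (erule inhab_App) simp_all

lemma contr_conv:
  "inhab \<Gamma> (is_contr A) \<Longrightarrow> A \<cong> B \<Longrightarrow> \<Gamma> \<turnstile> B \<Ztypecolon> Univ Inner i \<Longrightarrow> inhab \<Gamma> (is_contr B)"
  by (rule inhab_conv) (auto intro: conv_is_contr isty_Inner t_is_contr)

text \<open>\<open>B\<close> is left free because the fibres are obtained in beta-reduced form,
  whereas the family is an abstraction applied to a variable.\<close>

lemma contr_familyI:
  assumes Y: "\<Gamma> \<turnstile> Y \<Ztypecolon> Arr Exo A (Univ Inner i)" and A: "isty \<Gamma> A"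
    and k: "inhab (A # \<Gamma>) (is_contr B)" and B: "B \<cong> App Exo (wk Y) (Var 0)"
  shows "inhab \<Gamma> (contr_family A Y)"
proof -
  have c: "ctx (A # \<Gamma>)" using A by (rule isty_ctx)
  have "A # \<Gamma> \<turnstile> wk Y \<Ztypecolon> Arr Exo (wk A) (Univ Inner i)" using typing_wk[OF Y c] by simp
  then have t: "A # \<Gamma> \<turnstile> App Exo (wk Y) (Var 0) \<Ztypecolon> Univ Inner i" by (rule tUniv_App[OF _ var_0[OF c]])
  show ?thesis
    unfolding contr_family_def by (rule inhab_Lam[OF contr_conv[OF k B t]
      isty_Inner[OF t_is_contr[OF t]]])
qed

lemma contr_family_tail:
  assumes A: "isty \<Gamma> A" and Y: "\<Gamma> \<turnstile> Y \<Ztypecolon> fams i A" and a: "\<Gamma> \<turnstile> a \<Ztypecolon> A"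
    and k: "inhab \<Gamma> (contr_family (List A) Y)"
  shows "inhab \<Gamma> (contr_family (List A) (tail Y a))"
proof (rule contr_familyI[OF t_tail_fam[OF A Y a] isty_List[OF A]])
  have c: "ctx (List A # \<Gamma>)" using A by (intro isty_ctx isty_List)
  have "List A # \<Gamma> \<turnstile> LCons (wk a) (Var 0) \<Ztypecolon> List (wk A)"
    using isty_wk[OF A c] typing_wk[OF a c] var_0[OF c] by (simp add: tLCons)
  then show "inhab (List A # \<Gamma>) (is_contr (App Exo (wk Y) (LCons (wk a) (Var 0))))"
    using inhab_wk[OF k c] by (simp add: contr_family_App)
  show "App Exo (wk Y) (LCons (wk a) (Var 0)) \<cong> App Exo (wk (tail Y a)) (Var 0)"
    using conv_sym[OF conv_tail_App] by simp
qed

text \<open>The family and the contractibility of its fibres are both part of the induction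
  statement, as the step uses it for \<open>tail Y a\<close>.\<close>

definition lev_contr_ty :: "nat \<Rightarrow> tm \<Rightarrow> tm \<Rightarrow> tm \<Rightarrow> tm" where
  "lev_contr_ty i A c n = Pi Exo (fams i A) (Arr Exo (contr_family (List (wk A)) (Var 0))
     (is_contr (App Exo (lev i (wk A) (wk c) (wk n)) (Var 0))))"

lemma subst_lev_contr_ty [simp]:
  "subst \<sigma> (lev_contr_ty i A c n) = lev_contr_ty i (subst \<sigma> A) (subst \<sigma> c) (subst \<sigma> n)"
  by (simp add: lev_contr_ty_def)

lemma ren_lev_contr_ty [simp]:
  "ren r (lev_contr_ty i A c n) = lev_contr_ty i (ren r A) (ren r c) (ren r n)"
  by (simp add: lev_contr_ty_def)

lemma fams_contr_ctx:
  assumes A: "cofib i \<Gamma> A c" 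
  shows "cofib i (fams i A # \<Gamma>) (wk A) (wk c)"
    "fams i A # \<Gamma> \<turnstile> Var 0 \<Ztypecolon> fams i (wk A)"
    "cofib i (contr_family (List (wk A)) (Var 0) # fams i A # \<Gamma>) (wk (wk A)) (wk (wk c))"
    "contr_family (List (wk A)) (Var 0) # fams i A # \<Gamma> \<turnstile> Var 1 \<Ztypecolon> fams i (wk (wk A))"
    "inhab (contr_family (List (wk A)) (Var 0) # fams i A # \<Gamma>)
      (contr_family (List (wk (wk A))) (Var 1))"
    "ctx (contr_family (List (wk A)) (Var 0) # fams i A # \<Gamma>)"
    "ctx (fams i A # \<Gamma>)"
proof -
  show c1: "ctx (fams i A # \<Gamma>)" using A by (intro isty_ctx isty_fams)
  show A1: "cofib i (fams i A # \<Gamma>) (wk A) (wk c)" by (rule cofib_wk[OF A c1])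
  show Y: "fams i A # \<Gamma> \<turnstile> Var 0 \<Ztypecolon> fams i (wk A)" using var_0[OF c1] by simp
  show c2: "ctx (contr_family (List (wk A)) (Var 0) # fams i A # \<Gamma>)"
    by (rule isty_ctx[OF isty_contr_family[OF isty_List[OF cofib_isty[OF A1]] Y]])
  show "cofib i (contr_family (List (wk A)) (Var 0) # fams i A # \<Gamma>) (wk (wk A)) (wk (wk c))"
    by (rule cofib_wk[OF A1 c2])
  show "contr_family (List (wk A)) (Var 0) # fams i A # \<Gamma> \<turnstile> Var 1 \<Ztypecolon> fams i (wk (wk A))"
    using var_Suc[OF Y c2] by simp
  show "inhab (contr_family (List (wk A)) (Var 0) # fams i A # \<Gamma>)
    (contr_family (List (wk (wk A))) (Var 1))"
    using inhab_var_0[OF c2] by simp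
qed

lemma lev_contr_elim:
  assumes e: "inhab \<Gamma> (lev_contr_ty i A c n)" and Y: "\<Gamma> \<turnstile> Y \<Ztypecolon> fams i A"
    and k: "inhab \<Gamma> (contr_family (List A) Y)"
  shows "inhab \<Gamma> (is_contr (App Exo (lev i A c n) Y))"
proof -
  have "inhab \<Gamma> (Arr Exo (contr_family (List A) Y) (is_contr (App Exo (lev i A c n) Y)))"
    by (rule inhab_App[OF e[unfolded lev_contr_ty_def] Y]) simp
  then show ?thesis using k by (rule inhab_mp)
qed

lemma isty_lev_contr:
  assumes A: "cofib i \<Gamma> A c" and n: "\<Gamma> \<turnstile> n \<Ztypecolon> Nat Exo"
  shows "isty (fams i A # \<Gamma>) (is_contr (App Exo (lev i (wk A) (wk c) (wk n)) (Var 0)))"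
proof -
  note D = fams_contr_ctx[OF A]
  have "fams i A # \<Gamma> \<turnstile> wk n \<Ztypecolon> Nat Exo" using typing_wk[OF n D(7)] by simp
  then show ?thesis by (rule isty_Inner[OF t_is_contr[OF t_lev_App[OF D(1) _ D(2)]]])
qed

lemma isty_lev_contr_ty:
  assumes A: "cofib i \<Gamma> A c" and n: "\<Gamma> \<turnstile> n \<Ztypecolon> Nat Exo"
  shows "isty \<Gamma> (lev_contr_ty i A c n)"
  unfolding lev_contr_ty_def
  by (rule isty_Pi[OF isty_fams[OF A] isty_Arr[OF ctx_isty[OF fams_contr_ctx(6)[OF A]]
    isty_lev_contr[OF A n]]])

lemma lev_contr_intro:
  assumes A: "cofib i \<Gamma> A c" and n: "\<Gamma> \<turnstile> n \<Ztypecolon> Nat Exo"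
    and e: "inhab (contr_family (List (wk A)) (Var 0) # fams i A # \<Gamma>)
      (is_contr (App Exo (lev i (wk (wk A)) (wk (wk c)) (wk (wk n))) (Var 1)))"
  shows "inhab \<Gamma> (lev_contr_ty i A c n)"
proof -
  have "inhab (fams i A # \<Gamma>) (Arr Exo (contr_family (List (wk A)) (Var 0))
     (is_contr (App Exo (lev i (wk A) (wk c) (wk n)) (Var 0))))"
    using e by (intro inhab_Arr isty_lev_contr[OF A n]) simp
  then show ?thesis
    unfolding lev_contr_ty_def
    by (rule inhab_Lam) (rule isty_Arr[OF ctx_isty[OF fams_contr_ctx(6)[OF A]]
      isty_lev_contr[OF A n]])
qed

lemma lev_contr_NZero:
  assumes A: "cofib i \<Gamma> A c" and Y: "\<Gamma> \<turnstile> Y \<Ztypecolon> fams i A"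
    and k: "inhab \<Gamma> (contr_family (List A) Y)"
  shows "inhab \<Gamma> (is_contr (App Exo (lev i A c (NZero Exo)) Y))"
  by (rule contr_conv[OF contr_family_App[OF k tLNil[OF cofib_isty[OF A]]]
    conv_sym[OF conv_lev_NZero]
        t_lev_App[OF A ty_NZero[OF cofib_ctx[OF A]] Y]])

text \<open>Each value \<open>T n (tail Y a)\<close> of the step family is contractible by the
  hypothesis, because \<open>tail Y a\<close> again has contractible fibres. The second clause in
  the cofibrancy of \<open>A\<close> passes this to the match, which computes to the next
  level.\<close>

lemma lev_contr_NSuc:
  assumes A: "cofib i \<Gamma> A c" and n: "\<Gamma> \<turnstile> n \<Ztypecolon> Nat Exo" and Y: "\<Gamma> \<turnstile> Y \<Ztypecolon> fams i A"
    and k: "inhab \<Gamma> (contr_family (List A) Y)" and e: "inhab \<Gamma> (lev_contr_ty i A c n)"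
  shows "inhab \<Gamma> (is_contr (App Exo (lev i A c (NSuc Exo n)) Y))"
proof -
  have A0: "isty \<Gamma> A" using A by (rule cofib_isty)
  have S: "\<Gamma> \<turnstile> step_fam (lev i A c n) Y \<Ztypecolon> Arr Exo A (Univ Inner i)"
    by (rule t_step_fam[OF A0 t_lev[OF A n] Y])
  have "inhab \<Gamma> (contr_family A (step_fam (lev i A c n) Y))"
  proof (rule contr_familyI[OF S A0])
    have c: "ctx (A # \<Gamma>)" using A0 by (rule isty_ctx)
    note A1 = cofib_wk[OF A c] and a = var_0[OF c]
    have Y1: "A # \<Gamma> \<turnstile> wk Y \<Ztypecolon> fams i (wk A)" using typing_wk[OF Y c] by simp
    have e1: "inhab (A # \<Gamma>) (lev_contr_ty i (wk A) (wk c) (wk n))" using inhab_wk[OF e c] by simp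
    have k1: "inhab (A # \<Gamma>) (contr_family (List (wk A)) (wk Y))" using inhab_wk[OF k c] by simp
    show "inhab (A # \<Gamma>) (is_contr (App Exo (lev i (wk A) (wk c) (wk n)) (tail (wk Y) (Var 0))))"
      by (rule lev_contr_elim[OF e1 t_tail_fam[OF cofib_isty[OF A1] Y1 a]
            contr_family_tail[OF cofib_isty[OF A1] Y1 a k1]])
    show "App Exo (lev i (wk A) (wk c) (wk n)) (tail (wk Y) (Var 0))
        \<cong> App Exo (wk (step_fam (lev i A c n) Y)) (Var 0)"
      using conv_sym[OF conv_step_fam_App] by simp
  qed
  from cofib_elim(6)[OF A A S this] show ?thesis
    by (rule contr_conv[OF _ conv_sym[OF conv_lev_NSuc] t_lev_App[OF A ty_NSuc[OF n] Y]])
qed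

lemma lev_contr:
  assumes A: "cofib i \<Gamma> A c" and n: "\<Gamma> \<turnstile> n \<Ztypecolon> Nat Exo"
  shows "inhab \<Gamma> (lev_contr_ty i A c n)"
proof -
  let ?C = "lev_contr_ty i (wk A) (wk c) (Var 0)"
  have c0: "ctx \<Gamma>" using A by (rule cofib_ctx)
  have c1: "ctx (Nat Exo # \<Gamma>)" using c0 by (intro isty_ctx isty_Nat)
  note A1 = cofib_wk[OF A c1]
  have m: "Nat Exo # \<Gamma> \<turnstile> Var 0 \<Ztypecolon> Nat Exo" using var_0[OF c1] by simp
  have C: "isty (Nat Exo # \<Gamma>) ?C" by (rule isty_lev_contr_ty[OF A1 m])
  have c2: "ctx (?C # Nat Exo # \<Gamma>)" using C by (rule isty_ctx)
  note A2 = cofib_wk[OF A1 c2]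
  have m2: "?C # Nat Exo # \<Gamma> \<turnstile> Var 1 \<Ztypecolon> Nat Exo" using var_Suc[OF m c2] by simp
  have IH: "inhab (?C # Nat Exo # \<Gamma>) (lev_contr_ty i (wk (wk A)) (wk (wk c)) (Var 1))"
    using inhab_var_0[OF c2] by simp
  have "inhab \<Gamma> (inst ?C n)"
  proof (rule inhab_NatInd[OF C _ _ n])
    note D = fams_contr_ctx[OF A]
    have "inhab \<Gamma> (lev_contr_ty i A c (NZero Exo))"
      using lev_contr_NZero[OF D(3-5)] by (intro lev_contr_intro[OF A ty_NZero[OF c0]]) simp
    then show "inhab \<Gamma> (inst ?C (NZero Exo))" by simp
    note D2 = fams_contr_ctx[OF A2]
    have "inhab (?C # Nat Exo # \<Gamma>) (lev_contr_ty i (wk (wk A)) (wk (wk c)) (NSuc Exo (Var 1)))"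
    proof (rule lev_contr_intro[OF A2 ty_NSuc[OF m2]])
      show "inhab (contr_family (List (wk (wk (wk A)))) (Var 0) # fams i (wk (wk A)) # ?C # Nat
        Exo # \<Gamma>)
          (is_contr (App Exo (lev i (wk (wk (wk (wk A)))) (wk (wk (wk (wk c))))
            (wk (wk (NSuc Exo (Var 1))))) (Var 1)))"
        \<comment> \<open>This is the equation for \<open>NSuc\<close>: once the weakenings are
          moved inside, the index is visibly a successor.\<close>
        unfolding ren.simps(20)
      proof (rule lev_contr_NSuc[OF D2(3) _ D2(4,5)])
        show "contr_family (List (wk (wk (wk A)))) (Var 0) # fams i (wk (wk A)) # ?C # Nat Exo # \<Gamma>
            \<turnstile> wk (wk (Var 1)) \<Ztypecolon> Nat Exo"
          using typing_wk[OF typing_wk[OF m2 D2(7)] D2(6)] by simp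
        show "inhab (contr_family (List (wk (wk (wk A)))) (Var 0) # fams i (wk (wk A)) # ?C # Nat
          Exo # \<Gamma>)
            (lev_contr_ty i (wk (wk (wk (wk A)))) (wk (wk (wk (wk c)))) (wk (wk (Var 1))))"
          using inhab_wk[OF inhab_wk[OF IH D2(7)] D2(6)] by simp
      qed
    qed
    then show "inhab (?C # Nat Exo # \<Gamma>) (subst (NSuc Exo (Var 1) \<cdot> shifted 2) ?C)" by simp
  qed
  then show ?thesis by simp
qed

subsection \<open>Cofibrancy of the exo-type of lists\<close>

definition list_match :: "nat \<Rightarrow> tm \<Rightarrow> tm \<Rightarrow> tm \<Rightarrow> tm \<Rightarrow> tm" where
  "list_match i A c d Y = cof_match i (Nat Exo) d (tower_fam i A c Y)"

definition list_to :: "nat \<Rightarrow> tm \<Rightarrow> tm \<Rightarrow> tm \<Rightarrow> tm \<Rightarrow> tm" where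
  "list_to i A c d Y = Lam Exo (App Exo
     (cof_to i (Nat Exo) (wk d) (tower_fam i (wk A) (wk c) (wk Y)))
     (all_read i (wk A) (wk c) (wk Y) (Var 0)))"

definition list_from :: "nat \<Rightarrow> tm \<Rightarrow> tm \<Rightarrow> tm \<Rightarrow> tm \<Rightarrow> tm" where
  "list_from i A c d Y = Lam Exo (all_look i (wk A) (wk c) (wk Y)
     (App Exo (cof_from i (Nat Exo) (wk d) (tower_fam i (wk A) (wk c) (wk Y))) (Var 0)))"

lemma ren_list_terms [simp]:
  "ren r (list_match i A c d Y) = list_match i (ren r A) (ren r c) (ren r d) (ren r Y)"
  "ren r (list_to i A c d Y) = list_to i (ren r A) (ren r c) (ren r d) (ren r Y)"
  "ren r (list_from i A c d Y) = list_from i (ren r A) (ren r c) (ren r d) (ren r Y)"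
  by (simp_all add: list_match_def list_to_def list_from_def)

lemma conv_list_to_App: "App Exo (list_to i A c d Y) f \<cong>
    App Exo (cof_to i (Nat Exo) d (tower_fam i A c Y)) (all_read i A c Y f)"
  unfolding list_to_def by (rule conv_beta) simp

lemma conv_list_from_App: "App Exo (list_from i A c d Y) x \<cong>
    all_look i A c Y (App Exo (cof_from i (Nat Exo) d (tower_fam i A c Y)) x)"
  unfolding list_from_def by (rule conv_beta) simp

lemma conv_all_read: "f \<cong> f' \<Longrightarrow> all_read i A c Y f \<cong> all_read i A c Y f'"
  unfolding all_read_def by (intro cong_Lam cong_App conv_refl conv_ren)

lemma conv_all_look: "f \<cong> f' \<Longrightarrow> all_look i A c Y f \<cong> all_look i A c Y f'"
  unfolding all_look_def by (intro cong_Lam cong_App conv_refl conv_ren)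

lemma t_list_to:
  assumes A: "cofib i \<Gamma> A c" and d: "cofib i \<Gamma> (Nat Exo) d" and Y: "\<Gamma> \<turnstile> Y \<Ztypecolon> fams i A"
  shows "\<Gamma> \<turnstile> list_to i A c d Y \<Ztypecolon> Arr Exo (sections (List A) Y) (list_match i A c d Y)"
  unfolding list_to_def
proof (rule tLam)
  have c: "ctx (sections (List A) Y # \<Gamma>)"
    by (rule isty_ctx[OF isty_sections[OF isty_List[OF cofib_isty[OF A]] Y]])
  note A1 = cofib_wk[OF A c]
  have d1: "cofib i (sections (List A) Y # \<Gamma>) (Nat Exo) (wk d)" using cofib_wk[OF d c] by simp
  have Y1: "sections (List A) Y # \<Gamma> \<turnstile> wk Y \<Ztypecolon> fams i (wk A)" using typing_wk[OF Y c] by simp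
  have f: "sections (List A) Y # \<Gamma> \<turnstile> Var 0 \<Ztypecolon> sections (List (wk A)) (wk Y)"
    using var_0[OF c] by simp
  note el = cofib_elim[OF d1 d1 t_tower_fam[OF A1 Y1]]
  show "sections (List A) Y # \<Gamma> \<turnstile> App Exo (cof_to i (Nat Exo) (wk d)
    (tower_fam i (wk A) (wk c) (wk Y)))
     (all_read i (wk A) (wk c) (wk Y) (Var 0)) \<Ztypecolon> wk (list_match i A c d Y)"
    using tArr_App[OF el(2) t_all_read[OF A1 Y1 f]] by (simp add: list_match_def)
  show "isty (sections (List A) Y # \<Gamma>) (wk (list_match i A c d Y))"
    using isty_Inner[OF el(1)] by (simp add: list_match_def)
qed

lemma t_list_match:
  assumes A: "cofib i \<Gamma> A c" and d: "cofib i \<Gamma> (Nat Exo) d" and Y: "\<Gamma> \<turnstile> Y \<Ztypecolon> fams i A"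
  shows "\<Gamma> \<turnstile> list_match i A c d Y \<Ztypecolon> Univ Inner i"
  unfolding list_match_def by (rule cofib_elim(1)[OF d d t_tower_fam[OF A Y]])

lemma t_list_from:
  assumes A: "cofib i \<Gamma> A c" and d: "cofib i \<Gamma> (Nat Exo) d" and Y: "\<Gamma> \<turnstile> Y \<Ztypecolon> fams i A"
  shows "\<Gamma> \<turnstile> list_from i A c d Y \<Ztypecolon> Arr Exo (list_match i A c d Y) (sections (List A) Y)"
  unfolding list_from_def
proof (rule tLam)
  let ?M = "list_match i A c d Y"
  have c: "ctx (?M # \<Gamma>)" by (rule isty_ctx[OF isty_Inner[OF t_list_match[OF A d Y]]])
  note A1 = cofib_wk[OF A c]
  have d1: "cofib i (?M # \<Gamma>) (Nat Exo) (wk d)" using cofib_wk[OF d c] by simp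
  have Y1: "?M # \<Gamma> \<turnstile> wk Y \<Ztypecolon> fams i (wk A)" using typing_wk[OF Y c] by simp
  have x: "?M # \<Gamma> \<turnstile> Var 0 \<Ztypecolon> cof_match i (Nat Exo) (wk d) (tower_fam i (wk A) (wk c) (wk Y))"
    using var_0[OF c] by (simp add: list_match_def)
  note el = cofib_elim[OF d1 d1 t_tower_fam[OF A1 Y1]]
  show "?M # \<Gamma> \<turnstile> all_look i (wk A) (wk c) (wk Y)
     (App Exo (cof_from i (Nat Exo) (wk d) (tower_fam i (wk A) (wk c) (wk Y))) (Var 0))
     \<Ztypecolon> wk (sections (List A) Y)"
    using t_all_look[OF A1 Y1 tArr_App[OF el(3) x]] by simp
  show "isty (?M # \<Gamma>) (wk (sections (List A) Y))"
    using isty_sections[OF isty_List[OF cofib_isty[OF A1]] Y1] by simp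
qed

lemma list_to_from:
  assumes A: "cofib i \<Gamma> A c" and d: "cofib i \<Gamma> (Nat Exo) d" and Y: "\<Gamma> \<turnstile> Y \<Ztypecolon> fams i A"
    and x: "\<Gamma> \<turnstile> x \<Ztypecolon> list_match i A c d Y"
  shows "exo_eq \<Gamma> (list_match i A c d Y) (App Exo (list_to i A c d Y)
    (App Exo (list_from i A c d Y) x)) x"
proof -
  note el = cofib_elim[OF d d t_tower_fam[OF A Y], folded list_match_def]
  let ?h = "App Exo (cof_from i (Nat Exo) d (tower_fam i A c Y)) x"
  have h: "\<Gamma> \<turnstile> ?h \<Ztypecolon> tower i A c Y" by (rule tArr_App[OF el(3) x])
  have M: "isty \<Gamma> (list_match i A c d Y)" by (rule isty_Inner[OF el(1)])
  have "exo_eq \<Gamma> (list_match i A c d Y)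
      (App Exo (cof_to i (Nat Exo) d (tower_fam i A c Y))
        (all_read i A c Y (all_look i A c Y ?h))) x"
    \<comment> \<open>Restriction after evaluation is cancelled inside the argument of
      \<open>cof_to\<close>; what is left is the round trip of the match over the
      exo-naturals.\<close>
    by (rule exo_eq_trans[OF exo_eq_App[OF all_read_all_look[OF A Y h] el(2) M] el(4)[OF x]])
  then show ?thesis
  proof (rule exo_eq_conv[OF _ conv_refl conv_sym conv_refl M _ x])
    show "App Exo (list_to i A c d Y) (App Exo (list_from i A c d Y) x)
      \<cong> App Exo (cof_to i (Nat Exo) d (tower_fam i A c Y)) (all_read i A c Y (all_look i A c Y ?h))"
      by (rule conv_trans[OF conv_list_to_App cong_App[OF conv_refl
        conv_all_read[OF conv_list_from_App]]])
    show "\<Gamma> \<turnstile> App Exo (list_to i A c d Y) (App Exo (list_from i A c d Y) x) \<Ztypecolon> list_match i A c d Y"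
      by (rule tArr_App[OF t_list_to[OF A d Y] tArr_App[OF t_list_from[OF A d Y] x]])
  qed
qed

lemma list_from_to:
  assumes A: "cofib i \<Gamma> A c" and d: "cofib i \<Gamma> (Nat Exo) d" and Y: "\<Gamma> \<turnstile> Y \<Ztypecolon> fams i A"
    and f: "\<Gamma> \<turnstile> f \<Ztypecolon> sections (List A) Y"
  shows "exo_eq \<Gamma> (sections (List A) Y) (App Exo (list_from i A c d Y)
    (App Exo (list_to i A c d Y) f)) f"
proof -
  note el = cofib_elim[OF d d t_tower_fam[OF A Y], folded list_match_def]
  let ?T = "tower_fam i A c Y"
  let ?h = "all_read i A c Y f"
  let ?h' = "App Exo (cof_from i (Nat Exo) d ?T) (App Exo (cof_to i (Nat Exo) d ?T) ?h)"
  have h: "\<Gamma> \<turnstile> ?h \<Ztypecolon> tower i A c Y" by (rule t_all_read[OF A Y f])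
  have S: "isty \<Gamma> (sections (List A) Y)"
    by (rule isty_sections[OF isty_List[OF cofib_isty[OF A]] Y])
  have c: "ctx (tower i A c Y # \<Gamma>)" by (rule isty_ctx[OF isty_tower[OF A Y]])
  have Y1: "tower i A c Y # \<Gamma> \<turnstile> wk Y \<Ztypecolon> fams i (wk A)" using typing_wk[OF Y c] by simp
  have h1: "tower i A c Y # \<Gamma> \<turnstile> Var 0 \<Ztypecolon> tower i (wk A) (wk c) (wk Y)" using var_0[OF c] by simp
  \<comment> \<open>The round trip of the match sits inside \<open>all_look\<close>, which is not an
    application of a function term to the point. It is therefore typed over a variable point, so
    that congruence can replace the argument.\<close>
  have "tower i A c Y # \<Gamma> \<turnstile> all_look i (wk A) (wk c) (wk Y) (Var 0) \<Ztypecolon> wk (sections (List A) Y)"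
    using t_all_look[OF cofib_wk[OF A c] Y1 h1] by simp
  from exo_eq_cong[OF el(5)[OF h] this S]
  have "exo_eq \<Gamma> (sections (List A) Y) (all_look i A c Y ?h') (all_look i A c Y ?h)" by simp
  then have "exo_eq \<Gamma> (sections (List A) Y) (all_look i A c Y ?h') f"
    by (rule exo_eq_trans[OF _ all_look_all_read[OF A Y f]])
  then show ?thesis
  proof (rule exo_eq_conv[OF _ conv_refl conv_sym conv_refl S _ f])
    show "App Exo (list_from i A c d Y) (App Exo (list_to i A c d Y) f) \<cong> all_look i A c Y ?h'"
      by (rule conv_trans[OF conv_list_from_App conv_all_look[OF
        cong_App[OF conv_refl conv_list_to_App]]])
    show "\<Gamma> \<turnstile> App Exo (list_from i A c d Y) (App Exo (list_to i A c d Y) f) \<Ztypecolon> sections (List A) Y"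
      by (rule tArr_App[OF t_list_from[OF A d Y] tArr_App[OF t_list_to[OF A d Y] f]])
  qed
qed

lemma list_fibrant:
  assumes A: "cofib i \<Gamma> A c" and d: "cofib i \<Gamma> (Nat Exo) d" and Y: "\<Gamma> \<turnstile> Y \<Ztypecolon> fams i A"
  shows "\<exists>e. \<Gamma> \<turnstile> Pair Exo (list_match i A c d Y) e \<Ztypecolon> is_fibrant i (sections (List A) Y)"
proof (rule is_fibrantI)
  show S: "isty \<Gamma> (sections (List A) Y)"
    by (rule isty_sections[OF isty_List[OF cofib_isty[OF A]] Y])
  show M: "\<Gamma> \<turnstile> list_match i A c d Y \<Ztypecolon> Univ Inner i" by (rule t_list_match[OF A d Y])
  show "\<Gamma> \<turnstile> list_to i A c d Y \<Ztypecolon> Arr Exo (sections (List A) Y) (list_match i A c d Y)"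
    by (rule t_list_to[OF A d Y])
  show "\<Gamma> \<turnstile> list_from i A c d Y \<Ztypecolon> Arr Exo (list_match i A c d Y) (sections (List A) Y)"
    by (rule t_list_from[OF A d Y])
  {
    have c: "ctx (list_match i A c d Y # \<Gamma>)" by (rule isty_ctx[OF isty_Inner[OF M]])
    have d1: "cofib i (list_match i A c d Y # \<Gamma>) (Nat Exo) (wk d)" using cofib_wk[OF d c] by simp
    have Y1: "list_match i A c d Y # \<Gamma> \<turnstile> wk Y \<Ztypecolon> fams i (wk A)" using typing_wk[OF Y c] by simp
    show "exo_eq (list_match i A c d Y # \<Gamma>) (wk (list_match i A c d Y))
      (App Exo (wk (list_to i A c d Y)) (App Exo (wk (list_from i A c d Y)) (Var 0))) (Var 0)"
      using list_to_from[OF cofib_wk[OF A c] d1 Y1] var_0[OF c] by simp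
  }
  {
    have c: "ctx (sections (List A) Y # \<Gamma>)" by (rule isty_ctx[OF S])
    have d1: "cofib i (sections (List A) Y # \<Gamma>) (Nat Exo) (wk d)" using cofib_wk[OF d c] by simp
    have Y1: "sections (List A) Y # \<Gamma> \<turnstile> wk Y \<Ztypecolon> fams i (wk A)" using typing_wk[OF Y c] by simp
    show "exo_eq (sections (List A) Y # \<Gamma>) (wk (sections (List A) Y))
      (App Exo (wk (list_from i A c d Y)) (App Exo (wk (list_to i A c d Y)) (Var 0))) (Var 0)"
      using list_from_to[OF cofib_wk[OF A c] d1 Y1] var_0[OF c] by simp
  }
qed

lemma list_match_contr:
  assumes A: "cofib i \<Gamma> A c" and d: "cofib i \<Gamma> (Nat Exo) d" and Y: "\<Gamma> \<turnstile> Y \<Ztypecolon> fams i A"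
    and k: "inhab \<Gamma> (contr_family (List A) Y)"
  shows "inhab \<Gamma> (is_contr (list_match i A c d Y))"
  unfolding list_match_def
proof (rule cofib_elim(6)[OF d d t_tower_fam[OF A Y] contr_familyI[OF t_tower_fam[OF A Y]
  cofib_isty[OF d]]])
  have c: "ctx (Nat Exo # \<Gamma>)" using cofib_ctx[OF A] by (intro isty_ctx isty_Nat)
  have n: "Nat Exo # \<Gamma> \<turnstile> Var 0 \<Ztypecolon> Nat Exo" using var_0[OF c] by simp
  have Y1: "Nat Exo # \<Gamma> \<turnstile> wk Y \<Ztypecolon> fams i (wk A)" using typing_wk[OF Y c] by simp
  have k1: "inhab (Nat Exo # \<Gamma>) (contr_family (List (wk A)) (wk Y))" using inhab_wk[OF k c] by simp
  show "inhab (Nat Exo # \<Gamma>) (is_contr (App Exo (lev i (wk A) (wk c) (Var 0)) (wk Y)))"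
    by (rule lev_contr_elim[OF lev_contr[OF cofib_wk[OF A c] n] Y1 k1])
  show "App Exo (lev i (wk A) (wk c) (Var 0)) (wk Y) \<cong> App Exo (wk (tower_fam i A c Y)) (Var 0)"
    using conv_sym[OF conv_tower_fam_App] by simp
qed

text \<open>The two components of the witness fit together by computation: the match extracted from
  the first one reduces to \<open>list_match\<close>, whose contractibility is known, so the second
  clause follows by conversion.\<close>

theorem list_cofibrant:
  assumes A: "cofib i \<Gamma> A c" and d: "cofib i \<Gamma> (Nat Exo) d"
  shows "inhab \<Gamma> (is_cofibrant i (List A))"
proof -
  let ?F = "fams i A"
  let ?M = "list_match i (wk A) (wk c) (wk d) (Var 0)"
  note D = fams_contr_ctx[OF A]
  have L: "isty \<Gamma> (List A)" by (rule isty_List[OF cofib_isty[OF A]])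
  have d1: "cofib i (?F # \<Gamma>) (Nat Exo) (wk d)" using cofib_wk[OF d D(7)] by simp
  have d2: "cofib i (contr_family (List (wk A)) (Var 0) # ?F # \<Gamma>) (Nat Exo) (wk (wk d))"
    using cofib_wk[OF d1 D(6)] by simp
  obtain e where e: "?F # \<Gamma> \<turnstile> Pair Exo ?M e \<Ztypecolon> is_fibrant i (sections (List (wk A)) (Var 0))"
    using list_fibrant[OF D(1) d1 D(2)] by blast
  \<comment> \<open>\<open>e\<close> is some term over the variable for the family, about which only
    its typing is known; the explicit first component \<open>?M\<close> is all that the clause on
    contractibility inspects.\<close>
  define f where "f = Lam Exo (Pair Exo ?M e)"
  have f: "\<Gamma> \<turnstile> f \<Ztypecolon> cof_fibrant i (List A)"
    unfolding f_def cof_fibrant_def using e isty_cof_fibrant[OF L, of i]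
    by (intro tLam) (simp_all add: cof_fibrant_def isty_Pi_iff)
  have cv: "?M \<cong> fibrant_match i (App Exo (wk f) (Var 0))"
  proof -
    have "App Exo (wk f) (Var 0) \<cong> Pair Exo ?M e"
      unfolding f_def ren.simps by (rule conv_beta) (simp only: subst.simps inst_wk_up)
    then have "fibrant_match i (App Exo (wk f) (Var 0)) \<cong> fibrant_match i (Pair Exo ?M e)"
      unfolding fibrant_match_def by (intro conv_cong conv_refl)
    also have "\<dots> \<cong> ?M" unfolding fibrant_match_alt by (rule pr1_Pair)
    finally show ?thesis by (rule conv_sym)
  qed
  \<comment> \<open>Contractibility is shown with the assumption on the fibres as a context entry,
    then discharged; the target does not mention that entry, so an arrow results.\<close>
  have "inhab (contr_family (List (wk A)) (Var 0) # ?F # \<Gamma>) (wk (is_contr ?M))"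
    using list_match_contr[OF D(3) d2 D(4,5)] by simp
  then have "inhab (?F # \<Gamma>) (Arr Exo (contr_family (List (wk A)) (Var 0)) (is_contr ?M))"
    by (rule inhab_Arr[OF _ isty_Inner[OF t_is_contr[OF t_list_match[OF D(1) d1 D(2)]]]])
  then have "inhab (?F # \<Gamma>) (Arr Exo (contr_family (List (wk A)) (Var 0))
      (is_contr (fibrant_match i (App Exo (wk f) (Var 0)))))"
    by (rule inhab_conv[OF _ cong_Pi[OF conv_refl conv_ren[OF conv_is_contr[OF cv]]]
          isty_cof_contr_body[OF L f, unfolded ren.simps(25)]])
  then have "inhab \<Gamma> (cof_contr i (List A) f)"
    using inhab_Lam[OF _ isty_cof_contr_body[OF L f]] by (simp add: cof_contr_def)
  then obtain g where g: "\<Gamma> \<turnstile> g \<Ztypecolon> cof_contr i (List A) f" unfolding inhab_def by blast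
  have "\<Gamma> \<turnstile> Pair Exo f g \<Ztypecolon> is_cofibrant i (List A)"
    using isty_is_cofibrant[OF L, of i] g unfolding is_cofibrant_alt
    by (intro tPair[OF _ f]) (simp_all add: isty_Sig_iff)
  then show ?thesis unfolding inhab_def by blast
qed

theorem proposition3p3:
  fixes i :: nat
  shows "\<exists>t. [] \<turnstile> t \<Ztypecolon>
    Pi Exo (Univ Exo i)
      (Arr Exo (is_cofibrant i (Var 0))
        (Arr Exo (is_cofibrant i (Nat Exo))
          (is_cofibrant i (List (Var 0)))))"
proof -
  let ?U = "Univ Exo i"
  have c1: "ctx [?U]" by (intro isty_ctx isty_Univ ctx_Nil)
  have A1: "isty [?U] (Var 0)" using var_0[OF c1] by (auto intro: isty_Exo)
  let ?C = "is_cofibrant i (Var 0)" and ?N = "is_cofibrant i (Nat Exo)"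
  have c2: "ctx [?C, ?U]" by (rule isty_ctx[OF isty_is_cofibrant[OF A1]])
  have A2: "cofib i [?C, ?U] (Var 1) (Var 0)"
    unfolding cofib_def using isty_wk[OF A1 c2] var_0[OF c2] by simp
  have c3: "ctx [?N, ?C, ?U]" by (rule isty_ctx[OF isty_is_cofibrant[OF isty_Nat[OF c2]]])
  \<comment> \<open>In the full context \<open>Var 2\<close> is \<open>A\<close>,
    \<open>Var 1\<close> its witness and \<open>Var 0\<close> the witness for the exo-naturals;
    discharging the assumptions lowers the index of \<open>A\<close> from 2 to 0.\<close>
  have A3: "cofib i [?N, ?C, ?U] (Var 2) (Var 1)"
    using cofib_wk[OF A2 c3] by (simp add: eval_nat_numeral)
  have d3: "cofib i [?N, ?C, ?U] (Nat Exo) (Var 0)"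
    unfolding cofib_def using isty_Nat[OF c3] var_0[OF c3] by simp
  have "inhab [?N, ?C, ?U] (is_cofibrant i (List (Var 2)))" by (rule list_cofibrant[OF A3 d3])
  then have "inhab [?C, ?U] (Arr Exo ?N (is_cofibrant i (List (Var 1))))"
    using isty_is_cofibrant[OF isty_List[OF cofib_isty[OF A2]]]
    by (intro inhab_Arr) (simp_all add: eval_nat_numeral)
  then have "inhab [?U] (Arr Exo ?C (Arr Exo ?N (is_cofibrant i (List (Var 0)))))"
    using isty_Arr[OF isty_is_cofibrant[OF isty_Nat[OF c1]] isty_is_cofibrant[OF isty_List[OF A1]]]
    by (intro inhab_Arr) simp_all
  then have "inhab [] (Pi Exo ?U (Arr Exo ?C (Arr Exo ?N (is_cofibrant i (List (Var 0))))))"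
    by (rule inhab_Lam)
      (rule isty_Arr[OF isty_is_cofibrant[OF A1] isty_Arr[OF isty_is_cofibrant[OF isty_Nat[OF c1]]
            isty_is_cofibrant[OF isty_List[OF A1]]]])
  then show ?thesis by (simp add: inhab_def)
qed

end
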